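(* Let $G$ be a separable unimodular locally compact group, let $\mathcal{H} \subset \mathrm{L}^2(G)$ be a closed subspace invariant under the left regular representation $\lambda_G$, let $p$ denote the orthogonal projection of $\mathrm{L}^2(G)$ onto $\mathcal{H}$ (so $p \in VN_r(G)$), and let $\pi$ denote the restriction of $\lambda_G$ to $\mathcal{H}$. Let $tr$ be the natural trace on $VN_r(G)^+$. Then: (a) There exists an admissible pair for $\mathcal{H}$ (i.e. for $\pi$) if and only if $tr(p) < \infty$. (b) For all pairs $(\eta,\psi) \in \mathcal{H} \times \mathcal{H}$ of bounded vectors: $(\eta,\psi)$ is admissible if and only if $(\eta,\psi)$ is tracial for $\pi(G)'$ (with respect to the restriction of $tr$ to $\pi(G)'$), i.e. $tr(T) = \langle T\eta,\psi\rangle$ for all $T \in (\pi(G)')^+$.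
   Context: "Separable" for a locally compact group means second countable. Inner products are linear in the first argument. $\mu_G$ is Haar measure on $G$, and $\mathrm{L}^2(G)$ is taken with respect to it. The left regular representation acts on $\mathrm{L}^2(G)$ by $(\lambda_G(x)f)(y) = f(x^{-1}y)$. Its commuting algebra (commutant) is denoted $VN_r(G)$, the right group von Neumann algebra. Bounded vectors and admissible pairs: for a (unitary, strongly continuous) representation $(\pi,\mathcal{H}_\pi)$ of $G$, a vector $\eta \in \mathcal{H}_\pi$ is called bounded if the coefficient operator $V_\eta : \mathcal{H}_\pi \to \mathrm{L}^2(G)$, $(V_\eta\varphi)(x) = \langle \varphi, \pi(x)\eta\rangle$, is a (well-defined) bounded map. A pair $(\eta,\psi)$ of bounded vectors is called admissible if $V_\eta^* V_\psi = \mathrm{Id}_{\mathcal{H}_\pi}$. Natural trace: for $f \in \mathrm{L}^2(G)$ let $\mathcal{U}_f(g) = g * f$ for $g \in C_c(G)$; the full group Hilbert algebra consists of all $f \in \mathrm{L}^2(G)$ for which $\mathcal{U}_f$ extends to a bounded operator on $\mathrm{L}^2(G)$ (which then lies in $VN_r(G)$). These $f$ are exactly the bounded vectors for $\lambda_G$; with $f^*(x) = \overline{f(x^{-1})}$ one has $V_f = \mathcal{U}_{f^*} = \mathcal{U}_f^*$. The natural trace on $VN_r(G)^+$ (the cone of positive elements) is the faithful, normal, semifinite trace given by $tr(T) = \|f\|^2$ if $T = \mathcal{U}_f^*\mathcal{U}_f$ for some bounded vector $f$, and $tr(T) = \infty$ otherwise. The commutant $\pi(G)'$ of $\pi = \lambda_G|_{\mathcal{H}}$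 is identified with the reduced von Neumann algebra $\{pTp : T \in VN_r(G)\} \subset VN_r(G)$, and the trace on $\pi(G)'$ is the restriction of $tr$. Given a trace $tr$ on a von Neumann algebra $\mathcal{A}$, a pair $(\eta,\psi)$ of elements of the underlying Hilbert space is called tracial if $tr(T) = \langle T\eta,\psi\rangle$ for all $T \in \mathcal{A}^+$. *)

theory Defs
  imports "HOL-Analysis.Analysis"
begin

(* The library's class group_add is that of groups that need not be commutative, so the group
   operations xy, e and x^{-1} are written x + y, 0 and - x throughout.

   The Haar measure is a parameter of the class; its normalization is arbitrary. No regularity axiom
   is stated, because on a second countable locally compact Hausdorff space every Borel measure that is
   finite on compact sets is regular. *)
class lc_group = topological_group_add + t2_space + second_countable_topology +
  fixes haar :: "'a measure"
  assumes locally_compact: "\<exists>U K. open U \<and> compact K \<and> x \<in> U \<and> U \<subseteq> K"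
    and sets_haar_sigma: "sets haar = sets (sigma UNIV {U. open U})"
    and haar_compact: "compact K \<Longrightarrow> emeasure haar K < \<infinity>"
    and haar_nonzero: "emeasure haar UNIV \<noteq> 0"
    and haar_left_invariant: "A \<in> sets haar \<Longrightarrow> emeasure haar ((+) x ` A) = emeasure haar A"

lemma sets_haar: "sets (haar :: 'g::lc_group measure) = sets borel"
  by (simp add: sets_haar_sigma borel_def)

definition unimodular :: "'g::lc_group itself \<Rightarrow> bool" where
  "unimodular _ \<longleftrightarrow>
    (\<forall>x. \<forall>A\<in>sets haar. emeasure haar ((\<lambda>y::'g. y + x) ` A) = emeasure haar A)"

lemma space_haar [simp]: "space (haar :: 'g::lc_group measure) = UNIV"
  using sets_eq_imp_space_eq[OF sets_haar] by simp

lemma measurable_haar: "borel_measurable (haar :: 'g::lc_group measure) = borel_measurable borel"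
  by (rule measurable_cong_sets[OF sets_haar refl])

definition sq_integrable :: "('g::lc_group \<Rightarrow> complex) \<Rightarrow> bool" where
  "sq_integrable f \<longleftrightarrow> f \<in> borel_measurable haar \<and> integrable haar (\<lambda>x. (cmod (f x))\<^sup>2)"

definition l2_rel :: "('g::lc_group \<Rightarrow> complex) \<Rightarrow> ('g \<Rightarrow> complex) \<Rightarrow> bool" where
  "l2_rel f g \<longleftrightarrow> sq_integrable f \<and> sq_integrable g \<and> (AE x in haar. f x = g x)"

lemma sq_integrable_0: "sq_integrable (\<lambda>_. 0)"
  by (simp add: sq_integrable_def)

quotient_type (overloaded) 'g l2 = "'g::lc_group \<Rightarrow> complex" / partial: l2_rel
proof (rule part_equivpI)
  show "\<exists>f::'g \<Rightarrow> complex. l2_rel f f"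
    using sq_integrable_0 by (auto simp: l2_rel_def)
  show "symp (l2_rel :: ('g \<Rightarrow> complex) \<Rightarrow> _)"
    unfolding symp_def l2_rel_def by (simp add: eq_commute)
  show "transp (l2_rel :: ('g \<Rightarrow> complex) \<Rightarrow> _)"
    unfolding transp_def
  proof (intro allI impI)
    fix f g h :: "'g \<Rightarrow> complex"
    assume *: "l2_rel f g" "l2_rel g h"
    then have "AE x in haar. f x = g x" "AE x in haar. g x = h x"
      by (simp_all add: l2_rel_def)
    then have "AE x in haar. f x = h x"
      by eventually_elim simp
    with * show "l2_rel f h"
      by (simp add: l2_rel_def)
  qed
qed

lemma sq_integrable_add:
  assumes "sq_integrable f" "sq_integrable g"
  shows "sq_integrable (\<lambda>x. f x + g x)"
proof -
  have [measurable]: "f \<in> borel_measurable haar" "g \<in> borel_measurable haar"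
    using assms by (auto simp: sq_integrable_def)
  have "integrable haar (\<lambda>x. (cmod (f x + g x))\<^sup>2)"
  proof (rule Bochner_Integration.integrable_bound)
    show "integrable haar (\<lambda>x. 2 * (cmod (f x))\<^sup>2 + 2 * (cmod (g x))\<^sup>2)"
      using assms by (auto simp: sq_integrable_def)
    have "(cmod (a + b))\<^sup>2 \<le> 2 * (cmod a)\<^sup>2 + 2 * (cmod b)\<^sup>2" for a b
    proof -
      have "(cmod (a + b))\<^sup>2 \<le> (cmod a + cmod b)\<^sup>2"
        by (intro power_mono norm_triangle_ineq) auto
      also have "\<dots> \<le> 2 * (cmod a)\<^sup>2 + 2 * (cmod b)\<^sup>2"
        using sum_squares_bound[of "cmod a" "cmod b"] by (simp add: power2_sum)
      finally show ?thesis .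
    qed
    then show "AE x in haar. norm ((cmod (f x + g x))\<^sup>2)
        \<le> norm (2 * (cmod (f x))\<^sup>2 + 2 * (cmod (g x))\<^sup>2)"
      by (intro AE_I2) simp
  qed simp
  then show ?thesis
    by (simp add: sq_integrable_def)
qed

lemma sq_integrable_scale:
  assumes "sq_integrable f"
  shows "sq_integrable (\<lambda>x. c * f x)"
  using assms by (auto simp: sq_integrable_def norm_mult power_mult_distrib)

lemma integrable_mult_cnj:
  assumes "sq_integrable f" "sq_integrable g"
  shows "integrable haar (\<lambda>x. f x * cnj (g x))"
proof (rule Bochner_Integration.integrable_bound)
  have [measurable]: "f \<in> borel_measurable haar" "g \<in> borel_measurable haar"
    using assms by (auto simp: sq_integrable_def)
  show "integrable haar (\<lambda>x. (cmod (f x))\<^sup>2 + (cmod (g x))\<^sup>2)"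
    using assms by (auto simp: sq_integrable_def)
  show "(\<lambda>x. f x * cnj (g x)) \<in> borel_measurable haar"
  proof (rule borel_measurable_times)
    have "cnj \<in> borel_measurable borel"
      by (intro borel_measurable_continuous_onI continuous_intros)
    from measurable_compose[OF \<open>g \<in> borel_measurable haar\<close> this]
    show "(\<lambda>x. cnj (g x)) \<in> borel_measurable haar" .
  qed fact
  have "cmod a * cmod b \<le> (cmod a)\<^sup>2 + (cmod b)\<^sup>2" for a b
    using sum_squares_bound[of "cmod a" "cmod b"] mult_nonneg_nonneg[OF norm_ge_zero[of a] norm_ge_zero[of b]]
    by linarith
  then show "AE x in haar. norm (f x * cnj (g x)) \<le> norm ((cmod (f x))\<^sup>2 + (cmod (g x))\<^sup>2)"
    by (intro AE_I2) (simp add: norm_mult)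
qed

lift_definition cscale :: "complex \<Rightarrow> 'g::lc_group l2 \<Rightarrow> 'g l2" is "\<lambda>c f x. c * f x"
proof -
  fix c and f f' :: "'g \<Rightarrow> complex"
  assume *: "l2_rel f f'"
  then have "AE x in haar. f x = f' x"
    by (simp add: l2_rel_def)
  then have "AE x in haar. c * f x = c * f' x"
    by eventually_elim simp
  with * show "l2_rel (\<lambda>x. c * f x) (\<lambda>x. c * f' x)"
    by (simp add: l2_rel_def sq_integrable_scale)
qed

lift_definition cinner :: "'g::lc_group l2 \<Rightarrow> 'g l2 \<Rightarrow> complex" is
  "\<lambda>f g. \<integral>x. f x * cnj (g x) \<partial>haar"
proof -
  fix f f' g g' :: "'g \<Rightarrow> complex"
  assume *: "l2_rel f f'" "l2_rel g g'"
  have "integrable haar (\<lambda>x. f x * cnj (g x))" "integrable haar (\<lambda>x. f' x * cnj (g' x))"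
    using * by (auto simp: l2_rel_def intro: integrable_mult_cnj)
  moreover have "AE x in haar. f x * cnj (g x) = f' x * cnj (g' x)"
  proof -
    have "AE x in haar. f x = f' x" "AE x in haar. g x = g' x"
      using * by (simp_all add: l2_rel_def)
    then show ?thesis
      by eventually_elim simp
  qed
  ultimately show "(\<integral>x. f x * cnj (g x) \<partial>haar) = (\<integral>x. f' x * cnj (g' x) \<partial>haar)"
    by (intro integral_cong_AE) auto
qed

instantiation l2 :: (lc_group) real_vector
begin

lift_definition zero_l2 :: "'a l2" is "\<lambda>_. 0"
  by (simp add: l2_rel_def sq_integrable_0)

lift_definition plus_l2 :: "'a l2 \<Rightarrow> 'a l2 \<Rightarrow> 'a l2" is "\<lambda>f g x. f x + g x"
proof -
  fix f f' g g' :: "'a \<Rightarrow> complex"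
  assume *: "l2_rel f f'" "l2_rel g g'"
  then have "AE x in haar. f x = f' x" "AE x in haar. g x = g' x"
    by (simp_all add: l2_rel_def)
  then have "AE x in haar. f x + g x = f' x + g' x"
    by eventually_elim simp
  with * show "l2_rel (\<lambda>x. f x + g x) (\<lambda>x. f' x + g' x)"
    by (simp add: l2_rel_def sq_integrable_add)
qed

definition uminus_l2 :: "'a l2 \<Rightarrow> 'a l2" where
  "uminus_l2 f = cscale (-1) f"

definition minus_l2 :: "'a l2 \<Rightarrow> 'a l2 \<Rightarrow> 'a l2" where
  "minus_l2 f g = f + (- g)"

definition scaleR_l2 :: "real \<Rightarrow> 'a l2 \<Rightarrow> 'a l2" where
  "scaleR_l2 r f = cscale (complex_of_real r) f"

instance
proof
  fix f g h :: "'a l2" and a b :: real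
  show "f + g + h = f + (g + h)"
    by transfer (auto simp: l2_rel_def sq_integrable_add add.assoc)
  show "f + g = g + f"
    by transfer (auto simp: l2_rel_def sq_integrable_add add.commute)
  show "0 + f = f"
    by transfer (auto simp: l2_rel_def)
  show "- f + f = 0"
    unfolding uminus_l2_def
    by transfer (auto simp: l2_rel_def sq_integrable_0)
  show "f - g = f + - g"
    by (simp add: minus_l2_def)
  show "a *\<^sub>R (f + g) = a *\<^sub>R f + a *\<^sub>R g"
    unfolding scaleR_l2_def
    by transfer (simp add: l2_rel_def distrib_left sq_integrable_scale sq_integrable_add)
  show "(a + b) *\<^sub>R f = a *\<^sub>R f + b *\<^sub>R f"
    unfolding scaleR_l2_def
    by transfer (simp add: l2_rel_def distrib_right sq_integrable_scale sq_integrable_add)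
  show "a *\<^sub>R b *\<^sub>R f = (a * b) *\<^sub>R f"
    unfolding scaleR_l2_def
    by transfer (auto simp: l2_rel_def mult.assoc intro!: sq_integrable_scale)
  show "1 *\<^sub>R f = f"
    unfolding scaleR_l2_def by transfer (auto simp: l2_rel_def)
qed

end

lemma cinner_self: "cinner f f = complex_of_real (Re (cinner f f))" "0 \<le> Re (cinner f f)"
  by (transfer, simp add: complex_norm_square [symmetric] del: of_real_power)+

lemma cinner_commute: "cinner f g = cnj (cinner g f)"
proof transfer
  fix f g :: "'a \<Rightarrow> complex"
  show "(\<integral>x. f x * cnj (g x) \<partial>haar) = cnj (\<integral>x. g x * cnj (f x) \<partial>haar)"
    by (subst Bochner_Integration.integral_cnj [symmetric]) (simp add: mult.commute)
qed

lemma cinner_add_left: "cinner (f + g) h = cinner f h + cinner g h"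
proof transfer
  fix f g h :: "'a \<Rightarrow> complex"
  assume "l2_rel f f" "l2_rel g g" "l2_rel h h"
  then have "integrable haar (\<lambda>x. f x * cnj (h x))" "integrable haar (\<lambda>x. g x * cnj (h x))"
    by (auto simp: l2_rel_def intro: integrable_mult_cnj)
  then show "(\<integral>x. (f x + g x) * cnj (h x) \<partial>haar) =
      (\<integral>x. f x * cnj (h x) \<partial>haar) + (\<integral>x. g x * cnj (h x) \<partial>haar)"
    by (simp add: distrib_right)
qed

lemma cinner_cscale_left: "cinner (cscale c f) g = c * cinner f g"
  by transfer (simp add: mult.assoc)

lemma cinner_eq_0: "Re (cinner f f) = 0 \<longleftrightarrow> f = 0"
proof transfer
  fix f :: "'a \<Rightarrow> complex"
  assume "l2_rel f f"
  then have int: "integrable haar (\<lambda>x. (cmod (f x))\<^sup>2)" and f: "sq_integrable f"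
    by (auto simp: l2_rel_def sq_integrable_def)
  have "Re (\<integral>x. f x * cnj (f x) \<partial>haar) = (\<integral>x. (cmod (f x))\<^sup>2 \<partial>haar)"
    by (simp add: complex_norm_square [symmetric] del: of_real_power)
  also have "\<dots> = 0 \<longleftrightarrow> (AE x in haar. (cmod (f x))\<^sup>2 = 0)"
    using int by (intro integral_nonneg_eq_0_iff_AE) auto
  also have "\<dots> \<longleftrightarrow> l2_rel f (\<lambda>_. 0)"
    using f by (simp add: l2_rel_def sq_integrable_0)
  finally show "(Re (\<integral>x. f x * cnj (f x) \<partial>haar) = 0) = l2_rel f (\<lambda>_. 0)" .
qed

(* The real inner product is Re <f,g>, so that norm is the L^2 norm and closed sets are those of the
   norm topology. *)
instantiation l2 :: (lc_group) real_inner
begin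

definition inner_l2 :: "'a l2 \<Rightarrow> 'a l2 \<Rightarrow> real" where
  "inner_l2 f g = Re (cinner f g)"

definition norm_l2 :: "'a l2 \<Rightarrow> real" where
  "norm_l2 f = sqrt (Re (cinner f f))"

definition sgn_l2 :: "'a l2 \<Rightarrow> 'a l2" where
  "sgn_l2 f = f /\<^sub>R norm f"

definition dist_l2 :: "'a l2 \<Rightarrow> 'a l2 \<Rightarrow> real" where
  "dist_l2 f g = norm (f - g)"

definition uniformity_l2 :: "('a l2 \<times> 'a l2) filter" where
  "uniformity_l2 = (INF e\<in>{0<..}. principal {(f, g). dist f g < e})"

definition open_l2 :: "'a l2 set \<Rightarrow> bool" where
  "open_l2 U \<longleftrightarrow> (\<forall>f\<in>U. eventually (\<lambda>(f', g). f' = f \<longrightarrow> g \<in> U) uniformity)"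

instance
proof
  fix f g h :: "'a l2" and r :: real
  show "dist f g = norm (f - g)" by (rule dist_l2_def)
  show "sgn f = f /\<^sub>R norm f" by (rule sgn_l2_def)
  show "uniformity = (INF e\<in>{0<..}. principal {(f, g::'a l2). dist f g < e})"
    by (rule uniformity_l2_def)
  show "open U \<longleftrightarrow> (\<forall>f\<in>U. eventually (\<lambda>(f', g). f' = f \<longrightarrow> g \<in> U) uniformity)"
    for U :: "'a l2 set"
    by (rule open_l2_def)
  show "inner f g = inner g f"
    using cinner_commute[of f g] by (simp add: inner_l2_def)
  show "inner (f + g) h = inner f h + inner g h"
    by (simp add: inner_l2_def cinner_add_left)
  show "inner (r *\<^sub>R f) g = r * inner f g"
    by (simp add: inner_l2_def scaleR_l2_def cinner_cscale_left)
  show "0 \<le> inner f f"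
    by (simp add: inner_l2_def cinner_self(2))
  show "(inner f f = 0) = (f = 0)"
    by (simp add: inner_l2_def cinner_eq_0)
  show "norm f = sqrt (inner f f)"
    by (simp add: inner_l2_def norm_l2_def)
qed

end

lemma distr_haar: "distr haar borel ((+) x) = (haar :: 'g::lc_group measure)"
proof (rule measure_eqI)
  have cont: "continuous_on UNIV ((+) y)" for y :: 'g
    by (intro continuous_intros)
  then have meas [measurable]: "(+) y \<in> measurable haar borel" for y :: 'g
    using borel_measurable_continuous_onI measurable_haar by blast
  show "sets (distr haar borel ((+) x)) = sets (haar :: 'g measure)"
    by (simp add: sets_haar)
  fix A assume "A \<in> sets (distr haar borel ((+) x))"
  then have A: "A \<in> sets borel" by simp
  have eq: "(+) x -` A = (+) (- x) ` A"
  proof (intro set_eqI iffI)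
    fix y assume "y \<in> (+) x -` A"
    then have "x + y \<in> A" by simp
    moreover have "y = - x + (x + y)" by (simp add: add.assoc [symmetric])
    ultimately show "y \<in> (+) (- x) ` A" by blast
  next
    fix y assume "y \<in> (+) (- x) ` A"
    then show "y \<in> (+) x -` A" by (auto simp: add.assoc [symmetric])
  qed
  have "emeasure (distr haar borel ((+) x)) A = emeasure haar ((+) x -` A)"
    using A by (subst emeasure_distr) auto
  also have "\<dots> = emeasure haar A"
    unfolding eq using A by (simp add: haar_left_invariant sets_haar)
  finally show "emeasure (distr haar borel ((+) x)) A = emeasure haar A" .
qed

lemma measurable_translate: "(+) (x::'g::lc_group) \<in> measurable haar haar"
proof -
  have "continuous_on UNIV ((+) x)"
    by (intro continuous_intros)
  then have "(+) x \<in> measurable borel borel"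
    by (rule borel_measurable_continuous_onI)
  then show ?thesis
    by (simp add: measurable_cong_sets[OF sets_haar sets_haar])
qed

lemma distr_haar': "distr haar haar ((+) x) = (haar :: 'g::lc_group measure)"
  using distr_haar[of x] by (simp add: distr_cong[OF refl sets_haar[symmetric] refl])

lemma sq_integrable_translate:
  fixes f :: "'g::lc_group \<Rightarrow> complex"
  assumes "sq_integrable f"
  shows "sq_integrable (\<lambda>y. f (x + y))"
proof -
  have f: "f \<in> borel_measurable haar" and int: "integrable haar (\<lambda>x. (cmod (f x))\<^sup>2)"
    using assms by (auto simp: sq_integrable_def)
  have "integrable (distr haar haar ((+) x)) (\<lambda>x. (cmod (f x))\<^sup>2)"
    using int by (simp add: distr_haar')
  then have "integrable haar (\<lambda>y. (cmod (f (x + y)))\<^sup>2)"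
    by (rule integrable_distr[OF measurable_translate])
  moreover have "(\<lambda>y. f (x + y)) \<in> borel_measurable haar"
    by (rule measurable_compose[OF measurable_translate f])
  ultimately show ?thesis
    by (simp add: sq_integrable_def)
qed

(* The left regular representation: (lreg x f)(y) = f (x^{-1} y). *)
lift_definition lreg :: "'g::lc_group \<Rightarrow> 'g l2 \<Rightarrow> 'g l2" is "\<lambda>x f y. f (- x + y)"
proof -
  fix x :: 'g and f f' :: "'g \<Rightarrow> complex"
  assume *: "l2_rel f f'"
  then have "AE y in distr haar haar ((+) (- x)). f y = f' y"
    unfolding l2_rel_def distr_haar' by blast
  moreover have "{y \<in> space haar. f y = f' y} \<in> sets haar"
  proof -
    have [measurable]: "f \<in> borel_measurable haar" "f' \<in> borel_measurable haar"
      using * by (auto simp: l2_rel_def sq_integrable_def)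
    show ?thesis by measurable
  qed
  ultimately have "AE y in haar. f (- x + y) = f' (- x + y)"
    using AE_distr_iff[OF measurable_translate, of "\<lambda>y. f y = f' y" "- x"] by simp
  then show "l2_rel (\<lambda>y. f (- x + y)) (\<lambda>y. f' (- x + y))"
    using * by (simp add: l2_rel_def sq_integrable_translate)
qed

definition csubspace :: "'g::lc_group l2 set \<Rightarrow> bool" where
  "csubspace H \<longleftrightarrow> 0 \<in> H \<and> (\<forall>f\<in>H. \<forall>g\<in>H. f + g \<in> H) \<and> (\<forall>c. \<forall>f\<in>H. cscale c f \<in> H)"

definition bounded_clinear :: "('g::lc_group l2 \<Rightarrow> 'g l2) \<Rightarrow> bool" where
  "bounded_clinear A \<longleftrightarrow> bounded_linear A \<and> (\<forall>c f. A (cscale c f) = cscale c (A f))"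

definition orth_proj :: "'g::lc_group l2 set \<Rightarrow> 'g l2 \<Rightarrow> 'g l2" where
  "orth_proj H f = (THE h. h \<in> H \<and> (\<forall>k\<in>H. cinner (f - h) k = 0))"

(* The adjoint of an operator A from the Hilbert space H to L^2(G); it maps L^2(G) to H. *)
definition cadjoint :: "'g::lc_group l2 set \<Rightarrow> ('g l2 \<Rightarrow> 'g l2) \<Rightarrow> 'g l2 \<Rightarrow> 'g l2" where
  "cadjoint H A f = (THE h. h \<in> H \<and> (\<forall>k\<in>H. cinner (A k) f = cinner k h))"

(* Below, a map pi from G into the operators on L^2(G) together with a closed invariant subspace H
   stands for the representation given by restricting each pi x to H. *)

definition coeff :: "('g::lc_group \<Rightarrow> 'g l2 \<Rightarrow> 'g l2) \<Rightarrow> 'g l2 \<Rightarrow> 'g l2 \<Rightarrow> 'g \<Rightarrow> complex" where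
  "coeff \<pi> \<eta> \<phi> = (\<lambda>x. cinner \<phi> (\<pi> x \<eta>))"

definition coeff_op :: "('g::lc_group \<Rightarrow> 'g l2 \<Rightarrow> 'g l2) \<Rightarrow> 'g l2 \<Rightarrow> 'g l2 \<Rightarrow> 'g l2" where
  "coeff_op \<pi> \<eta> \<phi> = abs_l2 (coeff \<pi> \<eta> \<phi>)"

definition bounded_vector ::
    "('g::lc_group \<Rightarrow> 'g l2 \<Rightarrow> 'g l2) \<Rightarrow> 'g l2 set \<Rightarrow> 'g l2 \<Rightarrow> bool" where
  "bounded_vector \<pi> H \<eta> \<longleftrightarrow> \<eta> \<in> H \<and> (\<forall>\<phi>\<in>H. sq_integrable (coeff \<pi> \<eta> \<phi>)) \<and>
    (\<exists>C. \<forall>\<phi>\<in>H. norm (coeff_op \<pi> \<eta> \<phi>) \<le> C * norm \<phi>)"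

definition admissible ::
    "('g::lc_group \<Rightarrow> 'g l2 \<Rightarrow> 'g l2) \<Rightarrow> 'g l2 set \<Rightarrow> 'g l2 \<Rightarrow> 'g l2 \<Rightarrow> bool" where
  "admissible \<pi> H \<eta> \<psi> \<longleftrightarrow> bounded_vector \<pi> H \<eta> \<and> bounded_vector \<pi> H \<psi> \<and>
    (\<forall>\<phi>\<in>H. cadjoint H (coeff_op \<pi> \<eta>) (coeff_op \<pi> \<psi> \<phi>) = \<phi>)"

(* VN_r(G), the commuting algebra of the left regular representation. *)
definition VN_r :: "('g::lc_group l2 \<Rightarrow> 'g l2) set" where
  "VN_r = {T. bounded_clinear T \<and> (\<forall>x f. T (lreg x f) = lreg x (T f))}"

(* The algebra pi(G)' of the restriction pi of the left regular representation to H, identified with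
   the reduced von Neumann algebra inside VN_r(G). *)
definition reduced_VN :: "'g::lc_group l2 set \<Rightarrow> ('g l2 \<Rightarrow> 'g l2) set" where
  "reduced_VN H = {orth_proj H \<circ> T \<circ> orth_proj H | T. T \<in> VN_r}"

definition positive_part :: "('g::lc_group l2 \<Rightarrow> 'g l2) set \<Rightarrow> ('g l2 \<Rightarrow> 'g l2) set" where
  "positive_part \<A> = {T \<in> \<A>. \<forall>f. cinner (T f) f \<in> \<real>\<^sub>\<ge>\<^sub>0}"

definition convolve ::
    "('g::lc_group \<Rightarrow> complex) \<Rightarrow> ('g \<Rightarrow> complex) \<Rightarrow> 'g \<Rightarrow> complex" where
  "convolve g f x = (\<integral>y. g y * f (- y + x) \<partial>haar)"

definition Cc :: "('g::lc_group \<Rightarrow> complex) set" where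
  "Cc = {g. continuous_on UNIV g \<and> compact (closure {x. g x \<noteq> 0})}"

(* U_f, the bounded extension to L^2(G) of g |-> g * f on C_c(G). It is unique because C_c(G) is dense;
   it is meaningful for f in the full group Hilbert algebra, i.e. for bounded vectors f of lreg. *)
definition conv_op :: "'g::lc_group l2 \<Rightarrow> 'g l2 \<Rightarrow> 'g l2" where
  "conv_op f = (THE A. bounded_clinear A \<and>
    (\<forall>g\<in>Cc. A (abs_l2 g) = abs_l2 (convolve g (rep_l2 f))))"

(* The value does not depend on the choice of f. *)
definition natural_trace :: "('g::lc_group l2 \<Rightarrow> 'g l2) \<Rightarrow> ennreal" where
  "natural_trace T =
    (let P = (\<lambda>f. bounded_vector lreg UNIV f \<and> T = cadjoint UNIV (conv_op f) \<circ> conv_op f)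
     in if \<exists>f. P f then ennreal ((norm (SOME f. P f))\<^sup>2) else \<infinity>)"

definition tracial ::
    "('g::lc_group l2 \<Rightarrow> 'g l2) set \<Rightarrow> (('g l2 \<Rightarrow> 'g l2) \<Rightarrow> ennreal) \<Rightarrow> 'g l2 \<Rightarrow> 'g l2 \<Rightarrow> bool" where
  "tracial \<A> tr \<eta> \<psi> \<longleftrightarrow> (\<forall>T\<in>positive_part \<A>.
    tr T < \<infinity> \<and> complex_of_real (enn2real (tr T)) = cinner (T \<eta>) \<psi>)"

end

theory Submission
  imports Defs
begin

text \<open>
  Write \<open>V\<^sub>f\<close> for the coefficient operator of a bounded vector \<open>f\<close>, \<open>f\<^sup>*\<close> for the function
  \<open>x \<mapsto> cnj (f (- x))\<close>, \<open>VN\<close> for the commutant of the left regular representation, and put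
  \<open>U\<^sub>f = V\<^sub>f\<^sup>*\<close>, which is right convolution by \<open>f\<close> (\<open>conv_op_eq\<close>).  Four facts make the bounded
  vectors into an algebra:
  \<open>U\<^bsub>f*\<^esub> = V\<^sub>f\<close> with \<open>f\<^sup>*\<close> again bounded (\<open>V_star\<close>, \<open>bdd_star\<close>),
  \<open>U\<^bsub>Sf\<^esub> = S U\<^sub>f\<close> for \<open>S\<close> in \<open>VN\<close> (\<open>U_VN_r_apply\<close>),
  the map \<open>f \<mapsto> U\<^sub>f\<close> is injective (\<open>U_inject\<close>), and
  \<open>(U\<^sub>a b)\<^sup>* = V\<^sub>b a\<^sup>*\<close> (\<open>star_U\<close>), a consequence of the other three.
  With them, \<open>(\<eta>, \<psi>)\<close> is admissible iff \<open>U\<^sub>\<eta> V\<^sub>\<psi> = p\<close> (\<open>admissible_iff\<close>), and the rest is algebra.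

  Admissible pairs are tracial (\<open>admissible_imp_trace\<close>).  Let \<open>T\<close> be positive in \<open>p VN p\<close> and \<open>S\<close> a
  symmetric square root of \<open>T\<close> in \<open>VN\<close>; then \<open>S = S p\<close>.  Hence \<open>S = S U\<^sub>\<eta> V\<^sub>\<psi> = U\<^sub>h\<close> with
  \<open>h = S U\<^sub>\<eta> \<psi>\<^sup>*\<close>, so \<open>T = U\<^sub>h\<^sup>* U\<^sub>h\<close> has trace \<open>\<parallel>h\<parallel>\<^sup>2\<close>, and \<open>h\<^sup>* = h\<close> because \<open>S\<close> is symmetric.
  Moving factors across the inner product gives \<open>\<parallel>h\<parallel>\<^sup>2 = \<langle>S S \<eta>, \<psi>\<rangle> = \<langle>T \<eta>, \<psi>\<rangle>\<close>.  For \<open>T = p\<close> this shows that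
  the trace of \<open>p\<close> is finite.

  If the trace of \<open>p\<close> is finite, then \<open>p = U\<^sub>f\<^sup>* U\<^sub>f = U\<^sub>k\<close> for \<open>k = V\<^sub>f f\<close>, and \<open>(k, k)\<close> is admissible
  since \<open>U\<^sub>k V\<^sub>k = p p = p\<close> (\<open>finite_trace_imp_unit\<close>).

  Tracial pairs are admissible (\<open>tracial_imp_admissible\<close>).  If \<open>(\<eta>, \<psi>)\<close> is tracial, it
  has the same values \<open>\<langle>T \<eta>, \<psi>\<rangle>\<close> as \<open>(k, k)\<close>, first for positive \<open>T\<close> and by polarization for all \<open>T\<close> in
  \<open>p VN p\<close>.  Put \<open>d = U\<^sub>\<eta> \<psi>\<^sup>*\<close>, so that \<open>U\<^sub>d = U\<^sub>\<eta> V\<^sub>\<psi>\<close>.  Then \<open>\<langle>T \<eta>, \<psi>\<rangle> = \<langle>T k, d\<^sup>*\<rangle>\<close>, so \<open>T k\<close> is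
  orthogonal to \<open>d\<^sup>* - k\<close>; the choice \<open>T = V\<^sub>d - p\<close>, for which \<open>T k = d\<^sup>* - k\<close>, gives \<open>d\<^sup>* = k\<close> and
  \<open>U\<^sub>d = U\<^sub>k = p\<close>.

  Injectivity of \<open>f \<mapsto> U\<^sub>f\<close> comes from a countable family of sets that separates square integrable
  functions (\<open>V_inject\<close>).  That the trace does not depend on the choice of \<open>f\<close> follows because \<open>f\<close> is
  a limit of vectors \<open>U\<^sub>f x\<close>, while \<open>U\<^sub>f\<^sup>* U\<^sub>f\<close> determines both \<open>\<parallel>U\<^sub>f x\<parallel>\<close> and \<open>\<langle>U\<^sub>f x, f\<rangle>\<close>
  (\<open>norm_le_of_square_eq\<close>).
\<close>

section \<open>Haar measure\<close>

lemma relatively_compact_basis: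
  obtains B :: "'g::lc_group set set"
  where "countable B" "topological_basis B" "\<And>b. b \<in> B \<Longrightarrow> open b \<and> compact (closure b)"
proof -
  obtain B0 :: "'g set set" where B0: "countable B0" "topological_basis B0"
    using ex_countable_basis by blast
  define B where "B = {b \<in> B0. compact (closure b)}"
  have opn: "open b" if "b \<in> B" for b
    using that topological_basis_open[OF B0(2)] by (simp add: B_def)
  have "\<exists>b\<in>B. x \<in> b \<and> b \<subseteq> V" if V: "open V" "x \<in> V" for V and x :: 'g
  proof -
    obtain U K where UK: "open U" "compact K" "x \<in> U" "U \<subseteq> K"
      using locally_compact by blast
    then obtain b where b: "b \<in> B0" "x \<in> b" "b \<subseteq> V \<inter> U"
      using topological_basisE[OF B0(2), of "V \<inter> U" x] V by auto
    have "closure b \<subseteq> K"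
      using b UK by (intro closure_minimal compact_imp_closed) auto
    then have "closure b = K \<inter> closure b" by blast
    then have "compact (closure b)"
      using compact_Int_closed[OF UK(2) closed_closure, of b] by simp
    with b show ?thesis by (auto simp: B_def)
  qed
  then have "topological_basis B"
    using opn by (subst topological_basis_iff) auto
  moreover have "countable B"
    using B0(1) by (auto simp: B_def)
  ultimately show thesis
    using that opn by (auto simp: B_def)
qed

lemma emeasure_haar_relatively_compact:
  fixes A :: "'g::lc_group set"
  assumes "compact (closure A)"
  shows "emeasure haar A < \<infinity>"
proof -
  have "emeasure haar A \<le> emeasure haar (closure A)"
    by (rule emeasure_mono) (auto simp: sets_haar closure_subset)
  also have "\<dots> < \<infinity>"
    by (rule haar_compact[OF assms])
  finally show ?thesis .
qed

interpretation haar: sigma_finite_measure "haar :: 'g::lc_group measure"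
proof
  obtain B :: "'g set set" where B: "countable B" "topological_basis B"
      "\<And>b. b \<in> B \<Longrightarrow> open b \<and> compact (closure b)"
    using relatively_compact_basis by metis
  have "\<Union>B = UNIV"
    using topological_basisE[OF B(2) open_UNIV] by blast
  moreover have "emeasure haar b \<noteq> \<infinity>" if "b \<in> B" for b
    using emeasure_haar_relatively_compact[of b] B(3)[OF that] by simp
  ultimately show "\<exists>A::'g set set. countable A \<and> A \<subseteq> sets haar \<and> \<Union>A = space haar
      \<and> (\<forall>a\<in>A. emeasure haar a \<noteq> \<infinity>)"
    using B by (intro exI[of _ B]) (auto simp: sets_haar)
qed

interpretation haar_pair: pair_sigma_finite "haar :: 'g::lc_group measure" "haar :: 'h::lc_group measure"
  ..

lemma measurable_haar_haar: "measurable (haar :: 'g::lc_group measure) (haar :: 'h::lc_group measure) = measurable borel borel"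
  by (rule measurable_cong_sets[OF sets_haar sets_haar])

lemma measurable_haar_pair_continuous:
  fixes h :: "'g::lc_group \<times> 'g \<Rightarrow> 'g"
  assumes "continuous_on UNIV h"
  shows "h \<in> measurable (haar \<Otimes>\<^sub>M haar) haar"
proof -
  have "measurable ((haar :: 'g measure) \<Otimes>\<^sub>M (haar :: 'g measure)) (haar :: 'g measure) = measurable borel borel"
    by (rule measurable_cong_sets)
      (simp_all add: borel_prod[symmetric] sets_haar cong: sets_pair_measure_cong)
  with assms show ?thesis
    by (simp add: borel_measurable_continuous_onI)
qed

lemma measurable_haar_continuous:
  fixes h :: "'g::lc_group \<Rightarrow> 'g"
  assumes "continuous_on UNIV h"
  shows "h \<in> measurable haar haar"
  using assms by (simp add: measurable_haar_haar borel_measurable_continuous_onI)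

lemma nn_integral_haar_left:
  fixes f :: "'g::lc_group \<Rightarrow> ennreal"
  assumes "f \<in> borel_measurable haar"
  shows "(\<integral>\<^sup>+ y. f (x + y) \<partial>haar) = (\<integral>\<^sup>+ y. f y \<partial>haar)"
  using nn_integral_distr[OF measurable_translate, of f x] assms distr_haar'[of x] by simp

lemma nn_integral_haar_right:
  fixes f :: "'g::lc_group \<Rightarrow> ennreal"
  assumes um: "unimodular TYPE('g)" and f: "f \<in> borel_measurable haar"
  shows "(\<integral>\<^sup>+ y. f (y + x) \<partial>haar) = (\<integral>\<^sup>+ y. f y \<partial>haar)"
proof -
  have meas: "(\<lambda>y. y + x) \<in> measurable haar haar" for x :: 'g
    by (intro measurable_haar_continuous continuous_intros)
  have "distr haar haar (\<lambda>y. y + x) = (haar :: 'g measure)"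
  proof (rule measure_eqI)
    fix A assume "A \<in> sets (distr haar haar (\<lambda>y. y + x))"
    then have A: "A \<in> sets haar" by simp
    have "(\<lambda>y. y + x) -` A = (\<lambda>y. y + - x) ` A"
    proof (intro set_eqI iffI)
      fix y assume "y \<in> (\<lambda>y. y + x) -` A"
      then have "y + x \<in> A" by simp
      moreover have "y = (y + x) + - x" by (simp add: add.assoc)
      ultimately show "y \<in> (\<lambda>y. y + - x) ` A" by blast
    qed (auto simp: add.assoc)
    then have "emeasure (distr haar haar (\<lambda>y. y + x)) A = emeasure haar ((\<lambda>y. y + - x) ` A)"
      using A meas by (simp add: emeasure_distr)
    also have "\<dots> = emeasure haar A"
      using um A unfolding unimodular_def by blast
    finally show "emeasure (distr haar haar (\<lambda>y. y + x)) A = emeasure haar A" .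
  qed simp
  then show ?thesis
    using nn_integral_distr[OF meas, of f x] f by simp
qed

text \<open>Let \<open>I\<close> be the Haar integral.  In the double integral for \<open>I(f) I(g \<circ> uminus)\<close>, replace
  \<open>y\<close> by \<open>- x + y\<close>, then, for fixed \<open>y\<close>, \<open>x\<close> by \<open>y + x\<close>, and drop the right translation that has
  appeared in the argument of \<open>f\<close>: the result is \<open>I(f) I(g)\<close>.  Dividing by \<open>I(f)\<close> for one \<open>f\<close> with
  \<open>0 < I(f) < \<infinity>\<close> proves the claim.\<close>

lemma nn_integral_haar_uminus:
  fixes g :: "'g::lc_group \<Rightarrow> ennreal"
  assumes um: "unimodular TYPE('g)" and g [measurable]: "g \<in> borel_measurable haar"
  shows "(\<integral>\<^sup>+ y. g (- y) \<partial>haar) = (\<integral>\<^sup>+ y. g y \<partial>haar)"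
proof -
  obtain A :: "nat \<Rightarrow> 'g set" where A: "range A \<subseteq> sets haar" "(\<Union>i. A i) = space haar"
      "\<And>i. emeasure haar (A i) \<noteq> \<infinity>"
    using haar.sigma_finite by blast
  have "\<exists>i. emeasure haar (A i) \<noteq> 0"
  proof (rule ccontr)
    assume "\<not> (\<exists>i. emeasure haar (A i) \<noteq> 0)"
    then have "emeasure haar (\<Union>i. A i) = 0"
      by (intro emeasure_UN_eq_0) (use A in auto)
    then show False
      using haar_nonzero[where 'a='g] A(2) by simp
  qed
  then obtain i where i: "emeasure haar (A i) \<noteq> 0" by blast
  define f :: "'g \<Rightarrow> ennreal" where "f = indicator (A i)"
  have f [measurable]: "f \<in> borel_measurable haar"
    using A(1) by (auto simp: f_def)
  have I: "(\<integral>\<^sup>+ x. f x \<partial>haar) = emeasure haar (A i)"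
    using A(1) by (auto simp: f_def)
  have [measurable]: "(\<lambda>z::'g\<times>'g. - snd z + fst z) \<in> measurable (haar \<Otimes>\<^sub>M haar) haar"
     "(\<lambda>z::'g\<times>'g. snd z + fst z) \<in> measurable (haar \<Otimes>\<^sub>M haar) haar"
     "(\<lambda>z::'g\<times>'g. fst z + snd z) \<in> measurable (haar \<Otimes>\<^sub>M haar) haar"
     "(uminus::'g\<Rightarrow>'g) \<in> measurable haar haar"
    by (intro measurable_haar_pair_continuous measurable_haar_continuous continuous_intros)+
  have m1: "(\<lambda>z. f (fst z) * g (- snd z + fst z)) \<in> borel_measurable (haar \<Otimes>\<^sub>M haar)"
    by measurable
  have m2: "(\<lambda>z. f (fst z + snd z) * g (snd z)) \<in> borel_measurable (haar \<Otimes>\<^sub>M haar)"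
    by measurable
  have "(\<integral>\<^sup>+ x. f x \<partial>haar) * (\<integral>\<^sup>+ y. g (- y) \<partial>haar) = (\<integral>\<^sup>+ x. (\<integral>\<^sup>+ y. f x * g (- y) \<partial>haar) \<partial>haar)"
    by (simp add: nn_integral_cmult nn_integral_multc)
  also have "\<dots> = (\<integral>\<^sup>+ x. (\<integral>\<^sup>+ y. f x * g (- y + x) \<partial>haar) \<partial>haar)"
  proof (rule nn_integral_cong)
    fix x :: 'g
    have "(\<integral>\<^sup>+ y. f x * g (- y) \<partial>haar) = (\<integral>\<^sup>+ y. f x * g (- (- x + y)) \<partial>haar)"
      by (rule nn_integral_haar_left[symmetric, where f="\<lambda>y. f x * g (- y)"]) simp
    then show "(\<integral>\<^sup>+ y. f x * g (- y) \<partial>haar) = (\<integral>\<^sup>+ y. f x * g (- y + x) \<partial>haar)"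
      by (simp add: minus_add)
  qed
  also have "\<dots> = (\<integral>\<^sup>+ y. (\<integral>\<^sup>+ x. f x * g (- y + x) \<partial>haar) \<partial>haar)"
    using haar_pair.Fubini'[of "\<lambda>x y. f x * g (- y + x)"] m1 by (simp add: case_prod_unfold)
  also have "\<dots> = (\<integral>\<^sup>+ y. (\<integral>\<^sup>+ x. f (y + x) * g x \<partial>haar) \<partial>haar)"
  proof (rule nn_integral_cong)
    fix y :: 'g
    have [measurable]: "(\<lambda>x. - y + x) \<in> measurable haar haar"
      by (rule measurable_translate)
    have "(\<integral>\<^sup>+ x. f x * g (- y + x) \<partial>haar) = (\<integral>\<^sup>+ x. f (y + x) * g (- y + (y + x)) \<partial>haar)"
      by (rule nn_integral_haar_left[symmetric, where f="\<lambda>x. f x * g (- y + x)"]) measurable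
    then show "(\<integral>\<^sup>+ x. f x * g (- y + x) \<partial>haar) = (\<integral>\<^sup>+ x. f (y + x) * g x \<partial>haar)"
      by (simp add: add.assoc[symmetric])
  qed
  also have "\<dots> = (\<integral>\<^sup>+ x. (\<integral>\<^sup>+ y. f (y + x) * g x \<partial>haar) \<partial>haar)"
    using haar_pair.Fubini'[of "\<lambda>y x. f (y + x) * g x"] m2 by (simp add: case_prod_unfold)
  also have "\<dots> = (\<integral>\<^sup>+ x. (\<integral>\<^sup>+ y. f y \<partial>haar) * g x \<partial>haar)"
  proof (rule nn_integral_cong)
    fix x :: 'g
    have [measurable]: "(\<lambda>y. y + x) \<in> measurable haar haar"
      by (intro measurable_haar_continuous continuous_intros)
    show "(\<integral>\<^sup>+ y. f (y + x) * g x \<partial>haar) = (\<integral>\<^sup>+ y. f y \<partial>haar) * g x"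
      by (simp add: nn_integral_multc nn_integral_haar_right[OF um f])
  qed
  also have "\<dots> = (\<integral>\<^sup>+ x. f x \<partial>haar) * (\<integral>\<^sup>+ x. g x \<partial>haar)"
    by (simp add: nn_integral_cmult)
  finally show ?thesis
    using i A(3)[of i] by (simp add: I ennreal_mult_cancel_left)
qed

lemma distr_haar_uminus:
  assumes um: "unimodular TYPE('g::lc_group)"
  shows "distr haar haar uminus = (haar :: 'g measure)"
proof (rule measure_eqI)
  have meas: "(uminus :: 'g \<Rightarrow> 'g) \<in> measurable haar haar"
    by (intro measurable_haar_continuous continuous_intros)
  fix A assume "A \<in> sets (distr haar haar (uminus :: 'g \<Rightarrow> 'g))"
  then have A: "A \<in> sets (haar :: 'g measure)" by simp
  have "emeasure (distr haar haar uminus) A = (\<integral>\<^sup>+ y. indicator A (- y) \<partial>haar)"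
    using nn_integral_distr[OF meas, of "indicator A"] A by simp
  also have "\<dots> = emeasure haar A"
    using nn_integral_haar_uminus[OF um, of "indicator A"] A by simp
  finally show "emeasure (distr haar haar uminus) A = emeasure haar A" .
qed simp

section \<open>Hilbert spaces\<close>

text \<open>A minimizing sequence for the distance from \<open>x\<close> to \<open>S\<close> is Cauchy by the parallelogram law, since
  midpoints stay in \<open>S\<close>; its limit is the projection.\<close>

lemma exists_orthogonal_projection:
  fixes S :: "'a::{real_inner, complete_space} set"
  assumes S: "closed S" "subspace S"
  shows "\<exists>h\<in>S. \<forall>k\<in>S. inner (x - h) k = 0"
proof -
  define D where "D = (\<lambda>k. (norm (x - k))\<^sup>2) ` S"
  define d where "d = Inf D"
  have S0: "0 \<in> S" using S(2) by (rule subspace_0)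
  have bdd: "bdd_below D" unfolding D_def by (intro bdd_belowI[of _ 0]) auto
  have d_le: "d \<le> (norm (x - k))\<^sup>2" if "k \<in> S" for k
    unfolding d_def using that by (intro cInf_lower bdd) (auto simp: D_def)
  have "\<exists>k\<in>S. (norm (x - k))\<^sup>2 < d + inverse (real (Suc n))" for n
  proof -
    have "\<exists>y\<in>D. y < d + inverse (real (Suc n))"
      by (rule cInf_lessD) (use S0 in \<open>auto simp: D_def d_def\<close>)
    then show ?thesis by (auto simp: D_def)
  qed
  then obtain k where k: "\<And>n. k n \<in> S" "\<And>n. (norm (x - k n))\<^sup>2 < d + inverse (real (Suc n))"
    by metis
  have par: "(norm (k n - k m))\<^sup>2 \<le> 2 * inverse (real (Suc n)) + 2 * inverse (real (Suc m))" for n m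
  proof -
    have "(1/2) *\<^sub>R (k n + k m) \<in> S"
      using k(1) S(2) by (intro subspace_scale subspace_add)
    then have "d \<le> (norm (x - (1/2) *\<^sub>R (k n + k m)))\<^sup>2" by (rule d_le)
    moreover have "(norm (k n - k m))\<^sup>2
        = 2 * (norm (x - k n))\<^sup>2 + 2 * (norm (x - k m))\<^sup>2 - 4 * (norm (x - (1/2) *\<^sub>R (k n + k m)))\<^sup>2"
      unfolding power2_norm_eq_inner
      by (simp add: inner_diff inner_add inner_commute algebra_simps)
    ultimately show ?thesis
      using k(2)[of n] k(2)[of m] by linarith
  qed
  have "Cauchy k"
  proof (rule metric_CauchyI)
    fix e :: real assume e: "0 < e"
    then obtain N where N: "inverse (real (Suc N)) < e\<^sup>2 / 4"
      using reals_Archimedean[of "e\<^sup>2 / 4"] by auto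
    show "\<exists>M. \<forall>m\<ge>M. \<forall>n\<ge>M. dist (k m) (k n) < e"
    proof (intro exI allI impI)
      fix m n assume mn: "m \<ge> N" "n \<ge> N"
      then have "inverse (real (Suc m)) \<le> inverse (real (Suc N))"
        "inverse (real (Suc n)) \<le> inverse (real (Suc N))"
        by (auto intro!: le_imp_inverse_le)
      then have "(norm (k m - k n))\<^sup>2 < e\<^sup>2"
        using par[of m n] N by linarith
      then show "dist (k m) (k n) < e"
        using e by (simp add: dist_norm power2_less_imp_less)
    qed
  qed
  then obtain h where h: "k \<longlonglongrightarrow> h"
    using Cauchy_convergent convergent_def by blast
  then have hS: "h \<in> S"
    using S(1) k(1) closed_sequentially by blast
  have "(\<lambda>n. (norm (x - k n))\<^sup>2) \<longlonglongrightarrow> (norm (x - h))\<^sup>2"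
    by (intro tendsto_intros h)
  moreover have "(\<lambda>n. d + inverse (real (Suc n))) \<longlonglongrightarrow> d + 0"
    by (intro tendsto_intros LIMSEQ_inverse_real_of_nat)
  ultimately have hd: "(norm (x - h))\<^sup>2 \<le> d + 0"
    by (rule LIMSEQ_le) (use k(2) in \<open>auto intro: less_imp_le\<close>)
  have "inner (x - h) v = 0" if v: "v \<in> S" for v
  proof (cases "v = 0")
    case False
    \<comment> \<open>the value of \<open>t\<close> that minimizes the distance from \<open>x\<close> to \<open>h + t v\<close>\<close>
    define t where "t = inner (x - h) v / (norm v)\<^sup>2"
    have "h + t *\<^sub>R v \<in> S"
      using hS v S(2) by (intro subspace_scale subspace_add)
    then have "d \<le> (norm (x - (h + t *\<^sub>R v)))\<^sup>2" by (rule d_le)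
    also have "\<dots> = (norm (x - h))\<^sup>2 - 2 * t * inner (x - h) v + t\<^sup>2 * (norm v)\<^sup>2"
      unfolding power2_norm_eq_inner
      by (simp add: inner_diff inner_add inner_commute algebra_simps power2_eq_square)
    also have "\<dots> = (norm (x - h))\<^sup>2 - (inner (x - h) v)\<^sup>2 / (norm v)\<^sup>2"
      using False by (simp add: t_def field_simps power2_eq_square)
    finally have "(inner (x - h) v)\<^sup>2 / (norm v)\<^sup>2 \<le> 0"
      using hd by simp
    then show ?thesis
      using False by (simp add: divide_le_0_iff)
  qed simp
  with hS show ?thesis by blast
qed

lemma riesz_representation:
  fixes f :: "'a::{real_inner, complete_space} \<Rightarrow> real"
  assumes "bounded_linear f"
  shows "\<exists>y. \<forall>x. f x = inner x y"
proof (cases "\<forall>x. f x = 0")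
  case False
  then obtain z where z: "f z \<noteq> 0" by blast
  interpret f: bounded_linear f by fact
  define S where "S = {x. f x = 0}"
  have "closed S"
    unfolding S_def by (intro closed_Collect_eq f.continuous_on continuous_intros)
  moreover have "subspace S"
    by (auto simp: S_def subspace_def f.add f.scaleR)
  ultimately obtain h where h: "h \<in> S" "\<forall>k\<in>S. inner (z - h) k = 0"
    using exists_orthogonal_projection[of S z] by blast
  define w where "w = z - h"
  have fw: "f w \<noteq> 0" using z h(1) by (simp add: w_def f.diff S_def)
  then have w0: "norm w \<noteq> 0" by (auto simp: f.zero)
  have "f x = inner x ((f w / (norm w)\<^sup>2) *\<^sub>R w)" for x
  proof -
    have "x - (f x / f w) *\<^sub>R w \<in> S"
      using fw by (simp add: S_def f.diff f.scaleR)
    then have "inner w (x - (f x / f w) *\<^sub>R w) = 0"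
      using h(2) by (simp add: w_def)
    then have "inner x w = f x / f w * (norm w)\<^sup>2"
      by (simp add: inner_diff_right inner_commute power2_norm_eq_inner)
    then show ?thesis using fw w0 by simp
  qed
  then show ?thesis by blast
next
  case True
  then show ?thesis by (intro exI[of _ 0]) simp
qed

section \<open>Square roots of positive operators\<close>

text \<open>The square root is \<open>1 - R\<close>, where \<open>R = (A + R\<^sup>2) / 2\<close> and \<open>A = 1 - T\<close> with \<open>T\<close> scaled so
  that \<open>\<parallel>A\<parallel> \<le> 1\<close>.  The iteration \<open>R \<mapsto> (A + R\<^sup>2) / 2\<close> from 0 converges in norm, because its
  increments are dominated by those of the scalar iteration \<open>r \<mapsto> (1 + r\<^sup>2) / 2\<close>, which increases
  and stays below 1.  All iterates, hence the limit, are symmetric and commute with whatever commutes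
  with \<open>T\<close>.\<close>

primrec sqrt_iter :: "('a::real_normed_vector \<Rightarrow>\<^sub>L 'a) \<Rightarrow> nat \<Rightarrow> ('a \<Rightarrow>\<^sub>L 'a)" where
  "sqrt_iter A 0 = 0"
| "sqrt_iter A (Suc n) = (1/2) *\<^sub>R (A + (sqrt_iter A n o\<^sub>L sqrt_iter A n))"

primrec sqrt_iter_bound :: "nat \<Rightarrow> real" where
  "sqrt_iter_bound 0 = 0"
| "sqrt_iter_bound (Suc n) = (1 + (sqrt_iter_bound n)\<^sup>2) / 2"

lemma sqrt_iter_bound_range: "0 \<le> sqrt_iter_bound n \<and> sqrt_iter_bound n \<le> 1"
proof (induction n)
  case (Suc n)
  then have "(sqrt_iter_bound n)\<^sup>2 \<le> 1" by (simp add: power_le_one)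
  then show ?case by simp
qed simp

lemma sqrt_iter_bound_mono: "incseq sqrt_iter_bound"
proof (rule incseq_SucI)
  fix n
  have "0 \<le> (1 - sqrt_iter_bound n)\<^sup>2" by simp
  then show "sqrt_iter_bound n \<le> sqrt_iter_bound (Suc n)"
    by (simp add: power2_eq_square algebra_simps)
qed

lemma norm_sqrt_iter:
  assumes "norm A \<le> 1"
  shows "norm (sqrt_iter A n) \<le> sqrt_iter_bound n"
proof (induction n)
  case (Suc n)
  have "norm (sqrt_iter A n o\<^sub>L sqrt_iter A n) \<le> norm (sqrt_iter A n) * norm (sqrt_iter A n)"
    by (rule norm_blinfun_compose)
  also have "\<dots> \<le> sqrt_iter_bound n * sqrt_iter_bound n"
    using Suc by (intro mult_mono) (auto simp: sqrt_iter_bound_range)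
  finally have "norm (A + (sqrt_iter A n o\<^sub>L sqrt_iter A n)) \<le> 1 + (sqrt_iter_bound n)\<^sup>2"
    using assms norm_triangle_ineq[of A "sqrt_iter A n o\<^sub>L sqrt_iter A n"]
    by (simp add: power2_eq_square)
  then show ?case by simp
qed simp

lemma norm_sqrt_iter_diff:
  assumes A: "norm A \<le> 1"
  shows "norm (sqrt_iter A (Suc n) - sqrt_iter A n) \<le> sqrt_iter_bound (Suc n) - sqrt_iter_bound n"
proof (induction n)
  case 0
  then show ?case using A by simp
next
  case (Suc n)
  let ?R = "sqrt_iter A" and ?r = "sqrt_iter_bound"
  define P Q where "P = ?R (Suc n)" and "Q = ?R n"
  have "?R (Suc (Suc n)) - ?R (Suc n) = (1/2) *\<^sub>R ((P o\<^sub>L P) - (Q o\<^sub>L Q))"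
    unfolding P_def Q_def sqrt_iter.simps(2)[of A "Suc n"] sqrt_iter.simps(2)[of A n]
    by (simp add: scaleR_diff_right[symmetric] del: scaleR_diff_right)
  also have "(P o\<^sub>L P) - (Q o\<^sub>L Q) = (P o\<^sub>L (P - Q)) + ((P - Q) o\<^sub>L Q)"
    by (simp add: bounded_bilinear.diff_left[OF bounded_bilinear_blinfun_compose]
        bounded_bilinear.diff_right[OF bounded_bilinear_blinfun_compose])
  also have "norm ((1/2) *\<^sub>R \<dots>) \<le> (1/2) * (norm P * norm (P - Q) + norm (P - Q) * norm Q)"
    by (simp, intro norm_triangle_le add_mono norm_blinfun_compose)
  also have "\<dots> = (1/2) * ((norm P + norm Q) * norm (P - Q))"
    by (simp add: algebra_simps)
  also have "\<dots> \<le> (1/2) * ((?r (Suc n) + ?r n) * (?r (Suc n) - ?r n))"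
    using norm_sqrt_iter[OF A, of "Suc n"] norm_sqrt_iter[OF A, of n] Suc
      sqrt_iter_bound_range[of "Suc n"] sqrt_iter_bound_range[of n]
    unfolding P_def Q_def by (intro mult_left_mono mult_mono add_mono) (auto simp del: sqrt_iter.simps sqrt_iter_bound.simps)
  also have "\<dots> = ?r (Suc (Suc n)) - ?r (Suc n)"
    unfolding sqrt_iter_bound.simps(2)[of "Suc n"] sqrt_iter_bound.simps(2)[of n]
    by (simp add: power2_eq_square field_simps)
  finally show ?case .
qed

lemma sqrt_iter_Cauchy:
  assumes A: "norm A \<le> 1"
  shows "Cauchy (sqrt_iter A)"
proof -
  let ?R = "sqrt_iter A" and ?r = "sqrt_iter_bound"
  have step: "norm (?R (n + k) - ?R n) \<le> ?r (n + k) - ?r n" for n k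
  proof (induction k)
    case (Suc k)
    have "norm (?R (n + Suc k) - ?R n) \<le> norm (?R (Suc (n + k)) - ?R (n + k)) + norm (?R (n + k) - ?R n)"
      using norm_triangle_ineq[of "?R (Suc (n + k)) - ?R (n + k)" "?R (n + k) - ?R n"]
      by (simp del: sqrt_iter.simps)
    with Suc norm_sqrt_iter_diff[OF A, of "n + k"] show ?case
      by (simp del: sqrt_iter.simps sqrt_iter_bound.simps)
  qed simp
  obtain L where "?r \<longlonglongrightarrow> L"
    using incseq_convergent[OF sqrt_iter_bound_mono, of 1] sqrt_iter_bound_range by blast
  then have "convergent ?r" by (auto simp: convergent_def)
  then have "Cauchy ?r" by (rule convergent_Cauchy)
  show ?thesis
  proof (rule metric_CauchyI)
    fix e :: real assume "0 < e"
    with \<open>Cauchy ?r\<close> obtain M where M: "\<And>m n. m \<ge> M \<Longrightarrow> n \<ge> M \<Longrightarrow> dist (?r m) (?r n) < e"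
      unfolding Cauchy_def by blast
    have *: "dist (?R m) (?R n) < e" if "m \<ge> n" "n \<ge> M" for m n
    proof -
      have "dist (?R m) (?R n) \<le> ?r m - ?r n"
        using step[of n "m - n"] that by (simp add: dist_norm)
      also have "\<dots> < e"
        using M[of m n] that by (simp add: dist_real_def)
      finally show ?thesis .
    qed
    then show "\<exists>M. \<forall>m\<ge>M. \<forall>n\<ge>M. dist (?R m) (?R n) < e"
      by (intro exI[of _ M] allI impI) (metis dist_commute linorder_linear)
  qed
qed

lemma sqrt_iter_symmetric:
  fixes A :: "'a::real_inner \<Rightarrow>\<^sub>L 'a"
  assumes "\<And>x y. inner (A x) y = inner x (A y)"
  shows "inner (sqrt_iter A n x) y = inner x (sqrt_iter A n y)"
  by (induction n arbitrary: x y)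
     (auto simp: assms blinfun.add_left blinfun.scaleR_left inner_add_left inner_add_right)

lemma sqrt_iter_commute:
  fixes A :: "'a::real_normed_vector \<Rightarrow>\<^sub>L 'a"
  assumes "bounded_linear B" and "\<And>x. A (B x) = B (A x)"
  shows "sqrt_iter A n (B x) = B (sqrt_iter A n x)"
proof -
  interpret B: bounded_linear B by fact
  show ?thesis
    by (induction n arbitrary: x)
       (auto simp: assms(2) blinfun.add_left blinfun.scaleR_left B.zero B.add B.scaleR)
qed

lemma norm_one_minus_positive:
  fixes T :: "'a::real_inner \<Rightarrow>\<^sub>L 'a"
  assumes sym: "\<And>x y. inner (T x) y = inner x (T y)"
    and pos: "\<And>x. 0 \<le> inner (T x) x" and T: "norm T \<le> 1"
  shows "norm (id_blinfun - T) \<le> 1"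
proof (rule norm_blinfun_bound)
  fix x
  have Tn: "norm (T y) \<le> norm y" for y
    using norm_blinfun[of T y] T mult_right_mono[OF T norm_ge_zero[of y]] by simp
  \<comment> \<open>positivity of \<open>T\<close> at \<open>x - T x\<close> yields \<open>\<parallel>T x\<parallel>\<^sup>2 \<le> \<langle>T x, x\<rangle>\<close>\<close>
  have "0 \<le> inner (T (x - T x)) (x - T x)" by (rule pos)
  then have "0 \<le> inner (T x) x - 2 * inner (T x) (T x) + inner (T (T x)) (T x)"
    by (simp add: blinfun.diff_right inner_diff sym)
  moreover have "inner (T (T x)) (T x) \<le> norm (T (T x)) * norm (T x)"
    by (rule norm_cauchy_schwarz)
  moreover have "\<dots> \<le> norm (T x) * norm (T x)"
    by (intro mult_right_mono Tn) auto
  ultimately have "inner (T x) (T x) \<le> inner (T x) x"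
    by (simp add: dot_square_norm power2_eq_square)
  then have "inner (x - T x) (x - T x) \<le> inner x x"
    using pos[of x] by (simp add: inner_diff inner_commute)
  then show "norm ((id_blinfun - T) x) \<le> 1 * norm x"
    by (simp add: blinfun.diff_left norm_eq_sqrt_inner)
qed simp

lemma positive_operator_sqrt_contraction:
  fixes T :: "'a::{real_inner, banach} \<Rightarrow>\<^sub>L 'a"
  assumes sym: "\<And>x y. inner (T x) y = inner x (T y)"
    and pos: "\<And>x. 0 \<le> inner (T x) x" and T: "norm T \<le> 1"
  shows "\<exists>S :: 'a \<Rightarrow>\<^sub>L 'a. (\<forall>x y. inner (S x) y = inner x (S y)) \<and> (\<forall>x. S (S x) = T x) \<and>
    (\<forall>B. bounded_linear B \<longrightarrow> (\<forall>x. T (B x) = B (T x)) \<longrightarrow> (\<forall>x. S (B x) = B (S x)))"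
proof -
  define A where "A = id_blinfun - T"
  have A: "norm A \<le> 1"
    unfolding A_def by (rule norm_one_minus_positive[OF sym pos T])
  obtain R where R: "sqrt_iter A \<longlonglongrightarrow> R"
    using sqrt_iter_Cauchy[OF A] Cauchy_convergent convergent_def by blast
  have Rx: "(\<lambda>n. sqrt_iter A n x) \<longlonglongrightarrow> R x" for x
    by (intro tendsto_intros R)
  have "(\<lambda>n. sqrt_iter A (Suc n)) \<longlonglongrightarrow> (1/2) *\<^sub>R (A + (R o\<^sub>L R))"
    unfolding sqrt_iter.simps
    by (intro tendsto_intros R bounded_bilinear.tendsto[OF bounded_bilinear_blinfun_compose])
  then have fixpoint: "R = (1/2) *\<^sub>R (A + (R o\<^sub>L R))"
    using LIMSEQ_unique LIMSEQ_Suc[OF R] by blast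
  have symA: "inner (A x) y = inner x (A y)" for x y
    by (simp add: A_def blinfun.diff_left inner_diff sym)
  have symR: "inner (R x) y = inner x (R y)" for x y
  proof (rule LIMSEQ_unique)
    show "(\<lambda>n. inner (sqrt_iter A n x) y) \<longlonglongrightarrow> inner (R x) y"
      by (intro tendsto_intros Rx)
    show "(\<lambda>n. inner (sqrt_iter A n x) y) \<longlonglongrightarrow> inner x (R y)"
      unfolding sqrt_iter_symmetric[OF symA] by (intro tendsto_intros Rx)
  qed
  have commR: "R (B x) = B (R x)" if B: "bounded_linear B" and TB: "\<And>x. T (B x) = B (T x)" for B x
  proof (rule LIMSEQ_unique)
    interpret B: bounded_linear B by fact
    have AB: "A (B x) = B (A x)" for x
      by (simp add: A_def blinfun.diff_left B.diff TB)
    show "(\<lambda>n. sqrt_iter A n (B x)) \<longlonglongrightarrow> R (B x)" by (rule Rx)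
    show "(\<lambda>n. sqrt_iter A n (B x)) \<longlonglongrightarrow> B (R x)"
      unfolding sqrt_iter_commute[OF B AB] by (intro B.tendsto Rx)
  qed
  define S where "S = id_blinfun - R"
  have RR: "R (R x) = 2 *\<^sub>R R x - x + T x" for x
  proof -
    have "2 *\<^sub>R R x = 2 *\<^sub>R ((1/2) *\<^sub>R (A + (R o\<^sub>L R))) x"
      using fixpoint by simp
    then have "2 *\<^sub>R R x = A x + R (R x)"
      by (simp add: blinfun.scaleR_left blinfun.add_left)
    then show ?thesis by (simp add: A_def blinfun.diff_left algebra_simps)
  qed
  have "S (S x) = T x" for x
    using RR[of x] by (simp add: S_def blinfun.diff_left blinfun.diff_right algebra_simps scaleR_2)
  moreover have "inner (S x) y = inner x (S y)" for x y
    by (simp add: S_def blinfun.diff_left inner_diff symR)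
  moreover have "S (B x) = B (S x)" if "bounded_linear B" "\<forall>x. T (B x) = B (T x)" for B x
    using commR[OF that(1), of x] that linear_diff[OF bounded_linear.linear[OF that(1)], of x "R x"]
    by (simp add: S_def blinfun.diff_left)
  ultimately show ?thesis by blast
qed

text \<open>The general case, by scaling.  The last conjunct is what keeps the root complex linear and inside
  the commutant that contains \<open>T\<close>.\<close>

lemma positive_operator_sqrt:
  fixes T :: "'a::{real_inner, banach} \<Rightarrow> 'a"
  assumes bl: "bounded_linear T" and sym: "\<And>x y. inner (T x) y = inner x (T y)"
    and pos: "\<And>x. 0 \<le> inner (T x) x"
  shows "\<exists>S. bounded_linear S \<and> (\<forall>x y. inner (S x) y = inner x (S y)) \<and> (\<forall>x. S (S x) = T x) \<and>
    (\<forall>B. bounded_linear B \<longrightarrow> (\<forall>x. T (B x) = B (T x)) \<longrightarrow> (\<forall>x. S (B x) = B (S x)))"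
proof -
  interpret T: bounded_linear T by fact
  define c where "c = norm (Blinfun T) + 1"
  have c: "0 < c" by (simp add: c_def add_nonneg_pos)
  define T' where "T' = (1/c) *\<^sub>R Blinfun T"
  have T': "T' x = (1/c) *\<^sub>R T x" for x
    by (simp add: T'_def blinfun.scaleR_left bounded_linear_Blinfun_apply[OF bl])
  have "norm T' \<le> 1" using c by (simp add: T'_def) (simp add: c_def)
  moreover have "inner (T' x) y = inner x (T' y)" "0 \<le> inner (T' x) x" for x y
    using c pos[of x] by (simp_all add: T' sym)
  ultimately obtain S' :: "'a \<Rightarrow>\<^sub>L 'a" where S': "\<And>x y. inner (S' x) y = inner x (S' y)"
      "\<And>x. S' (S' x) = T' x"
      "\<And>B x. bounded_linear B \<Longrightarrow> (\<And>x. T' (B x) = B (T' x)) \<Longrightarrow> S' (B x) = B (S' x)"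
    using positive_operator_sqrt_contraction[of T'] by blast
  show ?thesis
  proof (intro exI[of _ "\<lambda>x. sqrt c *\<^sub>R S' x"] conjI allI impI)
    show "bounded_linear (\<lambda>x. sqrt c *\<^sub>R S' x)"
      by (intro bounded_linear_intros blinfun.bounded_linear_right)
    show "inner (sqrt c *\<^sub>R S' x) y = inner x (sqrt c *\<^sub>R S' y)" for x y
      by (simp add: S')
    show "sqrt c *\<^sub>R S' (sqrt c *\<^sub>R S' x) = T x" for x
      using c by (simp add: blinfun.scaleR_right S' T')
    fix B :: "'a \<Rightarrow> 'a" and x assume B: "bounded_linear B" "\<forall>x. T (B x) = B (T x)"
    interpret B: bounded_linear B by fact
    have "S' (B x) = B (S' x)"
      using B(2) by (intro S'(3) B(1)) (simp add: T' B.scaleR)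
    then show "sqrt c *\<^sub>R S' (B x) = B (sqrt c *\<^sub>R S' x)"
      by (simp add: B.scaleR)
  qed
qed

section \<open>The Hilbert space of square integrable functions\<close>

lemma l2_rel_rep: "l2_rel (rep_l2 f) (rep_l2 f)"
  by (rule Quotient_rep_reflp[OF Quotient_l2])

lemma sq_integrable_rep [simp]: "sq_integrable (rep_l2 f)"
  using l2_rel_rep[of f] by (simp add: l2_rel_def)

lemma rep_measurable [measurable]: "rep_l2 f \<in> borel_measurable haar"
  using sq_integrable_rep[of f] by (simp add: sq_integrable_def)

lemma abs_rep_l2 [simp]: "abs_l2 (rep_l2 f) = f"
  by (rule Quotient_abs_rep[OF Quotient_l2])

lemma rep_abs_l2: "sq_integrable u \<Longrightarrow> AE x in haar. rep_l2 (abs_l2 u) x = u x"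
  using Quotient_rep_abs[OF Quotient_l2, of u] by (simp add: l2_rel_def)

lemma abs_l2_eqI:
  "sq_integrable u \<Longrightarrow> sq_integrable v \<Longrightarrow> AE x in haar. u x = v x \<Longrightarrow> abs_l2 u = abs_l2 v"
  by (rule Quotient_rel_abs[OF Quotient_l2]) (simp add: l2_rel_def)

lemma cinner_abs:
  "sq_integrable u \<Longrightarrow> sq_integrable v \<Longrightarrow> cinner (abs_l2 u) (abs_l2 v) = (\<integral>x. u x * cnj (v x) \<partial>haar)"
  by (rule cinner.abs_eq) (auto simp: l2_rel_def)

lemma cinner_rep: "cinner f g = (\<integral>x. rep_l2 f x * cnj (rep_l2 g x) \<partial>haar)"
  using cinner_abs[of "rep_l2 f" "rep_l2 g"] by simp

lemma cinner_abs_right: "sq_integrable v \<Longrightarrow> cinner f (abs_l2 v) = (\<integral>x. rep_l2 f x * cnj (v x) \<partial>haar)"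
  using cinner_abs[of "rep_l2 f" v] by simp

lemma cinner_abs_left: "sq_integrable v \<Longrightarrow> cinner (abs_l2 v) f = (\<integral>x. v x * cnj (rep_l2 f x) \<partial>haar)"
  using cinner_abs[of v "rep_l2 f"] by simp

lemma plus_abs: "sq_integrable u \<Longrightarrow> sq_integrable v \<Longrightarrow> abs_l2 u + abs_l2 v = abs_l2 (\<lambda>x. u x + v x)"
  by (rule plus_l2.abs_eq) (auto simp: l2_rel_def)

lemma cscale_abs: "sq_integrable u \<Longrightarrow> cscale c (abs_l2 u) = abs_l2 (\<lambda>x. c * u x)"
  by (rule cscale.abs_eq) (auto simp: l2_rel_def)

lemma lreg_abs: "sq_integrable u \<Longrightarrow> lreg x (abs_l2 u) = abs_l2 (\<lambda>y. u (- x + y))"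
  by (rule lreg.abs_eq) (auto simp: l2_rel_def)

lemma minus_abs: "sq_integrable u \<Longrightarrow> sq_integrable v \<Longrightarrow> abs_l2 u - abs_l2 v = abs_l2 (\<lambda>x. u x - v x)"
  by (simp add: minus_l2_def uminus_l2_def cscale_abs plus_abs sq_integrable_scale[of v "-1", simplified])

lemma sq_integrable_diff: "sq_integrable u \<Longrightarrow> sq_integrable v \<Longrightarrow> sq_integrable (\<lambda>x. u x - v x)"
  using sq_integrable_add[OF _ sq_integrable_scale[of v "-1"], of u] by simp

lemma sq_integrable_nn:
  "sq_integrable u \<longleftrightarrow> u \<in> borel_measurable haar \<and> (\<integral>\<^sup>+ x. ennreal ((cmod (u x))\<^sup>2) \<partial>haar) < \<infinity>"
  by (auto simp: sq_integrable_def integrable_iff_bounded)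

lemma norm_l2_sq: "(norm f)\<^sup>2 = Re (cinner f f)"
  by (simp add: norm_l2_def cinner_self(2))

lemma norm_abs_sq:
  assumes "sq_integrable u"
  shows "(norm (abs_l2 u))\<^sup>2 = (\<integral>x. (cmod (u x))\<^sup>2 \<partial>haar)"
  by (simp add: norm_l2_sq cinner_abs[OF assms assms] complex_norm_square[symmetric] del: of_real_power)

lemma nn_norm_abs_sq:
  assumes "sq_integrable u"
  shows "(\<integral>\<^sup>+ x. ennreal ((cmod (u x))\<^sup>2) \<partial>haar) = ennreal ((norm (abs_l2 u))\<^sup>2)"
  using assms unfolding norm_abs_sq[OF assms] sq_integrable_def
  by (intro nn_integral_eq_integral) auto

lemma cinner_cscale_right: "cinner f (cscale c g) = cnj c * cinner f g"
proof -
  have "cinner f (cscale c g) = cnj (c * cinner g f)"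
    by (subst cinner_commute) (simp add: cinner_cscale_left)
  also have "\<dots> = cnj c * cinner f g"
    by (simp only: complex_cnj_mult cinner_commute[of f g])
  finally show ?thesis .
qed

lemma cinner_norm_le: "cmod (cinner f g) \<le> norm f * norm g"
proof (cases "cinner f g = 0")
  case False
  let ?z = "cinner f g"
  define c where "c = cnj ?z / complex_of_real (cmod ?z)"
  have zz: "cnj ?z * ?z = complex_of_real (cmod ?z) * complex_of_real (cmod ?z)"
    by (simp only: mult.commute[of "cnj ?z"] complex_norm_square[symmetric] power2_eq_square of_real_mult)
  have "c * ?z = complex_of_real (cmod ?z)"
    using False zz by (simp add: c_def)
  then have "cmod (cinner f g) = inner (cscale c f) g"
    by (simp add: inner_l2_def cinner_cscale_left)
  also have "\<dots> \<le> norm (cscale c f) * norm g"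
    by (rule norm_cauchy_schwarz)
  also have "norm (cscale c f) = norm f"
  proof -
    have "cinner (cscale c f) (cscale c f) = (c * cnj c) * cinner f f"
      by (simp add: cinner_cscale_left cinner_cscale_right)
    also have "c * cnj c = 1"
      using False zz by (simp add: c_def)
    finally show ?thesis by (simp add: norm_l2_def)
  qed
  finally show ?thesis .
qed simp

lemma Cauchy_fast_subsequence:
  fixes X :: "nat \<Rightarrow> 'a::metric_space" and e :: "nat \<Rightarrow> real"
  assumes "Cauchy X" and e: "\<And>n. 0 < e n"
  obtains r where "strict_mono r" "\<And>n m. m \<ge> r n \<Longrightarrow> dist (X m) (X (r n)) < e n"
proof -
  have "\<exists>N. \<forall>m\<ge>N. \<forall>k\<ge>N. dist (X m) (X k) < e n" for n
    using assms by (auto simp: Cauchy_def)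
  then obtain N where N: "\<And>n m k. m \<ge> N n \<Longrightarrow> k \<ge> N n \<Longrightarrow> dist (X m) (X k) < e n"
    by metis
  define r where "r n = (\<Sum>i\<le>n. Suc (N i))" for n
  have "Suc (N n) \<le> r n" for n
    unfolding r_def by (rule member_le_sum) auto
  then have "N n \<le> r n" for n
    using Suc_leD by blast
  then have "dist (X m) (X (r n)) < e n" if "m \<ge> r n" for m n
    using that by (intro N) (auto intro: order_trans)
  moreover have "strict_mono r"
    by (rule strict_monoI_Suc) (simp add: r_def)
  ultimately show thesis using that by blast
qed

lemma summable_geometric_increments_convergent:
  fixes u :: "nat \<Rightarrow> complex"
  assumes "(\<Sum>n. ennreal (4 ^ n * (cmod (u (Suc n) - u n))\<^sup>2)) < \<infinity>"
  shows "convergent u"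
proof -
  have "summable (\<lambda>n. 4 ^ n * (cmod (u (Suc n) - u n))\<^sup>2)"
    using assms by (intro summable_suminf_not_top) auto
  then have "(\<lambda>n. 4 ^ n * (cmod (u (Suc n) - u n))\<^sup>2) \<longlonglongrightarrow> 0"
    by (rule summable_LIMSEQ_zero)
  then have "\<forall>\<^sub>F n in sequentially. 4 ^ n * (cmod (u (Suc n) - u n))\<^sup>2 < 1"
    by (rule order_tendstoD) simp
  then have "\<forall>\<^sub>F n in sequentially. norm (u (Suc n) - u n) \<le> (1/2) ^ n"
  proof eventually_elim
    case (elim n)
    then have "(2 ^ n * cmod (u (Suc n) - u n))\<^sup>2 \<le> 1\<^sup>2"
      by (simp add: power_mult_distrib power_mult[symmetric] mult.commute[of n]) (simp add: power_mult)
    then have "2 ^ n * cmod (u (Suc n) - u n) \<le> 1"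
      by (rule power2_le_imp_le) simp
    then show ?case by (simp add: power_one_over field_simps)
  qed
  then have "summable (\<lambda>n. u (Suc n) - u n)"
    by (rule summable_comparison_test_ev) (simp add: summable_geometric)
  then have "convergent (\<lambda>n. \<Sum>i<n. u (Suc i) - u i)"
    by (simp add: summable_iff_convergent)
  then have "convergent (\<lambda>n. u n - u 0)"
    by (simp add: sum_lessThan_telescope)
  then have "convergent (\<lambda>n. (u n - u 0) + u 0)"
    by (intro convergent_add convergent_const)
  then show ?thesis by simp
qed

text \<open>The Riesz--Fischer argument.  Pass to a subsequence whose increments are at most \<open>4\<^sup>-\<^sup>n\<close> in norm.  Then
  the integral of \<open>\<Sum>\<^sub>n 4\<^sup>n |u\<^sub>n\<^sub>+\<^sub>1 - u\<^sub>n|\<^sup>2\<close> is finite, so almost everywhere the increments are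
  eventually at most \<open>2\<^sup>-\<^sup>n\<close> and the subsequence converges pointwise; by Fatou the limit is also
  the limit in norm.\<close>

lemma l2_Cauchy_convergent:
  fixes X :: "nat \<Rightarrow> 'g::lc_group l2"
  assumes X: "Cauchy X"
  shows "convergent X"
proof -
  obtain r where r: "strict_mono r" "\<And>n m. m \<ge> r n \<Longrightarrow> dist (X m) (X (r n)) < (1/4) ^ n"
    using Cauchy_fast_subsequence[OF X, of "\<lambda>n. (1/4) ^ n"] by auto
  define u where "u n = rep_l2 (X (r n))" for n
  have u_abs: "abs_l2 (u n) = X (r n)" for n by (simp add: u_def)
  have u_sq: "sq_integrable (u n)" for n by (simp add: u_def)
  have u_meas [measurable]: "u n \<in> borel_measurable haar" for n by (simp add: u_def)
  have nn_diff: "(\<integral>\<^sup>+ x. ennreal ((cmod (u m x - u n x))\<^sup>2) \<partial>haar) = ennreal ((dist (X (r m)) (X (r n)))\<^sup>2)" for m n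
    using nn_norm_abs_sq[OF sq_integrable_diff[OF u_sq[of m] u_sq[of n]]]
    by (simp add: minus_abs[OF u_sq u_sq, symmetric] u_abs dist_norm)
  have d: "(dist (X (r m)) (X (r n)))\<^sup>2 \<le> (1/16) ^ n" if "m \<ge> n" for m n
  proof -
    have "r m \<ge> r n" using r(1) that by (simp add: strict_mono_less_eq)
    then have "(dist (X (r m)) (X (r n)))\<^sup>2 \<le> ((1/4) ^ n)\<^sup>2"
      by (intro power_mono less_imp_le[OF r(2)] zero_le_dist)
    then show ?thesis by (simp add: power2_eq_square flip: power_mult_distrib)
  qed
  have "(\<integral>\<^sup>+ x. (\<Sum>n. ennreal (4 ^ n * (cmod (u (Suc n) x - u n x))\<^sup>2)) \<partial>haar)
      = (\<Sum>n. \<integral>\<^sup>+ x. ennreal (4 ^ n) * ennreal ((cmod (u (Suc n) x - u n x))\<^sup>2) \<partial>haar)"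
    by (subst nn_integral_suminf) (simp_all add: ennreal_mult)
  also have "\<dots> = (\<Sum>n. ennreal (4 ^ n * (dist (X (r (Suc n))) (X (r n)))\<^sup>2))"
    by (simp add: nn_integral_cmult nn_diff ennreal_mult)
  also have "\<dots> \<le> (\<Sum>n. ennreal ((1/4) ^ n))"
  proof (intro suminf_le summableI ennreal_leI)
    fix n
    have "4 ^ n * (dist (X (r (Suc n))) (X (r n)))\<^sup>2 \<le> 4 ^ n * (1/16) ^ n"
      by (intro mult_left_mono d) auto
    also have "\<dots> = (1/4 :: real) ^ n" by (simp flip: power_mult_distrib)
    finally show "4 ^ n * (dist (X (r (Suc n))) (X (r n)))\<^sup>2 \<le> (1/4) ^ n" .
  qed
  also have "\<dots> = ennreal (\<Sum>n. (1/4) ^ n)"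
    by (rule suminf_ennreal2) (auto intro: summable_geometric)
  also have "\<dots> < \<infinity>" by simp
  finally have "(\<integral>\<^sup>+ x. (\<Sum>n. ennreal (4 ^ n * (cmod (u (Suc n) x - u n x))\<^sup>2)) \<partial>haar) \<noteq> \<infinity>"
    by simp
  then have "AE x in haar. (\<Sum>n. ennreal (4 ^ n * (cmod (u (Suc n) x - u n x))\<^sup>2)) \<noteq> \<infinity>"
    by (intro nn_integral_PInf_AE) measurable
  then have conv: "AE x in haar. (\<lambda>n. u n x) \<longlonglongrightarrow> lim (\<lambda>n. u n x)"
  proof eventually_elim
    case (elim x)
    then have "convergent (\<lambda>n. u n x)"
      by (intro summable_geometric_increments_convergent) (simp add: less_top)
    then show ?case
      by (simp add: convergent_LIMSEQ_iff)
  qed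
  define v where "v x = lim (\<lambda>n. u n x)" for x
  have v_meas [measurable]: "v \<in> borel_measurable haar"
    unfolding v_def by measurable
  have bound: "(\<integral>\<^sup>+ x. ennreal ((cmod (v x - u n x))\<^sup>2) \<partial>haar) \<le> ennreal ((1/16) ^ n)" for n
  proof -
    have "(\<integral>\<^sup>+ x. ennreal ((cmod (v x - u n x))\<^sup>2) \<partial>haar)
        = (\<integral>\<^sup>+ x. liminf (\<lambda>m. ennreal ((cmod (u m x - u n x))\<^sup>2)) \<partial>haar)"
    proof (rule nn_integral_cong_AE)
      show "AE x in haar. ennreal ((cmod (v x - u n x))\<^sup>2) = liminf (\<lambda>m. ennreal ((cmod (u m x - u n x))\<^sup>2))"
        using conv
      proof eventually_elim
        case (elim x)
        then have "(\<lambda>m. ennreal ((cmod (u m x - u n x))\<^sup>2)) \<longlonglongrightarrow> ennreal ((cmod (v x - u n x))\<^sup>2)"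
          unfolding v_def by (intro tendsto_intros)
        then show ?case
          by (intro lim_imp_Liminf[symmetric]) auto
      qed
    qed
    also have "\<dots> \<le> liminf (\<lambda>m. \<integral>\<^sup>+ x. ennreal ((cmod (u m x - u n x))\<^sup>2) \<partial>haar)"
      by (rule nn_integral_liminf) measurable
    also have "\<dots> \<le> ennreal ((1/16) ^ n)"
    proof (rule Liminf_le)
      show "\<forall>\<^sub>F m in sequentially. (\<integral>\<^sup>+ x. ennreal ((cmod (u m x - u n x))\<^sup>2) \<partial>haar) \<le> ennreal ((1/16) ^ n)"
        by (rule eventually_sequentiallyI[of n]) (simp only: nn_diff, intro ennreal_leI d)
    qed simp
    finally show ?thesis .
  qed
  have diff_sq: "sq_integrable (\<lambda>x. v x - u n x)" for n
    using bound[of n] by (auto simp: sq_integrable_nn intro: le_less_trans)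
  have v_sq: "sq_integrable v"
    using sq_integrable_add[OF diff_sq[of 0] u_sq[of 0]] by simp
  have "dist (X (r n)) (abs_l2 v) \<le> (1/4) ^ n" for n
  proof -
    have "ennreal ((norm (abs_l2 v - X (r n)))\<^sup>2) \<le> ennreal ((1/16) ^ n)"
      using bound[of n] nn_norm_abs_sq[OF diff_sq[of n]] by (simp add: minus_abs[OF v_sq u_sq, symmetric] u_abs)
    then have "(norm (abs_l2 v - X (r n)))\<^sup>2 \<le> ((1/4) ^ n)\<^sup>2"
      by (simp add: power2_eq_square flip: power_mult_distrib)
    then have "norm (abs_l2 v - X (r n)) \<le> (1/4) ^ n"
      by (rule power2_le_imp_le) simp
    then show ?thesis
      by (simp only: dist_norm norm_minus_commute[of "X (r n)"])
  qed
  then have "(\<lambda>n. dist (X (r n)) (abs_l2 v)) \<longlonglongrightarrow> 0"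
    by (intro tendsto_sandwich[OF _ _ tendsto_const LIMSEQ_power_zero[of "1/4 :: real"]] always_eventually allI)
      simp_all
  then have "(X \<circ> r) \<longlonglongrightarrow> abs_l2 v"
    unfolding o_def by (rule iffD2[OF tendsto_dist_iff])
  then have "X \<longlonglongrightarrow> abs_l2 v"
    by (rule Cauchy_converges_subseq[OF X r(1)])
  then show ?thesis by (auto simp: convergent_def)
qed

instance l2 :: (lc_group) complete_space
  by standard (rule l2_Cauchy_convergent)

instance l2 :: (lc_group) banach ..

section \<open>Operators, projections and the commutant of the regular representation\<close>

lemma cinner_add_right: "cinner f (g + h) = cinner f g + cinner f h"
  by (subst (1 2 3) cinner_commute) (simp add: cinner_add_left)

lemma cscale_minus_one: "cscale (-1) f = - f"
  by (simp add: uminus_l2_def)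

lemma cinner_minus_left: "cinner (- f) g = - cinner f g"
  by (simp add: uminus_l2_def cinner_cscale_left)

lemma cinner_minus_right: "cinner f (- g) = - cinner f g"
  by (simp add: uminus_l2_def cinner_cscale_right)

lemma cinner_diff_left: "cinner (f - g) h = cinner f h - cinner g h"
  by (simp only: minus_l2_def cinner_add_left cinner_minus_left) simp

lemma cinner_diff_right: "cinner f (g - h) = cinner f g - cinner f h"
  by (simp only: minus_l2_def cinner_add_right cinner_minus_right) simp

lemma cinner_zero_left [simp]: "cinner 0 f = 0"
  using cinner_cscale_left[of 0 f f] cinner_diff_left[of f f f] by simp

lemma cinner_zero_right [simp]: "cinner f 0 = 0"
  using cinner_diff_right[of f f f] by simp

lemma cinner_eqI:
  assumes "\<And>k. cinner k f = cinner k g"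
  shows "f = g"
proof -
  have "cinner (f - g) (f - g) = 0"
    by (simp add: cinner_diff_right assms)
  then show ?thesis
    using cinner_eq_0[of "f - g"] by simp
qed

lemma cinner_self_norm: "cinner f f = complex_of_real ((norm f)\<^sup>2)"
  using cinner_self(1)[of f] by (simp only: norm_l2_sq)

lemma cscale_add_right: "cscale c (f + g) = cscale c f + cscale c g"
  by (rule cinner_eqI) (simp add: cinner_cscale_right cinner_add_right distrib_left)

lemma cscale_cscale: "cscale c (cscale d f) = cscale (c * d) f"
  by (rule cinner_eqI) (simp add: cinner_cscale_right)

lemma cscale_one [simp]: "cscale 1 f = f"
  by (rule cinner_eqI) (simp add: cinner_cscale_right)

lemma norm_cscale: "norm (cscale c f) = cmod c * norm f"
proof -
  have "complex_of_real ((norm (cscale c f))\<^sup>2) = (c * cnj c) * complex_of_real ((norm f)\<^sup>2)"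
    by (simp only: cinner_self_norm[symmetric]) (simp add: cinner_cscale_left cinner_cscale_right)
  then have "(norm (cscale c f))\<^sup>2 = (cmod c * norm f)\<^sup>2"
    by (simp only: complex_norm_square[symmetric] of_real_mult[symmetric] of_real_eq_iff power_mult_distrib)
  then show ?thesis by (simp add: power2_eq_iff_nonneg)
qed

lemma bounded_clinearI:
  assumes "\<And>f g. A (f + g) = A f + A g" "\<And>c f. A (cscale c f) = cscale c (A f)"
    and "\<And>f. norm (A f) \<le> K * norm f"
  shows "bounded_clinear A"
  unfolding bounded_clinear_def
  by (auto intro!: bounded_linear_intro[of A K] simp: assms scaleR_l2_def mult.commute[of _ K])

lemma bounded_clinear_add: "bounded_clinear A \<Longrightarrow> A (f + g) = A f + A g"
  by (simp add: bounded_clinear_def bounded_linear.linear linear_add)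

lemma bounded_clinear_diff: "bounded_clinear A \<Longrightarrow> A (f - g) = A f - A g"
  by (simp add: bounded_clinear_def bounded_linear.linear linear_diff)

lemma bounded_clinear_cscale: "bounded_clinear A \<Longrightarrow> A (cscale c f) = cscale c (A f)"
  by (simp add: bounded_clinear_def)

lemma bounded_clinear_zero: "bounded_clinear A \<Longrightarrow> A 0 = 0"
  by (simp add: bounded_clinear_def bounded_linear.linear linear_0)

lemma bounded_clinear_bound:
  assumes "bounded_clinear A"
  obtains K where "0 \<le> K" "\<And>f. norm (A f) \<le> K * norm f"
  using bounded_linear.nonneg_bounded[of A] assms by (auto simp: bounded_clinear_def mult.commute)

lemma bounded_clinear_cscale_op: "bounded_clinear (cscale c)"
  by (rule bounded_clinearI[where K="cmod c"])
    (simp_all add: cscale_add_right cscale_cscale norm_cscale mult.commute)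

lemma bounded_clinear_comp: "bounded_clinear A \<Longrightarrow> bounded_clinear B \<Longrightarrow> bounded_clinear (A \<circ> B)"
  unfolding bounded_clinear_def o_def by (auto intro: bounded_linear_compose)

lemma cadjoint_eqI:
  assumes "\<And>k. cinner (A k) f = cinner k h"
  shows "cadjoint UNIV A f = h"
  unfolding cadjoint_def using assms by (intro the_equality) (auto intro!: cinner_eqI)

text \<open>The Riesz representation of the real functional \<open>f \<mapsto> inner (A f) g\<close> gives the adjoint; imaginary
  parts follow by applying it to \<open>- \<i> f\<close>.\<close>

lemma cinner_cadjoint:
  assumes A: "bounded_clinear A"
  shows "cinner (A f) g = cinner f (cadjoint UNIV A g)"
proof -
  have "bounded_linear (\<lambda>f. inner (A f) g)"
    using A by (intro bounded_linear_intros) (simp add: bounded_clinear_def)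
  then obtain h where h: "\<And>f. inner (A f) g = inner f h"
    using riesz_representation by metis
  have "cinner (A f) g = cinner f h" for f
  proof (rule complex_eqI)
    show "Re (cinner (A f) g) = Re (cinner f h)"
      using h[of f] by (simp add: inner_l2_def)
    show "Im (cinner (A f) g) = Im (cinner f h)"
      using h[of "cscale (-\<i>) f"] by (simp add: inner_l2_def bounded_clinear_cscale[OF A] cinner_cscale_left)
  qed
  then show ?thesis
    using cadjoint_eqI[of A g h] by simp
qed

lemma cinner_cadjoint_left:
  assumes "bounded_clinear A"
  shows "cinner (cadjoint UNIV A g) f = cinner g (A f)"
  using cinner_cadjoint[OF assms, of f g] cinner_commute[of g "A f"]
    cinner_commute[of "cadjoint UNIV A g" f] by simp

lemma bounded_clinear_cadjoint:
  assumes A: "bounded_clinear A"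
  shows "bounded_clinear (cadjoint UNIV A)"
proof -
  obtain K where K: "0 \<le> K" "\<And>f. norm (A f) \<le> K * norm f"
    using bounded_clinear_bound[OF A] by blast
  let ?B = "cadjoint UNIV A"
  show ?thesis
  proof (rule bounded_clinearI)
    show "?B (f + g) = ?B f + ?B g" for f g
      by (rule cadjoint_eqI) (simp add: cinner_add_right cinner_cadjoint[OF A])
    show "?B (cscale c f) = cscale c (?B f)" for c f
      by (rule cadjoint_eqI) (simp add: cinner_cscale_right cinner_cadjoint[OF A])
    show "norm (?B f) \<le> K * norm f" for f
    proof (cases "norm (?B f) = 0")
      case False
      have "(norm (?B f))\<^sup>2 = cmod (cinner (?B f) (?B f))"
        by (simp add: cinner_self_norm norm_power)
      also have "\<dots> = cmod (cinner (A (?B f)) f)"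
        by (simp add: cinner_cadjoint[OF A])
      also have "\<dots> \<le> norm (A (?B f)) * norm f"
        by (rule cinner_norm_le)
      also have "\<dots> \<le> K * norm (?B f) * norm f"
        by (intro mult_right_mono K) simp
      finally have "norm (?B f) * norm (?B f) \<le> (K * norm f) * norm (?B f)"
        by (simp add: power2_eq_square algebra_simps)
      then show ?thesis using False
        by simp
    qed (use K in simp)
  qed
qed

lemma cadjoint_cadjoint:
  assumes "bounded_clinear A"
  shows "cadjoint UNIV (cadjoint UNIV A) = A"
  by (rule ext, rule cadjoint_eqI) (rule cinner_cadjoint_left[OF assms])

lemma cadjoint_comp:
  assumes "bounded_clinear A" "bounded_clinear B"
  shows "cadjoint UNIV (A \<circ> B) = cadjoint UNIV B \<circ> cadjoint UNIV A"
  by (rule ext, rule cadjoint_eqI) (simp add: cinner_cadjoint[OF assms(1)] cinner_cadjoint[OF assms(2)])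

lemma csubspace_subspace: "csubspace H \<Longrightarrow> subspace H"
  by (auto simp: csubspace_def subspace_def scaleR_l2_def)

lemma csubspace_diff: "csubspace H \<Longrightarrow> f \<in> H \<Longrightarrow> g \<in> H \<Longrightarrow> f - g \<in> H"
  by (simp add: csubspace_subspace subspace_diff)

locale closed_csubspace =
  fixes H :: "'g::lc_group l2 set"
  assumes csubspace: "csubspace H" and closed: "closed H"
begin

abbreviation p :: "'g l2 \<Rightarrow> 'g l2" where "p \<equiv> orth_proj H"

lemma orth_proj_eqI:
  assumes "h \<in> H" "\<And>k. k \<in> H \<Longrightarrow> cinner (f - h) k = 0"
  shows "p f = h"
  unfolding orth_proj_def
proof (rule the_equality)
  fix h' assume h': "h' \<in> H \<and> (\<forall>k\<in>H. cinner (f - h') k = 0)"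
  have "h' - h \<in> H" using h' assms(1) csubspace by (intro csubspace_diff) auto
  then have "cinner (f - h) (h' - h) = 0" "cinner (f - h') (h' - h) = 0"
    using h' assms by auto
  then have "cinner (h' - h) (h' - h) = 0"
    by (simp add: cinner_diff_left)
  then show "h' = h"
    using cinner_eq_0[of "h' - h"] by simp
qed (use assms in auto)

lemma orth_proj_mem: "p f \<in> H"
  and orth_proj_orthogonal: "k \<in> H \<Longrightarrow> cinner (f - p f) k = 0"
proof -
  obtain h where h: "h \<in> H" "\<And>k. k \<in> H \<Longrightarrow> inner (f - h) k = 0"
    using exists_orthogonal_projection[OF closed csubspace_subspace[OF csubspace]] by blast
  have *: "cinner (f - h) k = 0" if k: "k \<in> H" for k
  proof (rule complex_eqI)
    show "Re (cinner (f - h) k) = Re 0"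
      using h(2)[OF k] by (simp add: inner_l2_def)
    have "cscale \<i> k \<in> H"
      using k csubspace by (simp add: csubspace_def)
    from h(2)[OF this] show "Im (cinner (f - h) k) = Im 0"
      by (simp add: inner_l2_def cinner_cscale_right)
  qed
  have "p f = h" by (rule orth_proj_eqI[OF h(1) *])
  with h * show "p f \<in> H" "k \<in> H \<Longrightarrow> cinner (f - p f) k = 0" by auto
qed

lemma orth_proj_id: "f \<in> H \<Longrightarrow> p f = f"
  by (rule orth_proj_eqI) auto

lemma orth_proj_idem: "p (p f) = p f"
  by (rule orth_proj_id[OF orth_proj_mem])

lemma cinner_orth_proj_mem: "k \<in> H \<Longrightarrow> cinner (p f) k = cinner f k"
  using orth_proj_orthogonal[of k f] by (simp add: cinner_diff_left)

lemma cinner_orth_proj: "cinner (p f) g = cinner f (p g)"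
proof -
  have "cinner (p f) g = cnj (cinner g (p f))" by (rule cinner_commute)
  also have "cinner g (p f) = cinner (p g) (p f)"
    by (rule cinner_orth_proj_mem[OF orth_proj_mem, symmetric])
  also have "cnj \<dots> = cinner (p f) (p g)" by (rule cinner_commute[symmetric])
  also have "\<dots> = cinner f (p g)" by (rule cinner_orth_proj_mem[OF orth_proj_mem])
  finally show ?thesis .
qed

lemma bounded_clinear_orth_proj: "bounded_clinear p"
proof (rule bounded_clinearI)
  show "p (f + g) = p f + p g" for f g
    by (rule cinner_eqI) (simp add: cinner_orth_proj[symmetric] cinner_add_right)
  show "p (cscale c f) = cscale c (p f)" for c f
    by (rule cinner_eqI) (simp add: cinner_orth_proj[symmetric] cinner_cscale_right)
  show "norm (p f) \<le> 1 * norm f" for f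
  proof (cases "norm (p f) = 0")
    case False
    have "(norm (p f))\<^sup>2 = cmod (cinner (p f) (p f))"
      by (simp add: cinner_self_norm norm_power)
    also have "\<dots> = cmod (cinner f (p f))"
      by (simp add: cinner_orth_proj orth_proj_idem)
    also have "\<dots> \<le> norm f * norm (p f)"
      by (rule cinner_norm_le)
    finally show ?thesis using False by (simp add: power2_eq_square)
  qed simp
qed

lemma cadjoint_orth_proj: "cadjoint UNIV p = p"
  by (rule ext, rule cadjoint_eqI) (rule cinner_orth_proj)

end

lemma lreg_cinner: "cinner (lreg x f) (lreg x g) = cinner f g"
proof -
  have "cinner (lreg x (abs_l2 (rep_l2 f))) (lreg x (abs_l2 (rep_l2 g)))
      = (\<integral>y. rep_l2 f (- x + y) * cnj (rep_l2 g (- x + y)) \<partial>haar)"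
    by (simp only: lreg_abs sq_integrable_rep cinner_abs sq_integrable_translate)
  also have "\<dots> = (\<integral>y. rep_l2 f y * cnj (rep_l2 g y) \<partial>distr haar haar ((+) (- x)))"
    by (subst integral_distr[OF measurable_translate])
      (auto intro!: borel_measurable_integrable integrable_mult_cnj)
  finally show ?thesis
    by (simp add: distr_haar' cinner_rep)
qed

lemma lreg_lreg: "lreg x (lreg y f) = lreg (x + y) f"
  using lreg_abs[OF sq_integrable_rep[of f]] 
    lreg_abs[OF sq_integrable_translate[OF sq_integrable_rep[of f], of "- y"], of x]
  by (simp add: minus_add add.assoc del: add_uminus_conv_diff)

lemma lreg_zero [simp]: "lreg 0 f = f"
  using lreg_abs[OF sq_integrable_rep[of f], of 0] by simp

lemma lreg_cinner_left: "cinner (lreg x f) g = cinner f (lreg (- x) g)"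
  using lreg_cinner[of x f "lreg (- x) g"] by (simp add: lreg_lreg)

lemma lreg_cinner_right: "cinner f (lreg x g) = cinner (lreg (- x) f) g"
  by (simp add: lreg_cinner_left)

lemma norm_lreg [simp]: "norm (lreg x f) = norm f"
  by (simp add: norm_l2_def lreg_cinner)

lemma bounded_clinear_lreg: "bounded_clinear (lreg x)"
  by (rule bounded_clinearI[where K=1])
    (auto intro!: cinner_eqI simp: lreg_cinner_right cinner_add_right cinner_cscale_right)

lemma VN_r_bounded: "T \<in> VN_r \<Longrightarrow> bounded_clinear T"
  by (simp add: VN_r_def)

lemma VN_r_lreg: "T \<in> VN_r \<Longrightarrow> T (lreg x f) = lreg x (T f)"
  by (simp add: VN_r_def)

lemma VN_r_comp: "S \<in> VN_r \<Longrightarrow> T \<in> VN_r \<Longrightarrow> S \<circ> T \<in> VN_r"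
  by (simp add: VN_r_def bounded_clinear_comp)

lemma VN_r_cadjoint:
  assumes T: "T \<in> VN_r"
  shows "cadjoint UNIV T \<in> VN_r"
proof -
  note bT = VN_r_bounded[OF T]
  have "cadjoint UNIV T (lreg x f) = lreg x (cadjoint UNIV T f)" for x f
    by (rule cadjoint_eqI)
      (simp add: lreg_cinner_right VN_r_lreg[OF T, symmetric] cinner_cadjoint[OF bT])
  then show ?thesis
    by (simp add: VN_r_def bounded_clinear_cadjoint[OF bT])
qed

lemma VN_r_combination:
  assumes S: "S \<in> VN_r" and T: "T \<in> VN_r"
  shows "(\<lambda>f. S f + cscale c (T f)) \<in> VN_r"
proof -
  note bS = VN_r_bounded[OF S] and bT = VN_r_bounded[OF T]
  obtain K where K: "\<And>f. norm (S f) \<le> K * norm f" using bounded_clinear_bound[OF bS] by blast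
  obtain L where L: "\<And>f. norm (T f) \<le> L * norm f" using bounded_clinear_bound[OF bT] by blast
  have "bounded_clinear (\<lambda>f. S f + cscale c (T f))"
  proof (rule bounded_clinearI)
    show "norm (S f + cscale c (T f)) \<le> (K + cmod c * L) * norm f" for f
    proof -
      have "norm (S f + cscale c (T f)) \<le> norm (S f) + cmod c * norm (T f)"
        using norm_triangle_ineq[of "S f" "cscale c (T f)"] by (simp add: norm_cscale)
      also have "\<dots> \<le> K * norm f + cmod c * (L * norm f)"
        by (intro add_mono K mult_left_mono L) simp
      finally show ?thesis by (simp add: algebra_simps)
    qed
  qed (simp_all add: bounded_clinear_add[OF bS] bounded_clinear_add[OF bT] cscale_add_right
      bounded_clinear_cscale[OF bS] bounded_clinear_cscale[OF bT] cscale_cscale mult.commute add.assoc add.left_commute)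
  then show ?thesis
    by (simp add: VN_r_def VN_r_lreg[OF S] VN_r_lreg[OF T] bounded_clinear_add[OF bounded_clinear_lreg]
        bounded_clinear_cscale[OF bounded_clinear_lreg])
qed

lemma VN_r_diff: "S \<in> VN_r \<Longrightarrow> T \<in> VN_r \<Longrightarrow> (\<lambda>f. S f - T f) \<in> VN_r"
  using VN_r_combination[of S T "-1"] by (simp add: cscale_minus_one)

text \<open>A positive operator is symmetric, since its form \<open>\<langle>T f, f\<rangle>\<close> is real: evaluate at
  \<open>f + \<i> g\<close>.\<close>

lemma positive_imp_symmetric:
  assumes T: "bounded_clinear T" and pos: "\<And>f. cinner (T f) f \<in> \<real>\<^sub>\<ge>\<^sub>0"
  shows "inner (T f) g = inner f (T g)"
proof -
  have real: "Im (cinner (T h) h) = 0" for h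
    using pos[of h] by (auto simp: complex_nonneg_Reals_iff)
  have "Im (cinner (T (f + cscale \<i> g)) (f + cscale \<i> g)) = 0" by (rule real)
  then have "Re (cinner (T g) f) = Re (cinner (T f) g)"
    using real[of f] real[of g]
    by (simp add: bounded_clinear_add[OF T] bounded_clinear_cscale[OF T] cinner_add_left cinner_add_right
        cinner_cscale_left cinner_cscale_right)
  then show ?thesis
    by (simp add: inner_l2_def cinner_commute[of f "T g"])
qed

lemma VN_r_sqrt:
  assumes T: "T \<in> VN_r" and pos: "\<And>f. cinner (T f) f \<in> \<real>\<^sub>\<ge>\<^sub>0"
  obtains S where "S \<in> VN_r" "cadjoint UNIV S = S" "S \<circ> S = T"
proof -
  note bT = VN_r_bounded[OF T]
  have "\<exists>S. bounded_linear S \<and> (\<forall>x y. inner (S x) y = inner x (S y)) \<and> (\<forall>x. S (S x) = T x) \<and>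
    (\<forall>B. bounded_linear B \<longrightarrow> (\<forall>x. T (B x) = B (T x)) \<longrightarrow> (\<forall>x. S (B x) = B (S x)))"
  proof (rule positive_operator_sqrt)
    show "bounded_linear T" using bT by (simp add: bounded_clinear_def)
    show "inner (T x) y = inner x (T y)" for x y by (rule positive_imp_symmetric[OF bT pos])
    show "0 \<le> inner (T x) x" for x
      using pos[of x] by (simp add: inner_l2_def complex_nonneg_Reals_iff)
  qed
  then obtain S where S: "bounded_linear S" "\<And>x y. inner (S x) y = inner x (S y)" "\<And>x. S (S x) = T x"
    "\<And>B x. bounded_linear B \<Longrightarrow> (\<And>x. T (B x) = B (T x)) \<Longrightarrow> S (B x) = B (S x)"
    by blast
  have Sc: "S (cscale c f) = cscale c (S f)" for c f
    using bounded_clinear_cscale_op[of c] by (intro S(4)) (auto simp: bounded_clinear_def bounded_clinear_cscale[OF bT])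
  have "S (lreg x f) = lreg x (S f)" for x f
    using bounded_clinear_lreg[of x] by (intro S(4)) (auto simp: bounded_clinear_def VN_r_lreg[OF T])
  then have SV: "S \<in> VN_r"
    using S(1) Sc by (simp add: VN_r_def bounded_clinear_def)
  have "cadjoint UNIV S g = S g" for g
  proof (rule cadjoint_eqI)
    fix f
    show "cinner (S f) g = cinner f (S g)"
    proof (rule complex_eqI)
      show "Re (cinner (S f) g) = Re (cinner f (S g))"
        using S(2)[of f g] by (simp add: inner_l2_def)
      show "Im (cinner (S f) g) = Im (cinner f (S g))"
        using S(2)[of "cscale (-\<i>) f" g] by (simp add: inner_l2_def Sc cinner_cscale_left)
    qed
  qed
  with SV S(3) that[of S] show thesis by (auto simp: fun_eq_iff)
qed

lemma (in closed_csubspace) orth_proj_VN_r: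
  assumes inv: "\<And>x f. f \<in> H \<Longrightarrow> lreg x f \<in> H"
  shows "p \<in> VN_r"
proof -
  have "p (lreg x f) = lreg x (p f)" for x f
  proof (rule orth_proj_eqI)
    show "lreg x (p f) \<in> H" by (intro inv orth_proj_mem)
    fix k assume "k \<in> H"
    then have "cinner (f - p f) (lreg (- x) k) = 0"
      by (intro orth_proj_orthogonal inv)
    then show "cinner (lreg x f - lreg x (p f)) k = 0"
      by (simp add: lreg_cinner_left bounded_clinear_diff[OF bounded_clinear_lreg, symmetric])
  qed
  then show ?thesis
    by (simp add: VN_r_def bounded_clinear_orth_proj)
qed

section \<open>Families of functions that separate square integrable functions\<close>

text \<open>Test against \<open>w\<close> itself, cut off to a set of finite measure on which \<open>w\<close> is bounded.  The lemma is
  used for the difference of a coefficient and a square integrable function, to conclude that the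
  coefficient is square integrable.\<close>

lemma AE_zero_by_testing:
  fixes w :: "'g::lc_group \<Rightarrow> complex"
  assumes w [measurable]: "w \<in> borel_measurable haar"
    and test: "\<And>h. sq_integrable h \<Longrightarrow> integrable haar h \<Longrightarrow> (\<integral>x. w x * cnj (h x) \<partial>haar) = 0"
  shows "AE x in haar. w x = 0"
proof -
  obtain A :: "nat \<Rightarrow> 'g set" where A: "range A \<subseteq> sets haar" "(\<Union>i. A i) = space haar"
      "\<And>i. emeasure haar (A i) \<noteq> \<infinity>"
    using haar.sigma_finite by blast
  have "AE x in haar. x \<in> A n \<and> cmod (w x) \<le> real m \<longrightarrow> w x = 0" for n m
  proof -
    define S where "S = {x \<in> space haar. x \<in> A n \<and> cmod (w x) \<le> real m}"
    define h where "h x = indicator S x * w x" for x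
    have An [measurable]: "A n \<in> sets haar" using A(1) by blast
    have S [measurable]: "S \<in> sets haar" unfolding S_def by measurable
    have h [measurable]: "h \<in> borel_measurable haar" unfolding h_def by measurable
    have "emeasure haar S \<le> emeasure haar (A n)"
      by (intro emeasure_mono) (auto simp: S_def)
    then have Sfin: "emeasure haar S < \<infinity>"
      using A(3)[of n] by (simp add: le_less_trans less_top)
    have int1: "integrable haar (\<lambda>x. indicator S x * c)" for c :: real
      using S Sfin by (intro integrable_mult_left integrable_real_indicator) auto
    have bd: "cmod (h x) \<le> indicator S x * real m" for x
      by (auto simp: h_def S_def indicator_def)
    have "integrable haar h"
      by (rule Bochner_Integration.integrable_bound[OF int1[of "real m"] h])
        (intro AE_I2, use bd in \<open>simp add: order_trans[OF _ abs_ge_self]\<close>)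
    moreover have int2: "integrable haar (\<lambda>x. (cmod (h x))\<^sup>2)"
    proof (rule Bochner_Integration.integrable_bound[OF int1[of "(real m)\<^sup>2"]])
      have "(cmod (h x))\<^sup>2 \<le> indicator S x * (real m)\<^sup>2" for x
        using power_mono[OF bd[of x] norm_ge_zero, of 2] by (auto simp: indicator_def split: if_splits)
      then show "AE x in haar. norm ((cmod (h x))\<^sup>2) \<le> norm (indicator S x * (real m)\<^sup>2)"
        by (intro AE_I2) (simp add: abs_mult)
    qed measurable
    ultimately have "(\<integral>x. w x * cnj (h x) \<partial>haar) = 0"
      by (intro test) (simp_all add: sq_integrable_def)
    moreover have "w x * cnj (h x) = complex_of_real ((cmod (h x))\<^sup>2)" for x
      by (simp add: h_def indicator_def complex_norm_square del: of_real_power)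
    ultimately have "complex_of_real (\<integral>x. (cmod (h x))\<^sup>2 \<partial>haar) = 0"
      by (simp del: of_real_power)
    then have "(\<integral>x. (cmod (h x))\<^sup>2 \<partial>haar) = 0" by simp
    then have "AE x in haar. (cmod (h x))\<^sup>2 = 0"
      using integral_nonneg_eq_0_iff_AE[OF int2] by simp
    then show ?thesis
      by eventually_elim (auto simp: h_def S_def indicator_def)
  qed
  then have "AE x in haar. \<forall>n m. x \<in> A n \<and> cmod (w x) \<le> real m \<longrightarrow> w x = 0"
    unfolding AE_all_countable by blast
  then show ?thesis
  proof eventually_elim
    case (elim x)
    obtain n where "x \<in> A n" using A(2) by (metis UNIV_I UN_iff space_haar)
    moreover obtain m where "cmod (w x) \<le> real m" using real_arch_simple by blast
    ultimately show ?case using elim by blast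
  qed
qed

lemma sq_integrable_indicator:
  assumes "A \<in> sets haar" "emeasure haar A < \<infinity>"
  shows "sq_integrable (indicator A)"
proof -
  have "(\<lambda>x. (cmod (indicator A x))\<^sup>2) = (indicator A :: _ \<Rightarrow> real)"
    by (auto simp: indicator_def fun_eq_iff)
  then show ?thesis
    using assms by (simp add: sq_integrable_def)
qed

lemma AE_zero_real_by_sets:
  fixes u :: "'a \<Rightarrow> real"
  assumes u: "integrable M u" and 0: "\<And>A. A \<in> sets M \<Longrightarrow> (\<integral>x. indicator A x * u x \<partial>M) = 0"
  shows "AE x in M. u x = 0"
proof -
  have [measurable]: "u \<in> borel_measurable M" using u by simp
  have int: "integrable M (\<lambda>x. indicator A x * u x)" if "A \<in> sets M" for A
    using integrable_mult_indicator[OF that u] by simp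
  define P N where "P = {x \<in> space M. 0 < u x}" and "N = {x \<in> space M. u x < 0}"
  have [measurable]: "P \<in> sets M" "N \<in> sets M" unfolding P_def N_def by measurable
  have "AE x in M. indicator P x * u x = 0"
    using integral_nonneg_eq_0_iff_AE[OF int[of P]] 0[of P] by (auto simp: P_def indicator_def)
  moreover have "AE x in M. - (indicator N x * u x) = 0"
  proof -
    have "AE x in M. 0 \<le> - (indicator N x * u x)"
      by (intro AE_I2) (auto simp: N_def indicator_def)
    then show ?thesis
      using integral_nonneg_eq_0_iff_AE[of M "\<lambda>x. - (indicator N x * u x)"] int[of N] 0[of N] by simp
  qed
  moreover have "AE x in M. x \<in> space M" by simp
  ultimately show ?thesis
    by eventually_elim (auto simp: P_def N_def indicator_def split: if_splits)
qed

lemma AE_zero_complex_by_sets: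
  fixes u :: "'a \<Rightarrow> complex"
  assumes u: "integrable M u" and 0: "\<And>A. A \<in> sets M \<Longrightarrow> (\<integral>x. indicator A x * u x \<partial>M) = 0"
  shows "AE x in M. u x = 0"
proof -
  have int: "integrable M (\<lambda>x. indicator A x * u x)" if "A \<in> sets M" for A
  proof -
    have "indicator A x * u x = indicat_real A x *\<^sub>R u x" for x by (simp add: indicator_def)
    then show ?thesis using integrable_mult_indicator[OF that u] by simp
  qed
  have "(\<integral>x. indicator A x * Re (u x) \<partial>M) = 0" if "A \<in> sets M" for A
  proof -
    have "(\<integral>x. Re (indicator A x * u x) \<partial>M) = 0"
      by (subst integral_Re[OF int[OF that]]) (simp add: 0[OF that])
    moreover have "Re (indicator A x * u x) = indicator A x * Re (u x)" for x by (simp add: indicator_def)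
    ultimately show ?thesis by simp
  qed
  then have "AE x in M. Re (u x) = 0"
    using u by (intro AE_zero_real_by_sets) auto
  moreover have "(\<integral>x. indicator A x * Im (u x) \<partial>M) = 0" if "A \<in> sets M" for A
  proof -
    have "(\<integral>x. Im (indicator A x * u x) \<partial>M) = 0"
      by (subst integral_Im[OF int[OF that]]) (simp add: 0[OF that])
    moreover have "Im (indicator A x * u x) = indicator A x * Im (u x)" for x by (simp add: indicator_def)
    ultimately show ?thesis by simp
  qed
  then have "AE x in M. Im (u x) = 0"
    using u by (intro AE_zero_real_by_sets) auto
  ultimately show ?thesis
    by eventually_elim (simp add: complex_eq_iff)
qed

text \<open>Finite intersections from a countable basis of relatively compact open sets form a generating
  \<open>\<pi>\<close>-system, so a function whose integrals over them vanish has vanishing integrals over all Borel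
  subsets of each of them.\<close>

lemma countable_separating_sets:
  obtains \<S> :: "'g::lc_group set set"
  where "countable \<S>" "\<And>B. B \<in> \<S> \<Longrightarrow> open B \<and> compact (closure B)"
    "\<And>w. sq_integrable w \<Longrightarrow> (\<And>B. B \<in> \<S> \<Longrightarrow> (\<integral>x. indicator B x * w x \<partial>haar) = 0)
      \<Longrightarrow> AE x in haar. w x = 0"
proof -
  obtain B0 :: "'g set set" where B0: "countable B0" "topological_basis B0"
      "\<And>b. b \<in> B0 \<Longrightarrow> open b \<and> compact (closure b)"
    using relatively_compact_basis by metis
  define \<S> where "\<S> = Inter ` {F. F \<subseteq> B0 \<and> finite F \<and> F \<noteq> {}}"
  have "countable {F. F \<subseteq> B0 \<and> finite F}"
    using countable_Collect_finite_subset[OF B0(1)] by (simp add: conj_commute)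
  then have "countable {F. F \<subseteq> B0 \<and> finite F \<and> F \<noteq> {}}"
    by (rule countable_subset[rotated]) auto
  then have c: "countable \<S>" by (simp add: \<S>_def)
  have oc: "open B \<and> compact (closure B)" if B: "B \<in> \<S>" for B
  proof -
    obtain F where F: "F \<subseteq> B0" "finite F" "F \<noteq> {}" "B = \<Inter>F" using B by (auto simp: \<S>_def)
    then obtain b where b: "b \<in> F" by blast
    have "closure B \<subseteq> closure b" using b F by (intro closure_mono) auto
    then have "closure B = closure b \<inter> closure B" by blast
    then have "compact (closure B)"
      using compact_Int_closed[of "closure b" "closure B"] B0(3)[of b] b F(1) by auto
    moreover have "open B" using F B0(3) by (auto intro!: open_Inter)
    ultimately show ?thesis by simp
  qed
  have sub: "B0 \<subseteq> \<S>"
  proof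
    fix b assume "b \<in> B0"
    then show "b \<in> \<S>" unfolding \<S>_def by (intro image_eqI[of _ _ "{b}"]) auto
  qed
  have stable: "Int_stable \<S>"
  proof (rule Int_stableI)
    fix A B assume "A \<in> \<S>" "B \<in> \<S>"
    then obtain F G where "F \<subseteq> B0" "finite F" "F \<noteq> {}" "A = \<Inter>F" "G \<subseteq> B0" "finite G" "G \<noteq> {}" "B = \<Inter>G"
      by (auto simp: \<S>_def)
    then show "A \<inter> B \<in> \<S>" unfolding \<S>_def by (intro image_eqI[of _ _ "F \<union> G"]) auto
  qed
  have sig: "sigma_sets UNIV \<S> = sets (borel :: 'g measure)"
  proof
    show "sigma_sets UNIV \<S> \<subseteq> sets (borel :: 'g measure)"
    proof -
      have "\<S> \<subseteq> sets (borel :: 'g measure)" using oc by (auto intro: borel_open)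
      from sets.sigma_sets_subset[OF this] show ?thesis by simp
    qed
    have "sets (borel :: 'g measure) = sigma_sets UNIV B0"
      by (simp add: borel_eq_countable_basis[OF B0(1,2)])
    also have "\<dots> \<subseteq> sigma_sets UNIV \<S>" by (rule sigma_sets_mono') (rule sub)
    finally show "sets (borel :: 'g measure) \<subseteq> sigma_sets UNIV \<S>" .
  qed
  have sep: "AE x in haar. w x = 0"
    if w: "sq_integrable w" and 0: "\<And>B. B \<in> \<S> \<Longrightarrow> (\<integral>x. indicator B x * w x \<partial>haar) = 0" for w :: "'g \<Rightarrow> complex"
  proof -
    have "AE x in haar. x \<in> B \<longrightarrow> w x = 0" if B: "B \<in> \<S>" for B
    proof -
      define w' where "w' x = indicator B x * w x" for x
      have Bs: "B \<in> sets haar" using oc[OF B] by (simp add: sets_haar)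
      have "sq_integrable (indicator B :: 'g \<Rightarrow> complex)"
        using emeasure_haar_relatively_compact oc[OF B] Bs by (intro sq_integrable_indicator) auto
      from integrable_mult_cnj[OF w this] have w': "integrable haar w'"
        by (simp add: w'_def[abs_def] mult.commute[of _ "w _"]) (simp add: indicator_def of_bool_def if_distrib cong: if_cong)
      have "(LINT x:A|haar. w' x) = 0" if "A \<in> sigma_sets UNIV \<S>" for A
        using stable subset_UNIV[of \<S>, folded Pow_UNIV] that
      proof (induction A rule: sigma_sets_induct_disjoint)
        case (basic A)
        then have "A \<inter> B \<in> \<S>" using stable B by (auto simp: Int_stable_def)
        from 0[OF this] show ?case
          unfolding set_lebesgue_integral_def w'_def by (simp add: indicator_inter_arith mult.assoc scaleR_conv_of_real of_real_indicator)
      next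
        case empty
        then show ?case by (simp add: set_lebesgue_integral_def)
      next
        case (compl A)
        then have A: "A \<in> sets haar" by (simp add: sig sets_haar)
        have i: "integrable haar (\<lambda>x. indicat_real A x *\<^sub>R w' x)"
          by (rule integrable_mult_indicator[OF A w'])
        have "(LINT x:(UNIV - A)|haar. w' x) = (\<integral>x. w' x - indicat_real A x *\<^sub>R w' x \<partial>haar)"
          unfolding set_lebesgue_integral_def
          by (rule Bochner_Integration.integral_cong) (auto simp: indicator_def)
        also have "\<dots> = (\<integral>x. w' x \<partial>haar) - (LINT x:A|haar. w' x)"
          unfolding set_lebesgue_integral_def by (rule Bochner_Integration.integral_diff[OF w' i])
        also have "(\<integral>x. w' x \<partial>haar) = 0" using 0[OF B] by (simp add: w'_def)
        finally show ?case using compl by simp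
      next
        case (union A)
        then have A: "\<And>i. A i \<in> sets haar" by (auto simp: sig sets_haar)
        have "(LINT x:(\<Union>i. A i)|haar. w' x) = (\<Sum>i. (LINT x:(A i)|haar. w' x))"
        proof (rule lebesgue_integral_countable_add)
          show "set_integrable haar (\<Union>i. A i) w'"
            unfolding set_integrable_def using A by (intro integrable_mult_indicator w') auto
        qed (use A union in \<open>auto simp: disjoint_family_on_def\<close>)
        then show ?case using union by simp
      qed
      then have "(\<integral>x. indicator A x * w' x \<partial>haar) = 0" if "A \<in> sets haar" for A
        using that by (simp add: sig sets_haar set_lebesgue_integral_def scaleR_conv_of_real of_real_indicator)
      then have "AE x in haar. w' x = 0"
        by (rule AE_zero_complex_by_sets[OF w'])
      then show ?thesis
        by eventually_elim (auto simp: w'_def)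
    qed
    then have ae: "AE x in haar. \<forall>B\<in>\<S>. x \<in> B \<longrightarrow> w x = 0"
      by (subst AE_ball_countable[OF c]) simp
    have cover: "\<exists>B\<in>\<S>. x \<in> B" for x
    proof -
      obtain b where "b \<in> B0" "x \<in> b"
        by (rule topological_basisE[OF B0(2) open_UNIV UNIV_I])
      with sub show ?thesis by blast
    qed
    from ae show ?thesis
      by eventually_elim (use cover in blast)
  qed
  show thesis by (rule that[OF c oc sep])
qed

lemma euclidean_locally_compact_Hausdorff:
  "locally_compact_space (euclidean :: 'g::lc_group topology)" "Hausdorff_space (euclidean :: 'g topology)"
proof -
  show "locally_compact_space (euclidean :: 'g topology)"
    unfolding locally_compact_space_def using locally_compact[where 'a='g] by (simp add: open_openin[symmetric])
  show "Hausdorff_space (euclidean :: 'g topology)"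
    unfolding Hausdorff_space_def using hausdorff[where 'a='g] by (simp add: disjnt_def open_openin[symmetric])
qed

lemma open_eq_Union_compacts:
  fixes U :: "'g::lc_group set"
  assumes "open U"
  obtains K where "\<And>n::nat. compact (K n)" "incseq K" "(\<Union>n. K n) = U"
proof -
  obtain B0 :: "'g set set" where B0: "countable B0" "topological_basis B0"
      "\<And>b. b \<in> B0 \<Longrightarrow> open b \<and> compact (closure b)"
    using relatively_compact_basis by metis
  define C where "C = insert {} (closure ` {b \<in> B0. closure b \<subseteq> U})"
  have C: "countable C" "C \<noteq> {}" "\<And>k. k \<in> C \<Longrightarrow> compact k" "\<And>k. k \<in> C \<Longrightarrow> k \<subseteq> U"
    using B0 by (auto simp: C_def)
  have U: "\<Union>C = U"
  proof
    show "U \<subseteq> \<Union>C"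
    proof
      fix x assume "x \<in> U"
      have "neighbourhood_base_of (closedin euclidean) (euclidean :: 'g topology)"
        unfolding neighbourhood_base_of_closedin
        by (rule locally_compact_Hausdorff_imp_regular_space[OF euclidean_locally_compact_Hausdorff])
      then have "\<exists>V W. open V \<and> closed W \<and> x \<in> V \<and> V \<subseteq> W \<and> W \<subseteq> U"
        unfolding neighbourhood_base_of open_openin[symmetric] closed_closedin[symmetric]
        using assms \<open>x \<in> U\<close> by simp
      then obtain V W where "open V" "closed W" "x \<in> V" "V \<subseteq> W" "W \<subseteq> U"
        by (elim exE conjE)
      moreover obtain b where "b \<in> B0" "x \<in> b" "b \<subseteq> V"
        by (rule topological_basisE[OF B0(2) \<open>open V\<close> \<open>x \<in> V\<close>])
      ultimately have "closure b \<subseteq> U" "x \<in> closure b"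
        using closure_minimal[of b W] closure_subset[of b] by auto
      with \<open>b \<in> B0\<close> show "x \<in> \<Union>C" by (auto simp: C_def)
    qed
  qed (use C in auto)
  define K where "K n = (\<Union>i\<le>n. from_nat_into C i)" for n
  have "compact (K n)" for n
    unfolding K_def using C by (intro compact_UN) (auto intro: from_nat_into)
  moreover have "incseq K" unfolding K_def incseq_def by (auto intro: order_trans)
  moreover have "(\<Union>n. K n) = U"
  proof -
    have "(\<Union>n. K n) = (\<Union>n. from_nat_into C n)" by (auto simp: K_def)
    also have "\<dots> = \<Union>C" using range_from_nat_into[OF C(2,1)] by simp
    finally show ?thesis using U by simp
  qed
  ultimately show thesis using that by blast
qed

lemma Cc_measurable: "g \<in> Cc \<Longrightarrow> g \<in> borel_measurable haar"
  by (simp add: Cc_def measurable_haar borel_measurable_continuous_onI)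

lemma Cc_integrable:
  fixes g :: "'g::lc_group \<Rightarrow> complex"
  assumes g: "g \<in> Cc"
  shows "integrable haar g" "sq_integrable g"
proof -
  note [measurable] = Cc_measurable[OF g]
  define S where "S = closure {x. g x \<noteq> 0}"
  have S: "compact S" "S \<in> sets haar" using g by (auto simp: Cc_def S_def sets_haar)
  have fin: "emeasure haar S < \<infinity>" by (rule haar_compact[OF S(1)])
  have "compact (g ` S)"
    using g S(1) by (intro compact_continuous_image) (auto simp: Cc_def intro: continuous_on_subset)
  then obtain M where M: "\<And>x. x \<in> S \<Longrightarrow> cmod (g x) \<le> M"
    using compact_imp_bounded bounded_iff by (metis imageI)
  have supp: "g x = 0" if "x \<notin> S" for x
    using that closure_subset[of "{x. g x \<noteq> 0}"] by (auto simp: S_def)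
  have int1: "integrable haar (\<lambda>x. indicator S x * c)" for c :: real
    using S fin by (intro integrable_mult_left integrable_real_indicator) auto
  have bd: "cmod (g x) \<le> indicator S x * \<bar>M\<bar>" for x
    using M[of x] supp[of x] by (cases "x \<in> S") auto
  show "integrable haar g"
    by (rule Bochner_Integration.integrable_bound[OF int1[of "\<bar>M\<bar>"]]) (use bd in \<open>auto simp: abs_mult\<close>)
  have "integrable haar (\<lambda>x. (cmod (g x))\<^sup>2)"
  proof (rule Bochner_Integration.integrable_bound[OF int1[of "\<bar>M\<bar>\<^sup>2"]])
    have "(cmod (g x))\<^sup>2 \<le> indicator S x * \<bar>M\<bar>\<^sup>2" for x
    proof (cases "x \<in> S")
      case True
      then show ?thesis using power_mono[of "cmod (g x)" "\<bar>M\<bar>" 2] bd[of x] by simp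
    qed (simp add: supp)
    then show "AE x in haar. norm ((cmod (g x))\<^sup>2) \<le> norm (indicator S x * \<bar>M\<bar>\<^sup>2)"
      by (intro AE_I2) (simp add: abs_mult)
  qed measurable
  then show "sq_integrable g" by (simp add: sq_integrable_def)
qed

text \<open>An open set is an increasing union of compact sets; the approximating functions are Urysohn
  functions for these compact sets.\<close>

lemma open_indicator_limit_Cc:
  fixes U :: "'g::lc_group set"
  assumes U: "open U" "compact (closure U)"
  obtains g where "\<And>n::nat. g n \<in> Cc" "\<And>n x. cmod (g n x) \<le> indicator U x"
    "\<And>x. (\<lambda>n. g n x) \<longlonglongrightarrow> indicator U x"
proof -
  obtain K where K: "\<And>n::nat. compact (K n)" "incseq K" "(\<Union>n. K n) = U"
    using open_eq_Union_compacts[OF U(1)] by metis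
  have cr: "completely_regular_space (euclidean :: 'g topology)"
    using locally_compact_regular_imp_completely_regular_space euclidean_locally_compact_Hausdorff by blast
  have "\<exists>f :: 'g \<Rightarrow> real. continuous_on UNIV f \<and> (\<forall>x. 0 \<le> f x \<and> f x \<le> 1) \<and> (\<forall>x\<in>K n. f x = 1) \<and> (\<forall>x. x \<notin> U \<longrightarrow> f x = 0)" for n
  proof -
    have "disjnt (K n) (- U)" using K(3) by (auto simp: disjnt_def)
    moreover have "compactin euclidean (K n)" "closedin euclidean (- U)"
      using K(1) U(1) by (auto simp: closed_closedin[symmetric])
    ultimately obtain f where f: "continuous_map euclidean (subtopology euclidean {0..1::real}) f"
        "f ` (- U) \<subseteq> {0}" "f ` K n \<subseteq> {1}"
      using Urysohn_completely_regular_compact_closed[OF zero_le_one cr] by metis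
    then show ?thesis
      by (intro exI[of _ f]) (auto simp: continuous_map_in_subtopology)
  qed
  then obtain f :: "nat \<Rightarrow> 'g \<Rightarrow> real" where f: "\<And>n. continuous_on UNIV (f n)" "\<And>n x. 0 \<le> f n x \<and> f n x \<le> 1"
      "\<And>n x. x \<in> K n \<Longrightarrow> f n x = 1" "\<And>n x. x \<notin> U \<Longrightarrow> f n x = 0"
    by metis
  define g where "g n x = complex_of_real (f n x)" for n x
  have "g n \<in> Cc" for n
  proof -
    have "{x. g n x \<noteq> 0} \<subseteq> U" using f(4)[of _ n] by (auto simp: g_def)
    then have "closure {x. g n x \<noteq> 0} \<subseteq> closure U" by (rule closure_mono)
    then have "closure {x. g n x \<noteq> 0} = closure U \<inter> closure {x. g n x \<noteq> 0}" by blast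
    then have "compact (closure {x. g n x \<noteq> 0})"
      using compact_Int_closed[OF U(2), of "closure {x. g n x \<noteq> 0}"] by simp
    moreover have "continuous_on UNIV (g n)" unfolding g_def by (intro continuous_intros f)
    ultimately show ?thesis by (simp add: Cc_def)
  qed
  moreover have "cmod (g n x) \<le> indicator U x" for n x
    using f(2)[of n x] f(4)[of x n] by (auto simp: g_def indicator_def)
  moreover have "(\<lambda>n. g n x) \<longlonglongrightarrow> indicator U x" for x
  proof (cases "x \<in> U")
    case True
    then obtain m where "x \<in> K m" using K(3) by blast
    then have "x \<in> K n" if "n \<ge> m" for n using K(2) that by (auto simp: incseq_def)
    then have "\<forall>\<^sub>F n in sequentially. g n x = 1"
      by (intro eventually_sequentiallyI[of m]) (simp add: g_def f(3))
    then show ?thesis using True by (simp add: tendsto_eventually)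
  qed (simp add: g_def f(4))
  ultimately show thesis using that by blast
qed

text \<open>Whatever is orthogonal to \<open>C\<^sub>c\<close> is, by dominated convergence, orthogonal to the indicators of
  relatively compact open sets, and these separate.\<close>

lemma Cc_separating:
  fixes w :: "'g::lc_group l2"
  assumes 0: "\<And>g. g \<in> Cc \<Longrightarrow> cinner (abs_l2 g) w = 0"
  shows "w = 0"
proof -
  obtain \<S> :: "'g set set" where \<S>: "\<And>B. B \<in> \<S> \<Longrightarrow> open B \<and> compact (closure B)"
    "\<And>w. sq_integrable w \<Longrightarrow> (\<And>B. B \<in> \<S> \<Longrightarrow> (\<integral>x. indicator B x * w x \<partial>haar) = 0)
      \<Longrightarrow> AE x in haar. w x = 0"
    using countable_separating_sets by metis
  define u where "u x = cnj (rep_l2 w x)" for x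
  have [measurable]: "cnj \<in> borel_measurable borel"
    by (intro borel_measurable_continuous_onI continuous_intros)
  have u [measurable]: "u \<in> borel_measurable haar" unfolding u_def by measurable
  have usq: "sq_integrable u"
    using sq_integrable_rep[of w] u by (simp add: sq_integrable_def u_def)
  have "(\<integral>x. indicator B x * u x \<partial>haar) = 0" if B: "B \<in> \<S>" for B
  proof -
    obtain g where g: "\<And>n::nat. g n \<in> Cc" "\<And>n x. cmod (g n x) \<le> indicator B x"
      "\<And>x. (\<lambda>n. g n x) \<longlonglongrightarrow> indicator B x"
      using open_indicator_limit_Cc \<S>(1)[OF B] by metis
    have Bs [measurable]: "B \<in> sets haar" using \<S>(1)[OF B] by (simp add: sets_haar)
    note [measurable] = Cc_measurable[OF g(1)]
    have "sq_integrable (indicator B :: 'g \<Rightarrow> complex)"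
      using emeasure_haar_relatively_compact \<S>(1)[OF B] Bs by (intro sq_integrable_indicator) auto
    from integrable_mult_cnj[OF this sq_integrable_rep[of w]] have int: "integrable haar (\<lambda>x. indicator B x * u x)"
      by (simp add: u_def)
    have "(\<lambda>n. \<integral>x. g n x * u x \<partial>haar) \<longlonglongrightarrow> (\<integral>x. indicator B x * u x \<partial>haar)"
    proof (rule integral_dominated_convergence[where w="\<lambda>x. cmod (indicator B x * u x)"])
      show "AE x in haar. (\<lambda>n. g n x * u x) \<longlonglongrightarrow> indicator B x * u x"
        by (intro AE_I2 tendsto_intros g(3))
      show "AE x in haar. cmod (g n x * u x) \<le> cmod (indicator B x * u x)" for n
      proof (intro AE_I2)
        fix x
        show "cmod (g n x * u x) \<le> cmod (indicator B x * u x)"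
          using g(2)[of n x] by (cases "x \<in> B") (auto simp: norm_mult intro: mult_left_le_one_le)
      qed
    qed (use int in auto)
    moreover have "(\<integral>x. g n x * u x \<partial>haar) = 0" for n
      using 0[OF g(1)[of n]] by (simp add: cinner_abs_left[OF Cc_integrable(2)[OF g(1)]] u_def)
    ultimately show ?thesis
      by (simp add: LIMSEQ_const_iff)
  qed
  then have "AE x in haar. u x = 0" by (rule \<S>(2)[OF usq])
  then have "AE x in haar. rep_l2 w x = 0" by eventually_elim (simp add: u_def)
  then have "abs_l2 (rep_l2 w) = abs_l2 (\<lambda>_. 0)"
    by (intro abs_l2_eqI) (simp_all add: sq_integrable_0)
  then show ?thesis by (simp add: zero_l2_def)
qed

section \<open>Coefficient operators and the involution\<close>

lemma coeff_lreg: "coeff lreg f \<phi> x = (\<integral>y. rep_l2 \<phi> y * cnj (rep_l2 f (- x + y)) \<partial>haar)"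
  using lreg_abs[OF sq_integrable_rep[of f], of x]
    cinner_abs_right[OF sq_integrable_translate[OF sq_integrable_rep[of f], of "- x"], of \<phi>]
  by (simp add: coeff_def)

lemma cnj_measurable [measurable]: "cnj \<in> borel_measurable borel"
  by (intro borel_measurable_continuous_onI continuous_intros)

lemma translate_pair_measurable [measurable]:
  "(\<lambda>z::'g::lc_group \<times> 'g. - fst z + snd z) \<in> measurable (haar \<Otimes>\<^sub>M haar) haar"
  by (intro measurable_haar_pair_continuous continuous_intros)

lemma coeff_measurable: "coeff lreg f \<phi> \<in> borel_measurable haar"
proof -
  have "(\<lambda>z. rep_l2 \<phi> (snd z) * cnj (rep_l2 f (- fst z + snd z))) \<in> borel_measurable (haar \<Otimes>\<^sub>M haar)"
    by measurable
  then have "(\<lambda>x. \<integral>y. rep_l2 \<phi> y * cnj (rep_l2 f (- x + y)) \<partial>haar) \<in> borel_measurable haar"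
    by (intro haar.borel_measurable_lebesgue_integral) (simp add: case_prod_unfold)
  then show ?thesis
    by (simp add: coeff_lreg[abs_def])
qed

lemma coeff_bound: "cmod (coeff lreg f \<phi> x) \<le> norm \<phi> * norm f"
  using cinner_norm_le[of \<phi> "lreg x f"] by (simp add: coeff_def)

lemma integral_cmod_mult_le:
  assumes u: "sq_integrable u" and v: "sq_integrable v"
  shows "(\<integral>x. cmod (u x) * cmod (v x) \<partial>haar) \<le> norm (abs_l2 u) * norm (abs_l2 v)"
proof -
  have [measurable]: "u \<in> borel_measurable haar" "v \<in> borel_measurable haar"
    using u v by (auto simp: sq_integrable_def)
  define u' v' where "u' x = complex_of_real (cmod (u x))" and "v' x = complex_of_real (cmod (v x))" for x
  have u': "sq_integrable u'" and v': "sq_integrable v'"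
    using u v by (auto simp: sq_integrable_def u'_def[abs_def] v'_def[abs_def])
  have "cinner (abs_l2 u') (abs_l2 v') = complex_of_real (\<integral>x. cmod (u x) * cmod (v x) \<partial>haar)"
    unfolding cinner_abs[OF u' v'] u'_def v'_def by (simp flip: of_real_mult)
  then have "(\<integral>x. cmod (u x) * cmod (v x) \<partial>haar) \<le> cmod (cinner (abs_l2 u') (abs_l2 v'))"
    by simp
  also have "\<dots> \<le> norm (abs_l2 u') * norm (abs_l2 v')" by (rule cinner_norm_le)
  also have "norm (abs_l2 u') = norm (abs_l2 u)"
  proof (rule power2_eq_imp_eq)
    show "(norm (abs_l2 u'))\<^sup>2 = (norm (abs_l2 u))\<^sup>2"
      unfolding norm_abs_sq[OF u] norm_abs_sq[OF u'] by (simp add: u'_def)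
  qed simp_all
  also have "norm (abs_l2 v') = norm (abs_l2 v)"
  proof (rule power2_eq_imp_eq)
    show "(norm (abs_l2 v'))\<^sup>2 = (norm (abs_l2 v))\<^sup>2"
      unfolding norm_abs_sq[OF v] norm_abs_sq[OF v'] by (simp add: v'_def)
  qed simp_all
  finally show ?thesis .
qed

text \<open>Fubini for \<open>\<phi>(y) cnj (f(- x + y)) cnj (h(x))\<close>: by Cauchy--Schwarz in \<open>y\<close> it is dominated by
  \<open>\<parallel>\<phi>\<parallel> \<parallel>f\<parallel> |h(x)|\<close>.\<close>

lemma integral_coeff_convolve:
  fixes h :: "'g::lc_group \<Rightarrow> complex"
  assumes h: "integrable haar h"
  shows "(\<integral>x. coeff lreg f \<phi> x * cnj (h x) \<partial>haar) = (\<integral>y. rep_l2 \<phi> y * cnj (convolve h (rep_l2 f) y) \<partial>haar)"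
proof -
  have [measurable]: "h \<in> borel_measurable haar" using h by simp
  define k where "k x y = rep_l2 \<phi> y * cnj (rep_l2 f (- x + y)) * cnj (h x)" for x y
  have k [measurable]: "case_prod k \<in> borel_measurable (haar \<Otimes>\<^sub>M haar)"
  proof -
    have "(\<lambda>z. rep_l2 \<phi> (snd z) * cnj (rep_l2 f (- fst z + snd z)) * cnj (h (fst z))) \<in> borel_measurable (haar \<Otimes>\<^sub>M haar)"
      by measurable
    then show ?thesis by (simp add: k_def case_prod_unfold)
  qed
  note tr = sq_integrable_translate[OF sq_integrable_rep[of f]]
  have "integrable (haar \<Otimes>\<^sub>M haar) (case_prod k)"
  proof (rule haar_pair.Fubini_integrable[OF k])
    show "AE x in haar. integrable haar (\<lambda>y. case (x, y) of (x, y) \<Rightarrow> k x y)"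
      by (intro AE_I2) (simp add: k_def integrable_mult_cnj[OF sq_integrable_rep tr])
    show "integrable haar (\<lambda>x. \<integral>y. norm (case (x, y) of (x, y) \<Rightarrow> k x y) \<partial>haar)"
    proof (rule Bochner_Integration.integrable_bound)
      show "integrable haar (\<lambda>x. (norm \<phi> * norm f) * cmod (h x))"
        using h by (intro integrable_mult_right integrable_norm)
      have "(\<lambda>z. norm (case_prod k z)) \<in> borel_measurable (haar \<Otimes>\<^sub>M haar)" by measurable
      then show "(\<lambda>x. \<integral>y. norm (case (x, y) of (x, y) \<Rightarrow> k x y) \<partial>haar) \<in> borel_measurable haar"
        by (intro haar.borel_measurable_lebesgue_integral) (simp add: case_prod_unfold)
      have "(\<integral>y. cmod (k x y) \<partial>haar) \<le> (norm \<phi> * norm f) * cmod (h x)" for x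
      proof -
        have "(\<integral>y. cmod (k x y) \<partial>haar) = (\<integral>y. cmod (rep_l2 \<phi> y) * cmod (rep_l2 f (- x + y)) \<partial>haar) * cmod (h x)"
          by (simp add: k_def norm_mult)
        also have "\<dots> \<le> (norm (abs_l2 (rep_l2 \<phi>)) * norm (abs_l2 (\<lambda>y. rep_l2 f (- x + y)))) * cmod (h x)"
          by (intro mult_right_mono integral_cmod_mult_le sq_integrable_rep tr) simp
        also have "norm (abs_l2 (\<lambda>y. rep_l2 f (- x + y))) = norm f"
          using lreg_abs[OF sq_integrable_rep[of f], of x] norm_lreg[of x f] by simp
        finally show ?thesis by simp
      qed
      then show "AE x in haar. norm (\<integral>y. norm (case (x, y) of (x, y) \<Rightarrow> k x y) \<partial>haar) \<le> norm ((norm \<phi> * norm f) * cmod (h x))"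
        by (intro AE_I2) simp
    qed
  qed
  then have "(\<integral>y. (\<integral>x. k x y \<partial>haar) \<partial>haar) = (\<integral>x. (\<integral>y. k x y \<partial>haar) \<partial>haar)"
    by (rule haar_pair.Fubini_integral)
  moreover have "(\<integral>y. k x y \<partial>haar) = coeff lreg f \<phi> x * cnj (h x)" for x
    by (simp add: k_def coeff_lreg)
  moreover have "(\<integral>x. k x y \<partial>haar) = rep_l2 \<phi> y * cnj (convolve h (rep_l2 f) y)" for y
  proof -
    have "(\<integral>x. k x y \<partial>haar) = (\<integral>x. rep_l2 \<phi> y * cnj (h x * rep_l2 f (- x + y)) \<partial>haar)"
      by (simp add: k_def mult.assoc mult.commute[of "cnj (h _)"])
    then show ?thesis
      by (simp add: convolve_def del: complex_cnj_mult)
  qed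
  ultimately show ?thesis by simp
qed

abbreviation bdd :: "'g::lc_group l2 \<Rightarrow> bool" where
  "bdd \<equiv> bounded_vector lreg UNIV"

abbreviation V :: "'g::lc_group l2 \<Rightarrow> 'g l2 \<Rightarrow> 'g l2" where
  "V \<equiv> coeff_op lreg"

definition star :: "'g::lc_group l2 \<Rightarrow> 'g l2" where
  "star f = abs_l2 (\<lambda>x. cnj (rep_l2 f (- x)))"

lemma bdd_sq_integrable: "bdd f \<Longrightarrow> sq_integrable (coeff lreg f \<phi>)"
  by (simp add: bounded_vector_def)

lemma V_AE: "bdd f \<Longrightarrow> AE x in haar. rep_l2 (V f \<phi>) x = coeff lreg f \<phi> x"
  unfolding coeff_op_def by (rule rep_abs_l2[OF bdd_sq_integrable])

lemma V_bounded_clinear: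
  assumes f: "bdd f"
  shows "bounded_clinear (V f)"
proof -
  note sq = bdd_sq_integrable[OF f]
  obtain C where C: "\<And>\<phi>. norm (V f \<phi>) \<le> C * norm \<phi>"
    using f by (auto simp: bounded_vector_def)
  show ?thesis
  proof (rule bounded_clinearI[where K=C])
    show "V f (\<phi> + \<psi>) = V f \<phi> + V f \<psi>" for \<phi> \<psi>
      unfolding coeff_op_def by (subst plus_abs[OF sq sq]) (simp add: coeff_def cinner_add_left)
    show "V f (cscale c \<phi>) = cscale c (V f \<phi>)" for c \<phi>
      unfolding coeff_op_def by (subst cscale_abs[OF sq]) (simp add: coeff_def cinner_cscale_left)
  qed (rule C)
qed

lemma V_VN_r:
  assumes f: "bdd f"
  shows "V f \<in> VN_r"
proof -
  have "V f (lreg y \<phi>) = lreg y (V f \<phi>)" for y \<phi>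
    unfolding coeff_op_def lreg_abs[OF bdd_sq_integrable[OF f]]
    by (simp add: coeff_def lreg_cinner_left lreg_lreg)
  then show ?thesis by (simp add: VN_r_def V_bounded_clinear[OF f])
qed

lemma coeff_VN_r: "S \<in> VN_r \<Longrightarrow> coeff lreg (S f) \<phi> = coeff lreg f (cadjoint UNIV S \<phi>)"
  by (simp add: coeff_def fun_eq_iff VN_r_lreg[symmetric] cinner_cadjoint_left[OF VN_r_bounded])

lemma V_VN_r_apply:
  assumes S: "S \<in> VN_r"
  shows "V (S f) = V f \<circ> cadjoint UNIV S"
  by (simp add: coeff_op_def[abs_def] coeff_VN_r[OF S] fun_eq_iff)

lemma bdd_VN_r:
  assumes S: "S \<in> VN_r" and f: "bdd f"
  shows "bdd (S f)"
proof -
  obtain K where K: "0 \<le> K" "\<And>g. norm (V f g) \<le> K * norm g"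
    using bounded_clinear_bound[OF V_bounded_clinear[OF f]] by blast
  obtain L where L: "\<And>g. norm (cadjoint UNIV S g) \<le> L * norm g"
    using bounded_clinear_bound[OF bounded_clinear_cadjoint[OF VN_r_bounded[OF S]]] by blast
  have "norm (V (S f) g) \<le> (K * L) * norm g" for g
  proof -
    have "norm (V (S f) g) \<le> K * norm (cadjoint UNIV S g)"
      using K(2) by (simp add: V_VN_r_apply[OF S])
    also have "\<dots> \<le> K * (L * norm g)" by (intro mult_left_mono L K)
    finally show ?thesis by simp
  qed
  then show ?thesis
    using bdd_sq_integrable[OF f] by (auto simp: bounded_vector_def coeff_VN_r[OF S])
qed

text \<open>For each set \<open>B\<close> of a countable separating family, \<open>\<langle>1\<^sub>B, lreg x (f - g)\<rangle> = 0\<close> for almost all \<open>x\<close>.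
  Countability produces a single \<open>x\<close> that serves for all \<open>B\<close>, and then \<open>lreg x (f - g) = 0\<close>.\<close>

lemma V_inject:
  fixes f g :: "'g::lc_group l2"
  assumes f: "bdd f" and g: "bdd g" and eq: "V f = V g"
  shows "f = g"
proof -
  obtain \<S> :: "'g set set" where \<S>: "countable \<S>" "\<And>B. B \<in> \<S> \<Longrightarrow> open B \<and> compact (closure B)"
    "\<And>w. sq_integrable w \<Longrightarrow> (\<And>B. B \<in> \<S> \<Longrightarrow> (\<integral>x. indicator B x * w x \<partial>haar) = 0)
      \<Longrightarrow> AE x in haar. w x = 0"
    using countable_separating_sets by metis
  have "AE x in haar. cinner (abs_l2 (indicator B)) (lreg x (f - g)) = 0" for B
    using V_AE[OF f, of "abs_l2 (indicator B)"] V_AE[OF g, of "abs_l2 (indicator B)"]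
  proof eventually_elim
    case (elim x)
    then show ?case
      by (simp add: eq coeff_def bounded_clinear_diff[OF bounded_clinear_lreg] cinner_diff_right)
  qed
  then have "AE x in haar. \<forall>B\<in>\<S>. cinner (abs_l2 (indicator B)) (lreg x (f - g)) = 0"
    by (subst AE_ball_countable[OF \<S>(1)]) simp
  then have "\<exists>x. \<forall>B\<in>\<S>. cinner (abs_l2 (indicator B)) (lreg x (f - g)) = 0"
    by (rule eventually_happens'[rotated]) (simp add: ae_filter_eq_bot_iff haar_nonzero)
  then obtain x where x: "\<And>B. B \<in> \<S> \<Longrightarrow> cinner (abs_l2 (indicator B)) (lreg x (f - g)) = 0"
    by blast
  define w where "w y = cnj (rep_l2 (lreg x (f - g)) y)" for y
  have [measurable]: "w \<in> borel_measurable haar" unfolding w_def by measurable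
  have "sq_integrable w"
    using sq_integrable_rep[of "lreg x (f - g)"] by (simp add: sq_integrable_def w_def[abs_def])
  moreover have "(\<integral>y. indicator B y * w y \<partial>haar) = 0" if B: "B \<in> \<S>" for B
  proof -
    have "B \<in> sets haar" "emeasure haar B < \<infinity>"
      using \<S>(2)[OF B] emeasure_haar_relatively_compact[of B] by (auto simp: sets_haar)
    then show ?thesis
      using x[OF B] cinner_abs_left[OF sq_integrable_indicator, of B "lreg x (f - g)"] by (simp add: w_def)
  qed
  ultimately have "AE y in haar. w y = 0" by (rule \<S>(3))
  then have "AE y in haar. rep_l2 (lreg x (f - g)) y = 0"
    by eventually_elim (simp add: w_def)
  then have "abs_l2 (rep_l2 (lreg x (f - g))) = abs_l2 (\<lambda>_. 0)"
    by (intro abs_l2_eqI) (simp_all add: sq_integrable_0)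
  then have "lreg x (f - g) = 0" by (simp add: zero_l2_def)
  then have "norm (f - g) = 0" using norm_lreg[of x "f - g"] by simp
  then show ?thesis by simp
qed

locale unimodular_group =
  fixes G :: "'g::lc_group itself"
  assumes unimodular: "unimodular TYPE('g)"
begin

lemma uminus_measurable [measurable]: "(uminus :: 'g \<Rightarrow> 'g) \<in> measurable haar haar"
  by (intro measurable_haar_continuous continuous_intros)

lemma sq_integrable_star:
  fixes u :: "'g \<Rightarrow> complex"
  assumes u: "sq_integrable u"
  shows "sq_integrable (\<lambda>x. cnj (u (- x)))"
proof -
  have [measurable]: "u \<in> borel_measurable haar" and int: "integrable haar (\<lambda>x. (cmod (u x))\<^sup>2)"
    using u by (auto simp: sq_integrable_def)
  have "integrable (distr haar haar uminus) (\<lambda>x. (cmod (u x))\<^sup>2)"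
    using int by (simp add: distr_haar_uminus[OF unimodular])
  then have "integrable haar (\<lambda>x. (cmod (u (- x)))\<^sup>2)"
    by (rule integrable_distr[OF uminus_measurable])
  then show ?thesis by (simp add: sq_integrable_def)
qed

lemma star_abs:
  fixes u :: "'g \<Rightarrow> complex"
  assumes u: "sq_integrable u"
  shows "star (abs_l2 u) = abs_l2 (\<lambda>x. cnj (u (- x)))"
  unfolding star_def
proof (intro abs_l2_eqI sq_integrable_star sq_integrable_rep u)
  have [measurable]: "u \<in> borel_measurable haar" using u by (simp add: sq_integrable_def)
  have "AE x in distr haar haar uminus. rep_l2 (abs_l2 u) x = u x"
    unfolding distr_haar_uminus[OF unimodular] by (rule rep_abs_l2[OF u])
  then have "AE x in haar. rep_l2 (abs_l2 u) (- x) = u (- x)"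
    by (subst (asm) AE_distr_iff) measurable
  then show "AE x in haar. cnj (rep_l2 (abs_l2 u) (- x)) = cnj (u (- x))"
    by eventually_elim simp
qed

lemma star_star [simp]: "star (star f) = (f :: 'g l2)"
  unfolding star_def[of f] using star_abs[OF sq_integrable_star[OF sq_integrable_rep[of f]]] by simp

lemma cinner_star: "cinner (star f) (star g) = cinner g (f :: 'g l2)"
proof -
  have "cinner (star f) (star g) = (\<integral>x. rep_l2 g (- x) * cnj (rep_l2 f (- x)) \<partial>haar)"
    unfolding star_def by (simp add: cinner_abs sq_integrable_star mult.commute)
  also have "\<dots> = (\<integral>x. rep_l2 g x * cnj (rep_l2 f x) \<partial>distr haar haar uminus)"
    by (subst integral_distr[OF uminus_measurable]) auto
  finally show ?thesis by (simp add: distr_haar_uminus[OF unimodular] cinner_rep)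
qed

text \<open>This identifies the convolutions that arise from Fubini and in \<open>conv_op\<close> with values of
  coefficient operators.\<close>

lemma coeff_star:
  fixes h :: "'g \<Rightarrow> complex"
  assumes h: "sq_integrable h"
  shows "coeff lreg (star f) (abs_l2 h) = convolve h (rep_l2 f)"
proof
  fix y
  have "lreg y (star f) = abs_l2 (\<lambda>x. cnj (rep_l2 f (- x + y)))"
    unfolding star_def lreg_abs[OF sq_integrable_star[OF sq_integrable_rep]] by (simp add: minus_add)
  moreover have "sq_integrable (\<lambda>x. cnj (rep_l2 f (- x + y)))"
    using sq_integrable_translate[OF sq_integrable_star[OF sq_integrable_rep[of f]], of "- y"]
    by (simp add: minus_add)
  ultimately show "coeff lreg (star f) (abs_l2 h) y = convolve h (rep_l2 f) y"
    by (simp add: coeff_def cinner_abs[OF h] convolve_def)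
qed

lemma integral_coeff_star:
  fixes h :: "'g \<Rightarrow> complex"
  assumes h: "integrable haar h" "sq_integrable h"
  shows "(\<integral>x. coeff lreg f \<phi> x * cnj (h x) \<partial>haar)
    = (\<integral>y. rep_l2 \<phi> y * cnj (coeff lreg (star f) (abs_l2 h) y) \<partial>haar)"
  by (simp add: integral_coeff_convolve[OF h(1)] coeff_star[OF h(2)])

text \<open>Tested against \<open>h\<close>, the two sides are \<open>\<langle>\<phi>, V\<^sub>f h\<rangle>\<close> and \<open>\<langle>V\<^sub>f\<^sup>* \<phi>, h\<rangle>\<close>.  This is how the
  coefficients of \<open>f\<^sup>*\<close> are seen to be square integrable.\<close>

lemma coeff_star_AE:
  fixes f :: "'g l2"
  assumes f: "bdd f"
  shows "AE x in haar. coeff lreg (star f) \<phi> x = rep_l2 (cadjoint UNIV (V f) \<phi>) x"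
proof -
  let ?u = "coeff lreg (star f) \<phi>" and ?v = "rep_l2 (cadjoint UNIV (V f) \<phi>)"
  have "AE x in haar. ?u x - ?v x = 0"
  proof (rule AE_zero_by_testing)
    show "(\<lambda>x. ?u x - ?v x) \<in> borel_measurable haar"
      using coeff_measurable[of "star f" \<phi>] by measurable
    fix h :: "'g \<Rightarrow> complex"
    assume h: "sq_integrable h" "integrable haar h"
    have [measurable]: "h \<in> borel_measurable haar" using h(2) by simp
    have 1: "integrable haar (\<lambda>x. ?u x * cnj (h x))"
    proof (rule Bochner_Integration.integrable_bound)
      show "integrable haar (\<lambda>x. (norm \<phi> * norm (star f)) * cmod (h x))"
        using h(2) by (intro integrable_mult_right integrable_norm)
      show "(\<lambda>x. ?u x * cnj (h x)) \<in> borel_measurable haar"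
        using coeff_measurable[of "star f" \<phi>] by measurable
      have "norm (?u x * cnj (h x)) \<le> norm \<phi> * norm (star f) * cmod (h x)" for x
        by (simp only: norm_mult complex_mod_cnj) (intro mult_right_mono coeff_bound norm_ge_zero)
      then show "AE x in haar. norm (?u x * cnj (h x)) \<le> norm (norm \<phi> * norm (star f) * cmod (h x))"
        by (intro AE_I2) simp
    qed
    have 2: "integrable haar (\<lambda>x. ?v x * cnj (h x))"
      by (rule integrable_mult_cnj[OF sq_integrable_rep h(1)])
    have "(\<integral>x. ?u x * cnj (h x) \<partial>haar) = (\<integral>y. rep_l2 \<phi> y * cnj (coeff lreg f (abs_l2 h) y) \<partial>haar)"
      using integral_coeff_star[OF h(2,1), of "star f" \<phi>] by simp
    also have "\<dots> = cinner \<phi> (V f (abs_l2 h))"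
      unfolding coeff_op_def by (rule cinner_abs_right[OF bdd_sq_integrable[OF f], symmetric])
    also have "\<dots> = cinner (cadjoint UNIV (V f) \<phi>) (abs_l2 h)"
      by (rule cinner_cadjoint_left[OF V_bounded_clinear[OF f], symmetric])
    also have "\<dots> = (\<integral>x. ?v x * cnj (h x) \<partial>haar)"
      by (rule cinner_abs_right[OF h(1)])
    finally show "(\<integral>x. (?u x - ?v x) * cnj (h x) \<partial>haar) = 0"
      using 1 2 by (simp add: left_diff_distrib)
  qed
  then show ?thesis by simp
qed

lemma
  fixes f :: "'g l2"
  assumes f: "bdd f"
  shows bdd_star: "bdd (star f)" and V_star: "V (star f) = cadjoint UNIV (V f)"
proof -
  have sq: "sq_integrable (coeff lreg (star f) \<phi>)" for \<phi>
  proof -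
    have [measurable]: "coeff lreg (star f) \<phi> \<in> borel_measurable haar" by (rule coeff_measurable)
    have "AE x in haar. (cmod (coeff lreg (star f) \<phi> x))\<^sup>2 = (cmod (rep_l2 (cadjoint UNIV (V f) \<phi>) x))\<^sup>2"
      using coeff_star_AE[OF f, of \<phi>] by eventually_elim simp
    then have "integrable haar (\<lambda>x. (cmod (coeff lreg (star f) \<phi> x))\<^sup>2)
        \<longleftrightarrow> integrable haar (\<lambda>x. (cmod (rep_l2 (cadjoint UNIV (V f) \<phi>) x))\<^sup>2)"
      by (intro integrable_cong_AE) auto
    then show ?thesis
      using sq_integrable_rep[of "cadjoint UNIV (V f) \<phi>"] by (simp add: sq_integrable_def)
  qed
  have "V (star f) \<phi> = cadjoint UNIV (V f) \<phi>" for \<phi>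
    using abs_l2_eqI[OF sq sq_integrable_rep coeff_star_AE[OF f]] by (simp add: coeff_op_def)
  then show eq: "V (star f) = cadjoint UNIV (V f)" by (simp add: fun_eq_iff)
  have "\<exists>C. \<forall>\<phi>. norm (V (star f) \<phi>) \<le> C * norm \<phi>"
    using bounded_clinear_bound[OF bounded_clinear_cadjoint[OF V_bounded_clinear[OF f]]] unfolding eq by metis
  then show "bdd (star f)" using sq by (simp add: bounded_vector_def)
qed

text \<open>\<open>V\<^bsub>f*\<^esub>\<close> is an extension of \<open>g \<mapsto> g * f\<close>.  Two bounded extensions have the same adjoint, because
  differences of values of the adjoints are orthogonal to \<open>C\<^sub>c\<close>.\<close>

lemma conv_op_eq:
  fixes f :: "'g l2"
  assumes f: "bdd f"
  shows "conv_op f = V (star f)"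
  unfolding conv_op_def
proof (rule the_equality)
  have *: "abs_l2 (convolve g (rep_l2 f)) = V (star f) (abs_l2 g)" if "g \<in> Cc" for g
    using coeff_star[OF Cc_integrable(2)[OF that], of f] by (simp add: coeff_op_def)
  note bV = V_bounded_clinear[OF bdd_star[OF f]]
  show "bounded_clinear (V (star f)) \<and> (\<forall>g\<in>Cc. V (star f) (abs_l2 g) = abs_l2 (convolve g (rep_l2 f)))"
    using bV * by simp
  fix A assume A: "bounded_clinear A \<and> (\<forall>g\<in>Cc. A (abs_l2 g) = abs_l2 (convolve g (rep_l2 f)))"
  then have bA: "bounded_clinear A" by blast
  have "cadjoint UNIV A h = cadjoint UNIV (V (star f)) h" for h
  proof -
    have "cadjoint UNIV A h - cadjoint UNIV (V (star f)) h = 0"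
    proof (rule Cc_separating)
      fix g :: "'g \<Rightarrow> complex" assume "g \<in> Cc"
      then have "A (abs_l2 g) = V (star f) (abs_l2 g)" using A * by simp
      then show "cinner (abs_l2 g) (cadjoint UNIV A h - cadjoint UNIV (V (star f)) h) = 0"
        by (simp add: cinner_diff_right cinner_cadjoint[OF bA, symmetric] cinner_cadjoint[OF bV, symmetric])
    qed
    then show ?thesis by simp
  qed
  then have "cadjoint UNIV A = cadjoint UNIV (V (star f))" by (simp add: fun_eq_iff)
  then have "cadjoint UNIV (cadjoint UNIV A) = cadjoint UNIV (cadjoint UNIV (V (star f)))"
    by (rule arg_cong)
  then show "A = V (star f)"
    unfolding cadjoint_cadjoint[OF bA] cadjoint_cadjoint[OF bV] .
qed

end

section \<open>Right convolution operators and the natural trace\<close>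

context unimodular_group
begin

text \<open>Right convolution by \<open>f\<close>, and the adjoint of \<open>V f\<close>, for bounded \<open>f\<close>.\<close>

abbreviation U :: "'g l2 \<Rightarrow> 'g l2 \<Rightarrow> 'g l2" where
  "U f \<equiv> V (star f)"

lemma cadjoint_V: "bdd f \<Longrightarrow> cadjoint UNIV (V f) = U f"
  by (rule V_star[symmetric])

lemma cadjoint_U: "bdd f \<Longrightarrow> cadjoint UNIV (U f) = V f"
  by (simp add: V_star cadjoint_cadjoint[OF V_bounded_clinear])

lemma cinner_V: "bdd f \<Longrightarrow> cinner (V f x) y = cinner x (U f y)"
  using cinner_cadjoint[OF V_bounded_clinear[of f]] by (simp add: cadjoint_V)

lemma cinner_U: "bdd f \<Longrightarrow> cinner (U f x) y = cinner x (V f y)"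
  using cinner_cadjoint[OF V_bounded_clinear[OF bdd_star[of f]]] by (simp add: cadjoint_U)

lemma U_VN_r: "bdd f \<Longrightarrow> U f \<in> VN_r"
  by (rule V_VN_r[OF bdd_star])

lemma U_VN_r_apply:
  assumes S: "S \<in> VN_r" and f: "bdd f"
  shows "U (S f) = S \<circ> U f"
proof -
  have "U (S f) = cadjoint UNIV (V f \<circ> cadjoint UNIV S)"
    by (simp only: cadjoint_V[OF bdd_VN_r[OF S f], symmetric] V_VN_r_apply[OF S])
  also have "\<dots> = S \<circ> U f"
    by (simp only: cadjoint_comp[OF V_bounded_clinear[OF f] bounded_clinear_cadjoint[OF VN_r_bounded[OF S]]]
        cadjoint_cadjoint[OF VN_r_bounded[OF S]] cadjoint_V[OF f])
  finally show ?thesis .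
qed

lemma bdd_V: "bdd a \<Longrightarrow> bdd b \<Longrightarrow> bdd (V a b)"
  by (rule bdd_VN_r[OF V_VN_r])

lemma U_inject:
  assumes f: "bdd f" and g: "bdd g" and eq: "U f = U g"
  shows "f = g"
proof (rule V_inject[OF f g])
  show "V f = V g" using arg_cong[OF eq, of "cadjoint UNIV"] by (simp only: cadjoint_U f g)
qed

text \<open>Both sides have the same operator: \<open>U\<^sub>a U\<^sub>b\<close> is the operator of \<open>U\<^sub>a b\<close>, and its adjoint is
  \<open>V\<^sub>b V\<^sub>a = V\<^sub>b U\<^bsub>a*\<^esub>\<close>.\<close>

lemma star_U:
  assumes a: "bdd a" and b: "bdd b"
  shows "star (U a b) = V b (star a)"
proof (rule U_inject)
  show "bdd (star (U a b))" by (intro bdd_star bdd_V a b)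
  show "bdd (V b (star a))" by (intro bdd_star bdd_V a b)
  have "U (star (U a b)) = cadjoint UNIV (U (U a b))"
    by (simp only: star_star cadjoint_U[OF bdd_VN_r[OF U_VN_r[OF a] b]])
  also have "\<dots> = cadjoint UNIV (U a \<circ> U b)"
    by (simp only: U_VN_r_apply[OF U_VN_r[OF a] b])
  also have "\<dots> = V b \<circ> V a"
    by (simp only: cadjoint_comp V_bounded_clinear bdd_star a b cadjoint_U)
  also have "\<dots> = U (V b (star a))"
    by (simp only: U_VN_r_apply[OF V_VN_r[OF b] bdd_star[OF a]] star_star)
  finally show "U (star (U a b)) = U (V b (star a))" .
qed

text \<open>The projection \<open>q\<close> onto the closed range of \<open>U\<^sub>f\<close> lies in \<open>VN\<close>, so the operator of \<open>q f\<close> is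
  \<open>q U\<^sub>f = U\<^sub>f\<close>; by injectivity \<open>q f = f\<close>.\<close>

lemma bdd_in_closure_range_U:
  assumes f: "bdd f"
  shows "f \<in> closure (range (U f))"
proof -
  let ?M = "closure (range (U f))"
  note bU = V_bounded_clinear[OF bdd_star[OF f]]
  have lin: "A g \<in> ?M" if A: "bounded_clinear A" and AU: "\<And>x. A (U f x) \<in> range (U f)" and g: "g \<in> ?M" for A g
  proof -
    have "A ` ?M \<subseteq> closure (A ` range (U f))"
      using A by (intro closure_bounded_linear_image_subset) (simp add: bounded_clinear_def)
    also have "\<dots> \<subseteq> ?M" using AU by (intro closure_mono) auto
    finally show ?thesis using g by blast
  qed
  interpret M: closed_csubspace ?M
  proof
    show "closed ?M" by simp
    have "g + h \<in> ?M" if gh: "g \<in> ?M" "h \<in> ?M" for g h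
    proof -
      from gh obtain x y where xy: "\<And>n. x n \<in> range (U f)" "x \<longlonglongrightarrow> g" "\<And>n. y n \<in> range (U f)" "y \<longlonglongrightarrow> h"
        unfolding closure_sequential by blast
      have "x n + y n \<in> range (U f)" for n
      proof -
        obtain a b where "x n = U f a" "y n = U f b" using xy(1,3) by (meson rangeE)
        then have "x n + y n = U f (a + b)" by (simp add: bounded_clinear_add[OF bU])
        then show ?thesis by simp
      qed
      moreover have "(\<lambda>n. x n + y n) \<longlonglongrightarrow> g + h" by (intro tendsto_add xy)
      ultimately show ?thesis
        unfolding closure_sequential by (intro exI[of _ "\<lambda>n. x n + y n"]) simp
    qed
    moreover have "0 \<in> ?M"
      using closure_subset[of "range (U f)"] bounded_clinear_zero[OF bU] by (metis rangeI subsetD)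
    moreover have "cscale c g \<in> ?M" if "g \<in> ?M" for c g
      by (rule lin[OF bounded_clinear_cscale_op _ that]) (simp add: bounded_clinear_cscale[OF bU, symmetric])
    ultimately show "csubspace ?M" by (simp add: csubspace_def)
  qed
  have q: "M.p \<in> VN_r"
  proof (rule M.orth_proj_VN_r)
    show "lreg x g \<in> ?M" if "g \<in> ?M" for x g
      by (rule lin[OF bounded_clinear_lreg _ that]) (simp add: VN_r_lreg[OF U_VN_r[OF f], symmetric])
  qed
  have "M.p (U f x) = U f x" for x
    using closure_subset[of "range (U f)"] by (intro M.orth_proj_id) auto
  then have "U (M.p f) = U f"
    by (simp add: U_VN_r_apply[OF q f] fun_eq_iff)
  then have "M.p f = f"
    by (rule U_inject[OF bdd_VN_r[OF q f] f])
  then show ?thesis using M.orth_proj_mem[of f] by simp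
qed

text \<open>The operator \<open>U\<^sub>f\<^sup>* U\<^sub>f\<close> determines \<open>\<parallel>U\<^sub>f x\<parallel>\<close>, and also \<open>V\<^sub>f f\<close>, whose operator it is, hence
  \<open>\<langle>U\<^sub>f x, f\<rangle> = \<langle>x, V\<^sub>f f\<rangle>\<close>.  So \<open>\<langle>U\<^sub>f x, f\<rangle> \<le> \<parallel>U\<^sub>f x\<parallel> \<parallel>g\<parallel>\<close>; let \<open>U\<^sub>f x\<close> tend to \<open>f\<close>.\<close>

lemma norm_le_of_square_eq:
  assumes f: "bdd f" and g: "bdd g" and eq: "V f \<circ> U f = V g \<circ> U g"
  shows "norm f \<le> norm g"
proof (cases "f = 0")
  case False
  have k: "V f f = V g g"
  proof (rule U_inject)
    show "bdd (V f f)" "bdd (V g g)" by (intro bdd_V f g)+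
    show "U (V f f) = U (V g g)"
      by (simp only: U_VN_r_apply[OF V_VN_r[OF f] f] U_VN_r_apply[OF V_VN_r[OF g] g] eq)
  qed
  have n: "norm (U f x) = norm (U g x)" for x
  proof -
    have "cinner (U f x) (U f x) = cinner (U g x) (U g x)"
      using fun_cong[OF eq, of x] by (simp add: cinner_U f g)
    then show ?thesis by (simp add: norm_l2_def)
  qed
  have le: "inner (U f x) f \<le> norm (U f x) * norm g" for x
  proof -
    have "inner (U f x) f = inner (U g x) g"
      by (simp add: inner_l2_def cinner_U f g k)
    also have "\<dots> \<le> norm (U g x) * norm g" by (rule norm_cauchy_schwarz)
    finally show ?thesis by (simp add: n)
  qed
  obtain y where y: "\<And>n. y n \<in> range (U f)" "y \<longlonglongrightarrow> f"
    using bdd_in_closure_range_U[OF f] unfolding closure_sequential by blast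
  have "(\<lambda>n. inner (y n) f) \<longlonglongrightarrow> inner f f" "(\<lambda>n. norm (y n) * norm g) \<longlonglongrightarrow> norm f * norm g"
    by (intro tendsto_intros y)+
  moreover have "inner (y n) f \<le> norm (y n) * norm g" for n
    using y(1)[of n] le by auto
  ultimately have "inner f f \<le> norm f * norm g"
    by (intro LIMSEQ_le) auto
  then have "norm f * norm f \<le> norm f * norm g"
    by (simp add: dot_square_norm power2_eq_square)
  then show ?thesis using False by simp
qed simp

lemma natural_trace_witness:
  assumes "natural_trace T < \<infinity>"
  obtains f where "bdd f" "T = V f \<circ> U f"
proof -
  have "\<exists>f. bdd f \<and> T = cadjoint UNIV (conv_op f) \<circ> conv_op f"
    using assms unfolding natural_trace_def Let_def by (auto split: if_splits)
  then obtain f where f: "bdd f" "T = cadjoint UNIV (conv_op f) \<circ> conv_op f" by blast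
  show thesis
    by (rule that[OF f(1)]) (simp add: f(2) conv_op_eq[OF f(1)] cadjoint_U[OF f(1)])
qed

lemma natural_trace_eq:
  assumes f: "bdd f"
  shows "natural_trace (V f \<circ> U f) = ennreal ((norm f)\<^sup>2)"
proof -
  define P where "P g \<longleftrightarrow> bdd g \<and> V f \<circ> U f = cadjoint UNIV (conv_op g) \<circ> conv_op g" for g
  have P: "P g \<longleftrightarrow> bdd g \<and> V f \<circ> U f = V g \<circ> U g" for g
    unfolding P_def by (rule conj_cong[OF refl]) (simp add: conv_op_eq cadjoint_U)
  have "P f" by (simp add: P f)
  then have "P (SOME g. P g)" by (rule someI)
  then have g: "bdd (SOME g. P g)" "V f \<circ> U f = V (SOME g. P g) \<circ> U (SOME g. P g)"
    unfolding P by simp_all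
  have "norm (SOME g. P g) = norm f"
    by (rule order_antisym[OF norm_le_of_square_eq[OF g(1) f g(2)[symmetric]] norm_le_of_square_eq[OF f g]])
  moreover have "natural_trace (V f \<circ> U f) = (if \<exists>g. P g then ennreal ((norm (SOME g. P g))\<^sup>2) else \<infinity>)"
    unfolding natural_trace_def Let_def P_def by (rule refl)
  moreover have "\<exists>g. P g" using \<open>P f\<close> by (rule exI)
  ultimately show ?thesis by simp
qed

end

section \<open>Admissible and tracial pairs\<close>

locale invariant_subspace = unimodular_group G + closed_csubspace H
  for G :: "'g::lc_group itself" and H :: "'g l2 set" +
  assumes invariant: "\<And>x f. f \<in> H \<Longrightarrow> lreg x f \<in> H"
begin

lemma p_VN_r: "p \<in> VN_r"
  by (rule orth_proj_VN_r[OF invariant])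

lemma p_comp_p: "p \<circ> p = p"
  by (simp add: fun_eq_iff orth_proj_idem)

lemma coeff_orth_proj:
  assumes "\<eta> \<in> H"
  shows "coeff lreg \<eta> (p \<phi>) = coeff lreg \<eta> \<phi>"
  by (simp add: coeff_def fun_eq_iff cinner_orth_proj_mem[OF invariant[OF assms]])

lemma V_orth_proj: "\<eta> \<in> H \<Longrightarrow> V \<eta> (p \<phi>) = V \<eta> \<phi>"
  by (simp add: coeff_op_def coeff_orth_proj)

lemma U_mem:
  assumes \<eta>: "\<eta> \<in> H" "bdd \<eta>"
  shows "U \<eta> x \<in> H"
proof -
  have "p \<circ> U \<eta> = U \<eta>"
    using U_VN_r_apply[OF p_VN_r \<eta>(2)] by (simp add: orth_proj_id[OF \<eta>(1)])
  then have "p (U \<eta> x) = U \<eta> x" by (metis comp_apply)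
  then show ?thesis using orth_proj_mem[of "U \<eta> x"] by simp
qed

text \<open>Coefficients of \<open>\<eta>\<close> in \<open>H\<close> see only the projection of \<open>\<phi>\<close> to \<open>H\<close>.\<close>

lemma bounded_vector_iff: "bounded_vector lreg H \<eta> \<longleftrightarrow> \<eta> \<in> H \<and> bdd \<eta>"
proof
  assume *: "bounded_vector lreg H \<eta>"
  then have \<eta>: "\<eta> \<in> H" by (simp add: bounded_vector_def)
  obtain C where C: "\<And>\<phi>. \<phi> \<in> H \<Longrightarrow> norm (V \<eta> \<phi>) \<le> C * norm \<phi>"
    using * by (auto simp: bounded_vector_def)
  obtain K where K: "\<And>f. norm (p f) \<le> K * norm f"
    using bounded_clinear_bound[OF bounded_clinear_orth_proj] by blast
  have "norm (V \<eta> \<phi>) \<le> (\<bar>C\<bar> * K) * norm \<phi>" for \<phi>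
  proof -
    have "norm (V \<eta> \<phi>) \<le> C * norm (p \<phi>)"
      using C[OF orth_proj_mem, of \<phi>] by (simp add: V_orth_proj[OF \<eta>])
    also have "\<dots> \<le> \<bar>C\<bar> * norm (p \<phi>)" by (intro mult_right_mono) auto
    also have "\<dots> \<le> \<bar>C\<bar> * (K * norm \<phi>)" by (intro mult_left_mono K) simp
    finally show ?thesis by simp
  qed
  moreover have "sq_integrable (coeff lreg \<eta> \<phi>)" for \<phi>
    using * orth_proj_mem[of \<phi>] coeff_orth_proj[OF \<eta>, of \<phi>] unfolding bounded_vector_def by metis
  ultimately show "\<eta> \<in> H \<and> bdd \<eta>"
    using \<eta> by (auto simp: bounded_vector_def)
qed (auto simp: bounded_vector_def)

lemma cadjoint_H_V:
  assumes \<eta>: "\<eta> \<in> H" "bdd \<eta>"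
  shows "cadjoint H (V \<eta>) f = U \<eta> f"
  unfolding cadjoint_def
proof (rule the_equality)
  show "U \<eta> f \<in> H \<and> (\<forall>k\<in>H. cinner (V \<eta> k) f = cinner k (U \<eta> f))"
    using U_mem[OF \<eta>] by (simp add: cinner_V \<eta>)
  fix h assume h: "h \<in> H \<and> (\<forall>k\<in>H. cinner (V \<eta> k) f = cinner k h)"
  have "h - U \<eta> f \<in> H"
    using h U_mem[OF \<eta>] by (intro csubspace_diff csubspace) auto
  then have "cinner (h - U \<eta> f) h = cinner (h - U \<eta> f) (U \<eta> f)"
    using h by (metis cinner_V \<eta>(2))
  then have "cinner (h - U \<eta> f) (h - U \<eta> f) = 0" by (simp add: cinner_diff_right)
  then show "h = U \<eta> f" using cinner_eq_0[of "h - U \<eta> f"] by simp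
qed

lemma admissible_iff:
  "admissible lreg H \<eta> \<psi> \<longleftrightarrow> \<eta> \<in> H \<and> bdd \<eta> \<and> \<psi> \<in> H \<and> bdd \<psi> \<and> U \<eta> \<circ> V \<psi> = p"
proof -
  have "(\<forall>\<phi>\<in>H. cadjoint H (V \<eta>) (V \<psi> \<phi>) = \<phi>) \<longleftrightarrow> U \<eta> \<circ> V \<psi> = p"
    if \<eta>: "\<eta> \<in> H" "bdd \<eta>" and \<psi>: "\<psi> \<in> H" "bdd \<psi>"
  proof
    assume *: "\<forall>\<phi>\<in>H. cadjoint H (V \<eta>) (V \<psi> \<phi>) = \<phi>"
    show "U \<eta> \<circ> V \<psi> = p"
    proof
      fix \<phi>
      have "U \<eta> (V \<psi> (p \<phi>)) = p \<phi>"
        using * orth_proj_mem[of \<phi>] by (simp add: cadjoint_H_V[OF \<eta>])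
      then show "(U \<eta> \<circ> V \<psi>) \<phi> = p \<phi>" by (simp add: V_orth_proj[OF \<psi>(1)])
    qed
  next
    assume "U \<eta> \<circ> V \<psi> = p"
    then show "\<forall>\<phi>\<in>H. cadjoint H (V \<eta>) (V \<psi> \<phi>) = \<phi>"
      by (auto simp: cadjoint_H_V[OF \<eta>] fun_eq_iff orth_proj_id)
  qed
  then show ?thesis
    unfolding admissible_def bounded_vector_iff by blast
qed

lemma reduced_VN_iff: "T \<in> reduced_VN H \<longleftrightarrow> T \<in> VN_r \<and> p \<circ> T = T \<and> T \<circ> p = T"
proof
  assume "T \<in> reduced_VN H"
  then obtain S where S: "S \<in> VN_r" "T = p \<circ> S \<circ> p" by (auto simp: reduced_VN_def)
  show "T \<in> VN_r \<and> p \<circ> T = T \<and> T \<circ> p = T"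
    unfolding S(2) using VN_r_comp[OF VN_r_comp[OF p_VN_r S(1)] p_VN_r] by (simp add: orth_proj_idem fun_eq_iff)
next
  assume "T \<in> VN_r \<and> p \<circ> T = T \<and> T \<circ> p = T"
  then show "T \<in> reduced_VN H"
    unfolding reduced_VN_def by (intro CollectI exI[of _ T]) auto
qed

lemma p_positive: "p \<in> positive_part (reduced_VN H)"
proof -
  have "cinner (p f) f = complex_of_real ((norm (p f))\<^sup>2)" for f
    using cinner_orth_proj[of "p f" f] by (simp only: orth_proj_idem cinner_self_norm)
  then show ?thesis
    by (simp add: positive_part_def reduced_VN_iff p_VN_r p_comp_p complex_nonneg_Reals_iff)
qed

text \<open>The computation is
  \<open>\<parallel>h\<parallel>\<^sup>2 = \<langle>U\<^sub>a \<psi>\<^sup>*, h\<rangle> = \<langle>\<psi>\<^sup>*, V\<^sub>a h\<^sup>*\<rangle> = \<langle>\<psi>\<^sup>*, (U\<^sub>h a)\<^sup>*\<rangle> = \<langle>U\<^sub>h a, \<psi>\<rangle>\<close>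
  with \<open>a = S \<eta>\<close> and \<open>U\<^sub>h = S\<close>.  A square root is needed because finiteness of the trace asks for a
  factorization of \<open>T\<close>.\<close>

lemma admissible_imp_trace:
  assumes \<eta>: "\<eta> \<in> H" "bdd \<eta>" and \<psi>: "\<psi> \<in> H" "bdd \<psi>" and adm: "U \<eta> \<circ> V \<psi> = p"
    and T: "T \<in> positive_part (reduced_VN H)"
  shows "natural_trace T < \<infinity> \<and> complex_of_real (enn2real (natural_trace T)) = cinner (T \<eta>) \<psi>"
proof -
  have TV: "T \<in> VN_r" and Tp: "T \<circ> p = T" and pos: "\<And>f. cinner (T f) f \<in> \<real>\<^sub>\<ge>\<^sub>0"
    using T by (auto simp: positive_part_def reduced_VN_iff)
  obtain S where S: "S \<in> VN_r" "cadjoint UNIV S = S" "S \<circ> S = T"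
    using VN_r_sqrt[OF TV pos] by blast
  note bS = VN_r_bounded[OF S(1)]
  \<comment> \<open>\<open>\<parallel>S y\<parallel>\<^sup>2 = \<langle>y, T y\<rangle>\<close> vanishes for \<open>y = x - p x\<close>\<close>
  have Sp: "S \<circ> p = S"
  proof
    fix x
    have "cinner (S (x - p x)) (S (x - p x)) = cinner (x - p x) (T (x - p x))"
      using cinner_cadjoint[OF bS, of "x - p x" "S (x - p x)"] S(2,3) by (auto simp: fun_eq_iff)
    also have "T (x - p x) = 0"
      using fun_cong[OF Tp, of x] by (simp add: bounded_clinear_diff[OF VN_r_bounded[OF TV]])
    finally have "S (x - p x) = 0" using cinner_eq_0[of "S (x - p x)"] by simp
    then show "(S \<circ> p) x = S x" by (simp add: bounded_clinear_diff[OF bS])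
  qed
  define a where "a = S \<eta>"
  define h where "h = U a (star \<psi>)"
  have a: "bdd a" unfolding a_def by (rule bdd_VN_r[OF S(1) \<eta>(2)])
  have h: "bdd h" unfolding h_def by (rule bdd_VN_r[OF U_VN_r[OF a] bdd_star[OF \<psi>(2)]])
  have Ua: "U a = S \<circ> U \<eta>" unfolding a_def by (rule U_VN_r_apply[OF S(1) \<eta>(2)])
  have "U h = U a \<circ> V \<psi>"
    using U_VN_r_apply[OF U_VN_r[OF a] bdd_star[OF \<psi>(2)]] by (simp add: h_def)
  also have "\<dots> = S \<circ> (U \<eta> \<circ> V \<psi>)" by (simp add: Ua o_assoc)
  finally have Uh: "U h = S" by (simp only: adm Sp)
  then have Vh: "V h = S" using cadjoint_U[OF h] S(2) by simp
  have star_h: "star h = h"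
    by (rule U_inject[OF bdd_star[OF h] h]) (simp add: Uh Vh)
  have "natural_trace T = ennreal ((norm h)\<^sup>2)"
    using natural_trace_eq[OF h] by (simp add: Uh Vh S(3))
  moreover have "complex_of_real ((norm h)\<^sup>2) = cinner (T \<eta>) \<psi>"
  proof -
    have "complex_of_real ((norm h)\<^sup>2) = cinner (U a (star \<psi>)) h"
      by (simp only: cinner_self_norm[symmetric] h_def)
    also have "\<dots> = cinner (star \<psi>) (V a h)" by (rule cinner_U[OF a])
    also have "V a h = star (U h a)" using star_U[OF h a] by (simp only: star_h)
    also have "cinner (star \<psi>) (star (U h a)) = cinner (U h a) \<psi>" by (rule cinner_star)
    also have "U h a = T \<eta>" using S(3) by (auto simp: Uh a_def fun_eq_iff)
    finally show ?thesis .
  qed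
  ultimately show ?thesis by simp
qed

text \<open>The vector \<open>k\<close> is the unit of the algebra of bounded vectors in \<open>H\<close>: its operator is \<open>p\<close>.\<close>

lemma finite_trace_imp_unit:
  assumes "natural_trace p < \<infinity>"
  obtains k where "k \<in> H" "bdd k" "U k = p" "V k = p" "star k = k"
proof -
  obtain f where f: "bdd f" "p = V f \<circ> U f"
    using natural_trace_witness[OF assms] by blast
  define k where "k = V f f"
  have k: "bdd k" unfolding k_def by (intro bdd_V f)
  have Uk: "U k = p" unfolding k_def f(2) by (rule U_VN_r_apply[OF V_VN_r[OF f(1)] f(1)])
  have Vk: "V k = p" using cadjoint_U[OF k] by (simp only: Uk cadjoint_orth_proj)
  have "U (p k) = U k" by (simp only: U_VN_r_apply[OF p_VN_r k] Uk p_comp_p)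
  then have "p k = k" by (rule U_inject[OF bdd_VN_r[OF p_VN_r k] k])
  then have "k \<in> H" using orth_proj_mem[of k] by simp
  moreover have "star k = k"
    by (rule U_inject[OF bdd_star[OF k] k]) (simp add: Uk Vk)
  ultimately show thesis using that k Uk Vk by blast
qed

lemma tracial_imp_admissible:
  assumes \<eta>: "\<eta> \<in> H" "bdd \<eta>" and \<psi>: "\<psi> \<in> H" "bdd \<psi>"
    and tr: "tracial (reduced_VN H) natural_trace \<eta> \<psi>"
  shows "U \<eta> \<circ> V \<psi> = p"
proof -
  have "natural_trace p < \<infinity>" using tr p_positive by (auto simp: tracial_def)
  then obtain k where k: "k \<in> H" "bdd k" "U k = p" "V k = p" "star k = k"
    using finite_trace_imp_unit by blast
  have admk: "U k \<circ> V k = p" by (simp only: k p_comp_p)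
  \<comment> \<open>apply the two trace formulas to \<open>A\<^sup>* A\<close>\<close>
  have diag: "cinner (A \<eta>) (A \<psi>) = cinner (A k) (A k)" if A: "A \<in> reduced_VN H" for A
  proof -
    have AV: "A \<in> VN_r" and pA: "p \<circ> A = A" and Ap: "A \<circ> p = A" using A by (auto simp: reduced_VN_iff)
    note bA = VN_r_bounded[OF AV]
    let ?T = "cadjoint UNIV A \<circ> A"
    have pA': "p \<circ> cadjoint UNIV A = cadjoint UNIV A"
      using cadjoint_comp[OF bA bounded_clinear_orth_proj] by (simp only: Ap cadjoint_orth_proj)
    have form: "cinner (?T x) y = cinner (A x) (A y)" for x y
      by (simp add: cinner_cadjoint_left[OF bA])
    have "?T \<in> VN_r" by (intro VN_r_comp VN_r_cadjoint AV)
    moreover have "p \<circ> ?T = ?T" by (simp only: o_assoc pA')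
    moreover have "?T \<circ> p = ?T" by (simp only: o_assoc[symmetric] Ap)
    ultimately have T: "?T \<in> positive_part (reduced_VN H)"
      by (simp add: positive_part_def reduced_VN_iff form[unfolded o_def] cinner_self_norm complex_nonneg_Reals_iff)
    have "cinner (?T \<eta>) \<psi> = cinner (?T k) k"
      using tr T admissible_imp_trace[OF k(1,2) k(1,2) admk T] unfolding tracial_def by metis
    then show ?thesis by (simp only: form)
  qed
  have comb: "(\<lambda>f. T f + cscale c (p f)) \<in> reduced_VN H" if "T \<in> reduced_VN H" for T c
    using that VN_r_combination[OF _ p_VN_r, of T c]
    by (auto simp: reduced_VN_iff fun_eq_iff orth_proj_idem bounded_clinear_add[OF bounded_clinear_orth_proj]
        bounded_clinear_cscale[OF bounded_clinear_orth_proj])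
  \<comment> \<open>polarize with \<open>A = T + p\<close> and \<open>A = T + \<i> p\<close>\<close>
  have polar: "cinner (T \<eta>) \<psi> = cinner (T k) k" if T: "T \<in> reduced_VN H" for T
  proof -
    have pp: "p \<eta> = \<eta>" "p \<psi> = \<psi>" "p k = k" using \<eta> \<psi> k by (auto intro: orth_proj_id)
    have d0: "cinner \<eta> \<psi> = cinner k k"
      using diag[of p] p_positive by (simp add: positive_part_def pp)
    have "cinner (T \<eta> + \<eta>) (T \<psi> + \<psi>) = cinner (T k + k) (T k + k)"
      using diag[OF comb[OF T, of 1]] by (simp add: pp)
    then have 1: "cinner (T \<eta>) \<psi> + cinner \<eta> (T \<psi>) = cinner (T k) k + cinner k (T k)"
      using diag[OF T] d0 by (simp add: cinner_add_left cinner_add_right add.commute)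
    have "cinner (T \<eta> + cscale \<i> \<eta>) (T \<psi> + cscale \<i> \<psi>) = cinner (T k + cscale \<i> k) (T k + cscale \<i> k)"
      using diag[OF comb[OF T, of \<i>]] by (simp add: pp)
    then have "\<i> * (cinner \<eta> (T \<psi>) - cinner (T \<eta>) \<psi>) = \<i> * (cinner k (T k) - cinner (T k) k)"
      using diag[OF T] d0
      by (simp add: cinner_add_left cinner_add_right cinner_cscale_left cinner_cscale_right algebra_simps)
    then have 2: "cinner \<eta> (T \<psi>) - cinner (T \<eta>) \<psi> = cinner k (T k) - cinner (T k) k" by simp
    have double: "2 * a = (a + b) - (b - a)" for a b :: complex by simp
    have "2 * cinner (T \<eta>) \<psi> = 2 * cinner (T k) k"
      unfolding double[of "cinner (T \<eta>) \<psi>" "cinner \<eta> (T \<psi>)"] double[of "cinner (T k) k" "cinner k (T k)"]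
      by (simp only: 1 2)
    then show ?thesis by simp
  qed
  define d where "d = U \<eta> (star \<psi>)"
  have d: "bdd d" unfolding d_def by (intro bdd_V bdd_star \<eta> \<psi>)
  have Ud: "U d = U \<eta> \<circ> V \<psi>"
    using U_VN_r_apply[OF U_VN_r[OF \<eta>(2)] bdd_star[OF \<psi>(2)]] by (simp add: d_def)
  have star_d: "star d = U \<psi> (star \<eta>)"
    unfolding d_def by (rule star_U[OF \<eta>(2) bdd_star[OF \<psi>(2)]])
  have Vd: "V d = U \<psi> \<circ> V \<eta>"
    using cadjoint_U[OF d] cadjoint_comp[OF V_bounded_clinear[OF bdd_star[OF \<eta>(2)]] V_bounded_clinear[OF \<psi>(2)]]
    by (simp add: Ud cadjoint_U \<eta> cadjoint_V \<psi>)
  have Vdp: "V d \<circ> p = V d" by (simp add: Vd fun_eq_iff V_orth_proj[OF \<eta>(1)])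
  have pVd: "p \<circ> V d = V d" by (simp add: Vd fun_eq_iff orth_proj_id[OF U_mem[OF \<psi>]])
  \<comment> \<open>\<open>T \<eta> = U\<^bsub>Tk\<^esub> \<eta>\<close>, so \<open>\<langle>T \<eta>, \<psi>\<rangle> = \<langle>\<eta>, (V\<^sub>\<psi> T k)\<^sup>*\<rangle> = \<langle>V\<^sub>\<psi> T k, \<eta>\<^sup>*\<rangle>\<close>\<close>
  have pair: "cinner (T \<eta>) \<psi> = cinner (T k) (star d)" if T: "T \<in> VN_r" for T
  proof -
    have Tk: "bdd (T k)" by (rule bdd_VN_r[OF T k(2)])
    have "T \<eta> = U (T k) \<eta>"
      using orth_proj_id[OF \<eta>(1)] by (simp add: U_VN_r_apply[OF T k(2)] k(3))
    then have "cinner (T \<eta>) \<psi> = cinner \<eta> (V (T k) \<psi>)" by (simp add: cinner_U[OF Tk])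
    also have "V (T k) \<psi> = star (V \<psi> (T k))"
      using star_U[OF bdd_star[OF \<psi>(2)] Tk] by simp
    also have "cinner \<eta> (star (V \<psi> (T k))) = cinner (V \<psi> (T k)) (star \<eta>)"
      using cinner_star[of "star \<eta>" "V \<psi> (T k)"] by simp
    also have "\<dots> = cinner (T k) (star d)" by (simp add: cinner_V[OF \<psi>(2)] star_d)
    finally show ?thesis .
  qed
  \<comment> \<open>chosen so that \<open>T k\<close> is the vector \<open>star d - k\<close> to which it is orthogonal\<close>
  define T where "T f = V d f - p f" for f
  have TV: "T \<in> VN_r" unfolding T_def by (intro VN_r_diff V_VN_r d p_VN_r)
  have TR: "T \<in> reduced_VN H"
    using TV fun_cong[OF Vdp] fun_cong[OF pVd]
    by (simp add: reduced_VN_iff) (simp add: T_def fun_eq_iff orth_proj_idem bounded_clinear_diff[OF bounded_clinear_orth_proj])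
  have "V d k = star d"
  proof (rule U_inject)
    show "bdd (V d k)" by (intro bdd_V d k)
    show "bdd (star d)" by (rule bdd_star[OF d])
    show "U (V d k) = U (star d)" by (simp only: U_VN_r_apply[OF V_VN_r[OF d] k(2)] k(3) Vdp star_star)
  qed
  then have Tk: "T k = star d - k" by (simp add: T_def orth_proj_id[OF k(1)])
  have "cinner (T k) (star d - k) = 0"
    using pair[OF TV] polar[OF TR] by (simp add: cinner_diff_right)
  then have "star d = k" using cinner_eq_0[of "star d - k"] by (simp add: Tk)
  then have "d = k" using star_star[of d] k(5) by simp
  then show ?thesis using Ud k(3) by simp
qed

end

theorem theorem2p2:
  fixes H :: "'g::lc_group l2 set"
  assumes "unimodular TYPE('g)"
    and "csubspace H" and "closed H"
    and "\<And>x f. f \<in> H \<Longrightarrow> lreg x f \<in> H"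
  shows "((\<exists>\<eta> \<psi>. admissible lreg H \<eta> \<psi>) \<longleftrightarrow> natural_trace (orth_proj H) < \<infinity>) \<and>
    (\<forall>\<eta> \<psi>. bounded_vector lreg H \<eta> \<and> bounded_vector lreg H \<psi> \<longrightarrow>
      (admissible lreg H \<eta> \<psi> \<longleftrightarrow> tracial (reduced_VN H) natural_trace \<eta> \<psi>))"
proof -
  interpret invariant_subspace "TYPE('g)" H
    by unfold_locales (use assms in auto)
  show ?thesis
  proof (intro conjI iffI allI impI)
    assume "\<exists>\<eta> \<psi>. admissible lreg H \<eta> \<psi>"
    then show "natural_trace p < \<infinity>"
      using admissible_imp_trace[OF _ _ _ _ _ p_positive] unfolding admissible_iff by blast
  next
    assume "natural_trace p < \<infinity>"
    then obtain k where "k \<in> H" "bdd k" "U k = p" "V k = p" "star k = k"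
      using finite_trace_imp_unit by blast
    then have "admissible lreg H k k" by (simp add: admissible_iff p_comp_p)
    then show "\<exists>\<eta> \<psi>. admissible lreg H \<eta> \<psi>" by blast
  next
    fix \<eta> \<psi>
    assume "admissible lreg H \<eta> \<psi>"
    then show "tracial (reduced_VN H) natural_trace \<eta> \<psi>"
      unfolding tracial_def admissible_iff using admissible_imp_trace by blast
  next
    fix \<eta> \<psi>
    assume "bounded_vector lreg H \<eta> \<and> bounded_vector lreg H \<psi>" "tracial (reduced_VN H) natural_trace \<eta> \<psi>"
    then show "admissible lreg H \<eta> \<psi>"
      unfolding admissible_iff bounded_vector_iff using tracial_imp_admissible by blast
  qed
qed

end
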